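(* Let $K\ge 1$ and let $S=(s_{lk})_{l,k=1}^K$ be a symmetric real $K\times K$ matrix with non-negative entries that has support. Let $\rho$ be the Lebesgue density of the self-consistent density of states associated to $S$, i.e. of the probability measure on $\mathbb{R}$ whose Stieltjes transform is $\frac1K\sum_{k=1}^K m_k(z)$, where $(m_1(z),\dots,m_K(z))$ is the unique solution with $\operatorname{Im} m_k(z)>0$ for all $k$ of $$-\frac{1}{m_l(z)} = z+\sum_{k=1}^K s_{lk}\,m_k(z),\qquad l=1,\dots,K,\ \operatorname{Im} z>0 .$$ Then $\rho$ has a singularity at the origin of degree $\sigma=\frac{\ell_\lhd(S)}{\ell_\lhd(S)+2}$, i.e. the limit $$\lim_{\tau\to 0}|\tau|^{\sigma}\rho(\tau)$$ exists as a finite, strictly positive number.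
   Context: Stieltjes transform convention: the Stieltjes transform of a probability measure $\mu$ on $\mathbb{R}$ is $z\mapsto\int\frac{\mu(d\tau)}{\tau-z}$, $\operatorname{Im}z>0$. It is known that the equation has a unique solution with positive imaginary parts, that it gives rise to a probability measure in this way, and that this measure has a Lebesgue density on $\mathbb{R}\setminus\{0\}$, bounded away from $0$; $\rho(\tau)$ denotes its representative continuous on $\mathbb{R}\setminus\{0\}$ (given by $\pi\rho(\tau)=\lim_{\eta\downarrow0}\frac1K\sum_k\operatorname{Im}m_k(\tau+i\eta)$). A non-negative matrix $R\in\mathbb{R}^{K\times K}$ has support if there is a permutation $\pi$ of $\{1,\dots,K\}$ with $r_{i\pi(i)}>0$ for all $i$. A non-negative matrix $R\in\mathbb{R}^{k\times k}$ is fully indecomposable (FID) if for all nonempty $I,J\subset\{1,\dots,k\}$ with $|I|+|J|\ge k$ the submatrix $(r_{ij})_{i\in I,j\in J}$ is not identically zero. Normal form. Let $L,M\ge0$ be integers with $L+2M\ge 1$. For $i\in\{1,\dots,L+2M\}$ define the complement index $\hat i:=i$ if $M<i\le M+L$, and $\hat i:=L+2M+1-i$ otherwise. A symmetric non-negative matrix $R\in\mathbb{R}^{K\times K}$ is in normal form if, for some such $L,M$ and block dimensions $k_1,\dots,k_{L+2M}\ge1$ with $k_{\hat i}=k_i$ and $\sum_i k_i=K$, when $R=(R_{ij})_{i,j=1}^{L+2M}$ is divided into consecutive blocks $R_{ij}\in\mathbb{R}^{k_i\times k_j}$, the following hold: (a) $R_{i\hat i}$ is FID for every $i$; (b) $R_{ij}=0$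 if $i\neq j$ and $M<i,j\le M+L$; (c) $R_{ij}=0$ if $M<i\le M+L<j$, or $M<j\le M+L<i$, or $i,j>M+L$; (d) $R_{ij}=0$ if ($i\le M$, $j>M+L$ or $j\le M$, $i>M+L$) and $i+j>L+2M+1$. All other blocks are arbitrary (subject to symmetry). Every symmetric non-negative $R$ with support can be brought into normal form $PRP^t$ by some permutation matrix $P$. Given a normal form of $R$, its 0-1 mask is $T=(t_{ij})\in\{0,1\}^{(L+2M)\times(L+2M)}$ with $t_{ij}=0$ if and only if the $(i,j)$ block of the normal form is the zero matrix. For distinct $i,j\in\{1,\dots,L+2M\}$ write $i\lhd j$ if $t_{i\hat j}=1$. An increasing sequence is a sequence $i_0\lhd i_1\lhd\dots\lhd i_k$, and $k\ge 0$ is its length. $\ell_\lhd(R)$ is the length of the longest increasing sequence; it does not depend on the choice of normal form. *)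

theory Defs
  imports "HOL-Probability.Probability" "HOL-Combinatorics.Permutations"
begin

text \<open>
  A \<open>n \<times> n\<close> matrix is a function \<open>A :: nat \<Rightarrow> nat \<Rightarrow> real\<close>; only the entries \<open>A i j\<close> with
  \<open>i, j \<in> {1..n}\<close> are meaningful, and every notion below depends on these alone.
\<close>

definition symmetric_matrix :: "nat \<Rightarrow> (nat \<Rightarrow> nat \<Rightarrow> real) \<Rightarrow> bool" where
  "symmetric_matrix n A \<longleftrightarrow> (\<forall>i\<in>{1..n}. \<forall>j\<in>{1..n}. A i j = A j i)"

definition nonneg_matrix :: "nat \<Rightarrow> (nat \<Rightarrow> nat \<Rightarrow> real) \<Rightarrow> bool" where
  "nonneg_matrix n A \<longleftrightarrow> (\<forall>i\<in>{1..n}. \<forall>j\<in>{1..n}. 0 \<le> A i j)"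

definition has_support :: "nat \<Rightarrow> (nat \<Rightarrow> nat \<Rightarrow> real) \<Rightarrow> bool" where
  "has_support n A \<longleftrightarrow> (\<exists>p. p permutes {1..n} \<and> (\<forall>i\<in>{1..n}. A i (p i) > 0))"

definition fully_indecomposable :: "nat \<Rightarrow> (nat \<Rightarrow> nat \<Rightarrow> real) \<Rightarrow> bool" where
  "fully_indecomposable n A \<longleftrightarrow>
     (\<forall>I J. I \<subseteq> {1..n} \<and> J \<subseteq> {1..n} \<and> I \<noteq> {} \<and> J \<noteq> {} \<and> n \<le> card I + card J \<longrightarrow>
        (\<exists>i\<in>I. \<exists>j\<in>J. A i j \<noteq> 0))"


section \<open>Normal form\<close>

definition compl_index :: "nat \<Rightarrow> nat \<Rightarrow> nat \<Rightarrow> nat" where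
  "compl_index L M i = (if M < i \<and> i \<le> M + L then i else L + 2 * M + 1 - i)"

text \<open>
  The blocks are consecutive: block row \<open>i\<close> consists of the rows \<open>k 1 + \<dots> + k (i - 1) + a\<close>
  with \<open>a \<in> {1..k i}\<close>.
\<close>

definition block :: "(nat \<Rightarrow> nat) \<Rightarrow> (nat \<Rightarrow> nat \<Rightarrow> real) \<Rightarrow> nat \<Rightarrow> nat \<Rightarrow> nat \<Rightarrow> nat \<Rightarrow> real" where
  "block k R i j = (\<lambda>a b. R ((\<Sum>l\<in>{1..<i}. k l) + a) ((\<Sum>l\<in>{1..<j}. k l) + b))"

definition zero_block :: "(nat \<Rightarrow> nat) \<Rightarrow> (nat \<Rightarrow> nat \<Rightarrow> real) \<Rightarrow> nat \<Rightarrow> nat \<Rightarrow> bool" where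
  "zero_block k R i j \<longleftrightarrow> (\<forall>a\<in>{1..k i}. \<forall>b\<in>{1..k j}. block k R i j a b = 0)"

definition normal_form ::
    "nat \<Rightarrow> (nat \<Rightarrow> nat \<Rightarrow> real) \<Rightarrow> nat \<Rightarrow> nat \<Rightarrow> (nat \<Rightarrow> nat) \<Rightarrow> bool" where
  "normal_form K R L M k \<longleftrightarrow>
     symmetric_matrix K R \<and> nonneg_matrix K R \<and>
     1 \<le> L + 2 * M \<and>
     (\<forall>i\<in>{1..L + 2 * M}. 1 \<le> k i \<and> k (compl_index L M i) = k i) \<and>
     (\<Sum>i\<in>{1..L + 2 * M}. k i) = K \<and>
     (\<forall>i\<in>{1..L + 2 * M}. fully_indecomposable (k i) (block k R i (compl_index L M i))) \<and>
     (\<forall>i\<in>{1..L + 2 * M}. \<forall>j\<in>{1..L + 2 * M}.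
        (i \<noteq> j \<and> M < i \<and> i \<le> M + L \<and> M < j \<and> j \<le> M + L \<longrightarrow> zero_block k R i j) \<and>
        ((M < i \<and> i \<le> M + L \<and> M + L < j) \<or>
         (M < j \<and> j \<le> M + L \<and> M + L < i) \<or>
         (M + L < i \<and> M + L < j) \<longrightarrow> zero_block k R i j) \<and>
        (((i \<le> M \<and> M + L < j) \<or> (j \<le> M \<and> M + L < i)) \<and> L + 2 * M + 1 < i + j
           \<longrightarrow> zero_block k R i j))"

definition zero_one_mask :: "(nat \<Rightarrow> nat) \<Rightarrow> (nat \<Rightarrow> nat \<Rightarrow> real) \<Rightarrow> nat \<Rightarrow> nat \<Rightarrow> nat" where
  "zero_one_mask k R i j = (if zero_block k R i j then 0 else 1)"

definition lhd :: "nat \<Rightarrow> nat \<Rightarrow> (nat \<Rightarrow> nat \<Rightarrow> nat) \<Rightarrow> nat \<Rightarrow> nat \<Rightarrow> bool" where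
  "lhd L M T i j \<longleftrightarrow> i \<noteq> j \<and> T i (compl_index L M j) = 1"

definition increasing_seq ::
    "nat \<Rightarrow> nat \<Rightarrow> (nat \<Rightarrow> nat \<Rightarrow> nat) \<Rightarrow> nat \<Rightarrow> (nat \<Rightarrow> nat) \<Rightarrow> bool" where
  "increasing_seq L M T n s \<longleftrightarrow>
     (\<forall>a\<le>n. s a \<in> {1..L + 2 * M}) \<and> (\<forall>a<n. lhd L M T (s a) (s (Suc a)))"

text \<open>
  For the mask of a normal form, \<open>lhd L M T i j\<close> implies \<open>i < j\<close>, so the set of lengths below is
  finite (and contains 0).
\<close>

definition longest_increasing :: "nat \<Rightarrow> nat \<Rightarrow> (nat \<Rightarrow> nat \<Rightarrow> nat) \<Rightarrow> nat" where
  "longest_increasing L M T = Max {n. \<exists>s. increasing_seq L M T n s}"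

text \<open>
  \<open>\<lambda>i j. R (p i) (p j)\<close> is \<open>P R P\<^sup>t\<close> for the permutation matrix \<open>P\<close> whose row \<open>i\<close> has its 1 in
  column \<open>p i\<close>. The definite description is justified for symmetric non-negative \<open>R\<close> with
  support: a normal form exists, and all normal forms yield the same length.
\<close>

definition ell_lhd :: "nat \<Rightarrow> (nat \<Rightarrow> nat \<Rightarrow> real) \<Rightarrow> nat" where
  "ell_lhd K R = (THE n. \<exists>p L M k. p permutes {1..K} \<and>
     normal_form K (\<lambda>i j. R (p i) (p j)) L M k \<and>
     n = longest_increasing L M (zero_one_mask k (\<lambda>i j. R (p i) (p j))))"


section \<open>Self-consistent density of states\<close>

definition stieltjes :: "real measure \<Rightarrow> complex \<Rightarrow> complex" where
  "stieltjes \<mu> z = (\<integral>\<tau>. 1 / (complex_of_real \<tau> - z) \<partial>\<mu>)"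

definition solves_qve ::
    "nat \<Rightarrow> (nat \<Rightarrow> nat \<Rightarrow> real) \<Rightarrow> (nat \<Rightarrow> complex \<Rightarrow> complex) \<Rightarrow> bool" where
  "solves_qve K S m \<longleftrightarrow>
     (\<forall>z. Im z > 0 \<longrightarrow> (\<forall>l\<in>{1..K}. Im (m l z) > 0 \<and>
        - 1 / m l z = z + (\<Sum>k\<in>{1..K}. complex_of_real (S l k) * m k z)))"

definition is_scdos :: "nat \<Rightarrow> (nat \<Rightarrow> nat \<Rightarrow> real) \<Rightarrow> real measure \<Rightarrow> bool" where
  "is_scdos K S \<mu> \<longleftrightarrow> real_distribution \<mu> \<and>
     (\<exists>m. solves_qve K S m \<and>
        (\<forall>z. Im z > 0 \<longrightarrow> stieltjes \<mu> z = (\<Sum>k\<in>{1..K}. m k z) / of_nat K))"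

text \<open>
  The density is taken on \<open>\<real> - {0}\<close>, where it is determined pointwise by continuity; the value
  \<open>\<rho> 0\<close> is unconstrained. Non-negativity is required because \<^const>\<open>ennreal\<close> truncates.
\<close>

definition is_scdos_density :: "nat \<Rightarrow> (nat \<Rightarrow> nat \<Rightarrow> real) \<Rightarrow> (real \<Rightarrow> real) \<Rightarrow> bool" where
  "is_scdos_density K S \<rho> \<longleftrightarrow>
     continuous_on (- {0}) \<rho> \<and> (\<forall>\<tau>\<in>- {0}. 0 \<le> \<rho> \<tau>) \<and>
     (\<exists>\<mu>. is_scdos K S \<mu> \<and>
        restrict_space \<mu> (- {0}) =
          density (restrict_space lborel (- {0})) (\<lambda>\<tau>. ennreal (\<rho> \<tau>)))"

end

theory Submission
  imports Defs "HOL-Combinatorics.Cycles" "Jordan_Normal_Form.Char_Poly"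
begin

text \<open>
  Near \<open>0\<close> the solution behaves like a pure power, \<open>m\<^sub>k(z) \<sim> C\<^sub>k z\<close> to the power \<open>r\<^sub>k\<close>, uniformly in the
  upper half-plane, because \<open>m\<^sub>k\<close> is an algebraic function: if all principal submatrices of \<open>S\<close> are
  invertible, monomials in \<open>m\<close> of degree above \<open>K\<close> can be reduced, so a dimension count gives a polynomial
  relation of bounded degree between \<open>z\<close> and \<open>m\<^sub>k\<close>; such relations survive the limit \<open>\<epsilon> \<rightarrow> 0\<close> from
  \<open>S + \<epsilon> I\<close>. The Newton polygon and connectedness then single out one leading term.

  The exponents are found on the imaginary axis, where \<open>m = i v\<close> with \<open>v > 0\<close>. Convexity gives
  \<open>\<Sum>r\<^sub>k \<le> 0\<close>, which together with full indecomposability makes \<open>r\<close> constant, equal to \<open>f\<^sub>i\<close>, on the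
  \<open>i\<close>-th block and \<open>- f\<^sub>i\<close> on its complement. Comparing the equations summed over these two blocks shows
  that \<open>f\<^sub>i\<close> is the mean of the largest \<open>f\<^sub>j\<close> with \<open>i \<lhd> j\<close> (or \<open>-1\<close>) and the smallest \<open>f\<^sub>j\<close> with
  \<open>j \<lhd> i\<close> (or \<open>1\<close>), which forces the minimal exponent to be \<open>- \<ell> / (\<ell> + 2)\<close>. In particular \<open>\<ell>\<close> does
  not depend on the normal form.
\<close>

section \<open>Stability and existence for the quadratic vector equation\<close>

text \<open>The density at a real \<tau> is a limit \<eta> -> 0 with \<tau> fixed, and only
  afterwards does \<tau> tend to 0. An expansion along the imaginary axis, where positivity makes
  the equations tractable, says nothing about this iterated limit; algebraicity is the bridge, since
  it provides one leading term in the whole half-plane, whose exponent may then be computed on the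
  axis. \<open>S\<close> itself may have singular principal submatrices, for instance zero diagonal
  entries, so the algebraic relation has to come from perturbed matrices. The degree bound must
  depend on the dimension alone, so that coefficient vectors normalised to total modulus 1 have a
  nonzero limit. On the axis every component is a positive multiple of \<open>\<i>\<close>. Hence
  the leading coefficients belonging to the minimal exponent all have the same phase and cannot
  cancel in the average; this phase also produces the factor \<open>cos (pi / 2 * \<sigma>)\<close>
  in the limit, which is positive because \<open>\<sigma> < 1\<close>.\<close>

lemma Im_neg_inverse: "Im (- 1 / w) = Im w / (cmod w)\<^sup>2"
  by (simp add: Im_divide cmod_power2)

lemma cmod_neg_inverse_le:
  assumes "Im w \<ge> \<eta>" "\<eta> > 0"
  shows "cmod (- 1 / w) \<le> 1 / \<eta>"
proof -
  have "\<eta> \<le> cmod w"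
    using assms abs_Im_le_cmod[of w] by linarith
  then show ?thesis
    using assms by (simp add: norm_divide frac_le)
qed

text \<open>The map \<open>w \<mapsto> - 1 / w\<close> is an isometry for the pseudo-distance
  \<open>\<bar>a - b\<bar> / sqrt (Im a * Im b)\<close> of the half-plane.\<close>

lemma qve_step_contraction:
  fixes S :: "'i \<Rightarrow> 'i \<Rightarrow> real" and u w :: "'i \<Rightarrow> complex"
  assumes fin: "finite I" and S: "\<And>k. k \<in> I \<Longrightarrow> 0 \<le> S l k"
    and u: "\<And>k. k \<in> I \<Longrightarrow> Im (u k) > 0" and w: "\<And>k. k \<in> I \<Longrightarrow> Im (w k) > 0"
    and d: "d \<ge> 0" "\<And>k. k \<in> I \<Longrightarrow> cmod (u k - w k) \<le> d * sqrt (Im (u k) * Im (w k))"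
    and ab: "Im a \<ge> \<eta>" "Im b \<ge> \<eta>" "\<eta> > 0" "cmod (a - b) \<le> \<epsilon>"
    and X: "(\<Sum>k\<in>I. S l k * Im (u k)) \<le> X" "(\<Sum>k\<in>I. S l k * Im (w k)) \<le> X"
    and A: "A = a + (\<Sum>k\<in>I. of_real (S l k) * u k)"
    and B: "B = b + (\<Sum>k\<in>I. of_real (S l k) * w k)"
  shows "cmod (- 1 / A - (- 1 / B)) \<le> (\<epsilon> / \<eta> + d * (X / (\<eta> + X))) * sqrt (Im (- 1 / A) * Im (- 1 / B))"
proof -
  define P where "P = (\<Sum>k\<in>I. S l k * Im (u k))"
  define Q where "Q = (\<Sum>k\<in>I. S l k * Im (w k))"
  have P0: "P \<ge> 0" and Q0: "Q \<ge> 0"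
    unfolding P_def Q_def using S less_imp_le[OF u] less_imp_le[OF w] by (auto intro!: sum_nonneg mult_nonneg_nonneg)
  have PX: "P \<le> X" "Q \<le> X" using X by (auto simp: P_def Q_def)
  have X0: "X \<ge> 0" using P0 PX by linarith
  have e0: "\<epsilon> \<ge> 0" using ab(4) norm_ge_zero order_trans by blast
  have ImA: "Im A = Im a + P" and ImB: "Im B = Im b + Q"
    by (simp_all add: A B P_def Q_def)
  have Ap: "Im A > 0" "Im A \<ge> \<eta>" "Im A \<ge> \<eta> + P" and Bp: "Im B > 0" "Im B \<ge> \<eta>" "Im B \<ge> \<eta> + Q"
    using ImA ImB ab P0 Q0 by auto
  have An: "A \<noteq> 0" "B \<noteq> 0" using Ap Bp by auto
  \<comment> \<open>Cauchy-Schwarz with the weights \<open>S l k\<close> bounds the sum of the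
    geometric means \<open>sqrt (Im (u k) * Im (w k))\<close> by the geometric mean of
    \<open>P\<close> and \<open>Q\<close>.\<close>
  have "(\<Sum>k\<in>I. sqrt (S l k * Im (u k)) * sqrt (S l k * Im (w k)))\<^sup>2
      \<le> (\<Sum>k\<in>I. (sqrt (S l k * Im (u k)))\<^sup>2) * (\<Sum>k\<in>I. (sqrt (S l k * Im (w k)))\<^sup>2)"
    by (rule Cauchy_Schwarz_ineq_sum)
  also have "\<dots> = P * Q"
    unfolding P_def Q_def using S u w by (intro arg_cong2[where f="(*)"] sum.cong)
      (use less_imp_le[OF u] less_imp_le[OF w] in \<open>auto intro!: real_sqrt_pow2 mult_nonneg_nonneg\<close>)
  finally have CS: "(\<Sum>k\<in>I. sqrt (S l k * Im (u k)) * sqrt (S l k * Im (w k))) \<le> sqrt (P * Q)"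
    by (rule real_le_rsqrt)
  have term_le: "cmod (of_real (S l k) * (u k - w k)) \<le> d * (sqrt (S l k * Im (u k)) * sqrt (S l k * Im (w k)))"
    if "k \<in> I" for k
  proof -
    have "cmod (of_real (S l k) * (u k - w k)) = S l k * cmod (u k - w k)"
      using S that by (simp add: norm_mult)
    also have "\<dots> \<le> S l k * (d * sqrt (Im (u k) * Im (w k)))"
      by (intro mult_left_mono d(2) S that)
    also have "\<dots> = d * (sqrt (S l k * Im (u k)) * sqrt (S l k * Im (w k)))"
      using S[OF that] by (simp add: real_sqrt_mult)
    finally show ?thesis .
  qed
  have "A - B = (a - b) + (\<Sum>k\<in>I. of_real (S l k) * (u k - w k))"
    by (simp add: A B sum_subtractf algebra_simps)
  then have "cmod (A - B) \<le> cmod (a - b) + cmod (\<Sum>k\<in>I. of_real (S l k) * (u k - w k))"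
    by (simp only: norm_triangle_ineq)
  also have "\<dots> \<le> cmod (a - b) + (\<Sum>k\<in>I. cmod (of_real (S l k) * (u k - w k)))"
    by (intro add_left_mono norm_sum)
  also have "\<dots> \<le> \<epsilon> + (\<Sum>k\<in>I. d * (sqrt (S l k * Im (u k)) * sqrt (S l k * Im (w k))))"
    by (intro add_mono ab(4) sum_mono term_le)
  also have "\<dots> \<le> \<epsilon> + d * sqrt (P * Q)"
    unfolding sum_distrib_left[symmetric] using CS d(1) by (intro add_left_mono mult_left_mono)
  finally have 1: "cmod (A - B) \<le> \<epsilon> + d * sqrt (P * Q)" .
  have "\<eta> * \<eta> \<le> Im A * Im B" using Ap Bp ab(3) by (intro mult_mono) auto
  then have "\<eta> \<le> sqrt (Im A * Im B)"
    by (intro real_le_rsqrt) (simp add: power2_eq_square)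
  then have 2: "\<epsilon> \<le> \<epsilon> / \<eta> * sqrt (Im A * Im B)"
    using e0 ab(3) by (simp add: field_simps mult_left_mono)
  \<comment> \<open>Since \<open>p / (\<eta> + p)\<close> increases with \<open>p\<close>, the shift
    of the imaginary part by \<eta> yields the contraction factor \<open>X / (\<eta> + X)\<close>,
    which is strictly below 1.\<close>
  have frac: "p \<le> X / (\<eta> + X) * y" if "0 \<le> p" "p \<le> X" "\<eta> + p \<le> y" for p y
  proof -
    have "p * (\<eta> + X) \<le> X * (\<eta> + p)" using that ab(3) by (simp add: algebra_simps)
    also have "\<dots> \<le> X * y" using X0 that by (intro mult_left_mono)
    finally show ?thesis using X0 ab(3) by (simp add: field_simps)
  qed
  have "P * Q \<le> (X / (\<eta> + X) * Im A) * (X / (\<eta> + X) * Im B)"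
    using frac[of P "Im A"] frac[of Q "Im B"] P0 Q0 PX Ap Bp X0 ab(3) by (intro mult_mono) auto
  also have "\<dots> = (X / (\<eta> + X))\<^sup>2 * (Im A * Im B)"
    by (simp add: power2_eq_square algebra_simps)
  finally have "sqrt (P * Q) \<le> sqrt ((X / (\<eta> + X))\<^sup>2 * (Im A * Im B))"
    by (rule real_sqrt_le_mono)
  also have "\<dots> = X / (\<eta> + X) * sqrt (Im A * Im B)"
    unfolding real_sqrt_mult using X0 ab(3) by simp
  finally have "d * sqrt (P * Q) \<le> d * (X / (\<eta> + X) * sqrt (Im A * Im B))"
    using d(1) by (rule mult_left_mono)
  with 1 2 have 3: "cmod (A - B) \<le> (\<epsilon> / \<eta> + d * (X / (\<eta> + X))) * sqrt (Im A * Im B)"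
    by (simp add: algebra_simps)
  \<comment> \<open>Here the isometry enters: passing to \<open>- 1 / A\<close> and
    \<open>- 1 / B\<close> divides both sides of the estimate by
    \<open>cmod A * cmod B\<close>.\<close>
  have "- 1 / A - (- 1 / B) = (A - B) / (A * B)"
    using An by (simp add: field_simps)
  then have 4: "cmod (- 1 / A - (- 1 / B)) = cmod (A - B) / (cmod A * cmod B)"
    by (simp add: norm_divide norm_mult)
  have "Im (- 1 / A) * Im (- 1 / B) = (Im A * Im B) / (cmod A * cmod B)\<^sup>2"
    unfolding Im_neg_inverse by (simp add: power_mult_distrib)
  then have 5: "sqrt (Im (- 1 / A) * Im (- 1 / B)) = sqrt (Im A * Im B) / (cmod A * cmod B)"
    by (simp add: real_sqrt_divide)
  have "cmod (A - B) / (cmod A * cmod B)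
      \<le> (\<epsilon> / \<eta> + d * (X / (\<eta> + X))) * sqrt (Im A * Im B) / (cmod A * cmod B)"
    using 3 by (intro divide_right_mono) auto
  then show ?thesis
    unfolding 4 5 by simp
qed

lemma qve_solution_bound:
  fixes S :: "'i \<Rightarrow> 'i \<Rightarrow> real" and u :: "'i \<Rightarrow> complex"
  assumes "\<And>k. k \<in> I \<Longrightarrow> 0 \<le> S l k" "\<And>k. k \<in> I \<Longrightarrow> Im (u k) > 0"
    and "Im a \<ge> \<eta>" "\<eta> > 0" "- 1 / u l = a + (\<Sum>k\<in>I. of_real (S l k) * u k)"
  shows "cmod (u l) \<le> 1 / \<eta>"
proof -
  define A where "A = a + (\<Sum>k\<in>I. of_real (S l k) * u k)"
  have "Im A = Im a + (\<Sum>k\<in>I. S l k * Im (u k))" by (simp add: A_def)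
  moreover have "(\<Sum>k\<in>I. S l k * Im (u k)) \<ge> 0"
    using assms by (intro sum_nonneg mult_nonneg_nonneg) (auto intro: less_imp_le)
  ultimately have "Im A \<ge> \<eta>" using assms by linarith
  moreover have "A = - 1 / u l" using assms(5) by (simp add: A_def)
  then have "u l = - 1 / A" by simp
  ultimately show ?thesis using cmod_neg_inverse_le[of \<eta> A] assms(4) by simp
qed

lemma row_sum_le:
  fixes S :: "'i \<Rightarrow> 'i \<Rightarrow> real"
  assumes "finite I" "\<And>l k. l \<in> I \<Longrightarrow> k \<in> I \<Longrightarrow> 0 \<le> S l k" "l \<in> I" "\<eta> \<ge> 0"
  shows "(\<Sum>k\<in>I. S l k) / \<eta> \<le> (\<Sum>l\<in>I. \<Sum>k\<in>I. S l k) / \<eta>"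
  using assms
  by (intro divide_right_mono member_le_sum[of l I "\<lambda>l. \<Sum>k\<in>I. S l k"]) (auto intro: sum_nonneg)

text \<open>The equations are evaluated where the pseudo-distance of \<open>u\<close> and
  \<open>w\<close> is largest. Taking \<open>a = b\<close> gives uniqueness, constant
  \<open>a\<close> and \<open>b\<close> give continuity in \<open>z\<close>, and letting
  \<open>b\<close> depend on \<open>l\<close> absorbs a diagonal perturbation of
  \<open>S\<close>.\<close>

lemma qve_stability:
  fixes S :: "'i \<Rightarrow> 'i \<Rightarrow> real" and u w a b :: "'i \<Rightarrow> complex"
  assumes fin: "finite I" and S: "\<And>l k. l \<in> I \<Longrightarrow> k \<in> I \<Longrightarrow> 0 \<le> S l k"
    and u: "\<And>l. l \<in> I \<Longrightarrow> Im (u l) > 0 \<and> - 1 / u l = a l + (\<Sum>k\<in>I. of_real (S l k) * u k)"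
    and w: "\<And>l. l \<in> I \<Longrightarrow> Im (w l) > 0 \<and> - 1 / w l = b l + (\<Sum>k\<in>I. of_real (S l k) * w k)"
    and \<eta>: "\<eta> > 0" and ab: "\<And>l. l \<in> I \<Longrightarrow> Im (a l) \<ge> \<eta> \<and> Im (b l) \<ge> \<eta> \<and> cmod (a l - b l) \<le> \<epsilon>"
    and l: "l \<in> I"
  defines "X \<equiv> (\<Sum>l\<in>I. \<Sum>k\<in>I. S l k) / \<eta>"
  shows "cmod (u l - w l) \<le> \<epsilon> * (\<eta> + X) / \<eta> ^ 3"
proof -
  have X: "(\<Sum>k\<in>I. S l k) / \<eta> \<le> X" if "l \<in> I" for l
    unfolding X_def by (rule row_sum_le) (use fin S that \<eta> in auto)
  define D where "D = (\<lambda>k. cmod (u k - w k) / sqrt (Im (u k) * Im (w k)))"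
  define d where "d = Max (D ` I)"
  have pos: "Im (u k) * Im (w k) > 0" if "k \<in> I" for k using u w that by simp
  have bu: "cmod (u k) \<le> 1 / \<eta>" "cmod (w k) \<le> 1 / \<eta>" if "k \<in> I" for k
    using S u w ab \<eta> that by (blast intro: qve_solution_bound[of I S k _ \<eta>])+
  have Imb: "Im (u k) \<le> 1 / \<eta>" "Im (w k) \<le> 1 / \<eta>" if "k \<in> I" for k
    using bu[OF that] abs_Im_le_cmod[of "u k"] abs_Im_le_cmod[of "w k"] by linarith+
  have Dk: "D k \<le> d" if "k \<in> I" for k unfolding d_def using fin that by simp
  have Dd: "cmod (u k - w k) \<le> d * sqrt (Im (u k) * Im (w k))" if "k \<in> I" for k
    using Dk[OF that] pos[OF that] by (simp add: D_def pos_divide_le_eq)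
  have "D l \<ge> 0" unfolding D_def using pos[OF l] by simp
  then have d0: "d \<ge> 0" using Dk[OF l] by linarith
  have Xs: "(\<Sum>k\<in>I. S j k * Im (u k)) \<le> X" "(\<Sum>k\<in>I. S j k * Im (w k)) \<le> X" if "j \<in> I" for j
  proof -
    have "(\<Sum>k\<in>I. S j k * Im (u k)) \<le> (\<Sum>k\<in>I. S j k * (1 / \<eta>))"
      by (intro sum_mono mult_left_mono Imb S that)
    then show "(\<Sum>k\<in>I. S j k * Im (u k)) \<le> X"
      using X[OF that] by (simp add: sum_divide_distrib)
    have "(\<Sum>k\<in>I. S j k * Im (w k)) \<le> (\<Sum>k\<in>I. S j k * (1 / \<eta>))"
      by (intro sum_mono mult_left_mono Imb S that)
    then show "(\<Sum>k\<in>I. S j k * Im (w k)) \<le> X"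
      using X[OF that] by (simp add: sum_divide_distrib)
  qed
  have X0: "X \<ge> 0"
  proof -
    have "0 \<le> (\<Sum>k\<in>I. S l k) / \<eta>" using S l \<eta> by (intro divide_nonneg_nonneg sum_nonneg) auto
    then show ?thesis using X[OF l] by linarith
  qed
  \<comment> \<open>At a maximising index the contraction estimate has \<open>d\<close> on both
    sides; solving for it costs the factor \<open>(\<eta> + X) / \<eta>\<close>.\<close>
  have "d \<in> D ` I" unfolding d_def using fin l by (intro Max_in) auto
  then obtain j where j: "j \<in> I" "d = D j" by auto
  have "cmod (- 1 / (- 1 / u j) - (- 1 / (- 1 / w j)))
      \<le> (\<epsilon> / \<eta> + d * (X / (\<eta> + X))) * sqrt (Im (- 1 / (- 1 / u j)) * Im (- 1 / (- 1 / w j)))"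
  proof (rule qve_step_contraction[OF fin, of S j u w d \<eta> "a j" "b j"])
    show "\<And>k. k \<in> I \<Longrightarrow> 0 \<le> S j k" using S j(1) by blast
    show "\<And>k. k \<in> I \<Longrightarrow> cmod (u k - w k) \<le> d * sqrt (Im (u k) * Im (w k))" by (rule Dd)
  qed (use u w ab \<eta> Xs[OF j(1)] d0 j(1) in auto)
  then have "cmod (u j - w j) \<le> (\<epsilon> / \<eta> + d * (X / (\<eta> + X))) * sqrt (Im (u j) * Im (w j))"
    by simp
  then have "d \<le> \<epsilon> / \<eta> + d * (X / (\<eta> + X))"
    using pos[OF j(1)] j(2) by (simp add: D_def pos_divide_le_eq)
  moreover have "\<eta> / (\<eta> + X) = 1 - X / (\<eta> + X)"
    using X0 \<eta> by (simp add: field_simps)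
  ultimately have "d * (\<eta> / (\<eta> + X)) \<le> \<epsilon> / \<eta>"
    by (simp add: right_diff_distrib)
  then have d2: "d \<le> \<epsilon> * (\<eta> + X) / \<eta>\<^sup>2"
    using X0 \<eta> by (simp add: field_simps power2_eq_square)
  have "sqrt (Im (u l) * Im (w l)) \<le> sqrt (1 / \<eta> * (1 / \<eta>))"
    using Imb[OF l] u[OF l] w[OF l] \<eta> by (intro real_sqrt_le_mono mult_mono) auto
  also have "sqrt (1 / \<eta> * (1 / \<eta>)) = 1 / \<eta>"
    using \<eta> by (intro real_sqrt_unique) (auto simp: power2_eq_square)
  finally have "sqrt (Im (u l) * Im (w l)) \<le> 1 / \<eta>" .
  then have "cmod (u l - w l) \<le> d * (1 / \<eta>)"
    using Dd[OF l] d0 by (meson mult_left_mono order_trans)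
  also have "\<dots> \<le> \<epsilon> * (\<eta> + X) / \<eta>\<^sup>2 * (1 / \<eta>)"
    using d2 \<eta> by (intro mult_right_mono) auto
  also have "\<dots> = \<epsilon> * (\<eta> + X) / \<eta> ^ 3"
    by (simp add: power2_eq_square power3_eq_cube)
  finally show ?thesis .
qed

text \<open>Fixed point iteration: successive differences decay geometrically in the
  pseudo-distance. Existence is needed for the perturbed matrices, whose solutions are not given by
  hypothesis.\<close>

lemma qve_exists:
  fixes S :: "'i \<Rightarrow> 'i \<Rightarrow> real"
  assumes fin: "finite I" and S: "\<And>l k. l \<in> I \<Longrightarrow> k \<in> I \<Longrightarrow> 0 \<le> S l k" and z: "Im z > 0"
  shows "\<exists>u. \<forall>l\<in>I. Im (u l) > 0 \<and> - 1 / u l = z + (\<Sum>k\<in>I. of_real (S l k) * u k)"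
proof -
  define \<eta> where "\<eta> = Im z"
  define A where "A = (\<lambda>u l. z + (\<Sum>k\<in>I. of_real (S l k) * u k))"
  \<comment> \<open>The start \<open>\<i> / \<eta>\<close> has modulus \<open>1 / \<eta>\<close>,
    the a priori bound for all later iterates, so one bound serves the whole sequence.\<close>
  define U :: "nat \<Rightarrow> 'i \<Rightarrow> complex" where "U = rec_nat (\<lambda>_. \<i> / of_real \<eta>) (\<lambda>n u l. - 1 / A u l)"
  have U0: "U 0 = (\<lambda>_. \<i> / of_real \<eta>)" and US: "U (Suc n) l = - 1 / A (U n) l" for n l
    by (simp_all add: U_def)
  have \<eta>: "\<eta> > 0" using z by (simp add: \<eta>_def)
  define X where "X = (\<Sum>l\<in>I. \<Sum>k\<in>I. S l k) / \<eta>"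
  have X0: "X \<ge> 0" unfolding X_def using \<eta> S by (auto intro!: divide_nonneg_pos sum_nonneg)
  have Xl: "(\<Sum>k\<in>I. S l k) / \<eta> \<le> X" if "l \<in> I" for l
    unfolding X_def by (rule row_sum_le) (use fin S that \<eta> in auto)
  have ImA: "Im (A u l) \<ge> \<eta>" if "l \<in> I" "\<And>k. k \<in> I \<Longrightarrow> Im (u k) > 0" for u l
  proof -
    have "(\<Sum>k\<in>I. S l k * Im (u k)) \<ge> 0"
      using S that by (intro sum_nonneg mult_nonneg_nonneg) (auto intro: less_imp_le)
    then show ?thesis by (simp add: A_def \<eta>_def)
  qed
  have Upos: "l \<in> I \<longrightarrow> Im (U n l) > 0" for n l
  proof (induction n arbitrary: l)
    case 0 then show ?case using \<eta> by (simp add: U0 Im_divide power2_eq_square)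
  next
    case (Suc n)
    have "Im (A (U n) l) > 0" if "l \<in> I"
      by (rule less_le_trans[OF \<eta> ImA[OF that]]) (use Suc in blast)
    moreover have "(cmod w)\<^sup>2 > 0" if "Im w > 0" for w using that by auto
    ultimately show ?case unfolding US Im_neg_inverse by (blast intro: divide_pos_pos)
  qed
  have Ub: "cmod (U n l) \<le> 1 / \<eta>" if "l \<in> I" for n l
  proof (cases n)
    case 0 then show ?thesis using \<eta> by (simp add: U0 norm_divide)
  next
    case (Suc n') then show ?thesis
      using cmod_neg_inverse_le[OF ImA \<eta>] Upos that by (simp add: US)
  qed
  have UIm: "Im (U n l) \<le> 1 / \<eta>" if "l \<in> I" for n l
    using Ub[OF that, of n] abs_Im_le_cmod[of "U n l"] by linarith
  have Xs: "(\<Sum>k\<in>I. S j k * Im (U n k)) \<le> X" if "j \<in> I" for j n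
  proof -
    have "(\<Sum>k\<in>I. S j k * Im (U n k)) \<le> (\<Sum>k\<in>I. S j k * (1 / \<eta>))"
      by (intro sum_mono mult_left_mono UIm S that)
    then show ?thesis using Xl[OF that] by (simp add: sum_divide_distrib)
  qed
  define q where "q = X / (\<eta> + X)"
  have q: "0 \<le> q" "q < 1" using X0 \<eta> by (auto simp: q_def)
  define d where "d = (\<Sum>k\<in>I. cmod (U 0 k - U 1 k) / sqrt (Im (U 0 k) * Im (U 1 k)))"
  have d0: "d \<ge> 0" unfolding d_def using Upos by (intro sum_nonneg divide_nonneg_nonneg real_sqrt_ge_zero mult_nonneg_nonneg) (auto intro: less_imp_le)
  have dist: "l \<in> I \<longrightarrow> cmod (U n l - U (Suc n) l) \<le> d * q ^ n * sqrt (Im (U n l) * Im (U (Suc n) l))" for n l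
  proof (induction n arbitrary: l)
    case 0
    show ?case
    proof
      assume l: "l \<in> I"
      have "cmod (U 0 l - U 1 l) / sqrt (Im (U 0 l) * Im (U 1 l)) \<le> d"
        unfolding d_def using fin l Upos
        by (intro member_le_sum[of l I "\<lambda>k. cmod (U 0 k - U 1 k) / sqrt (Im (U 0 k) * Im (U 1 k))"]
              divide_nonneg_nonneg real_sqrt_ge_zero mult_nonneg_nonneg) (auto intro: less_imp_le)
      moreover have "Im (U 0 l) * Im (U 1 l) > 0" using Upos l by simp
      ultimately show "cmod (U 0 l - U (Suc 0) l) \<le> d * q ^ 0 * sqrt (Im (U 0 l) * Im (U (Suc 0) l))"
        by (simp add: pos_divide_le_eq)
    qed
  next
    case (Suc n)
    show ?case
    proof
      assume l: "l \<in> I"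
      have "cmod (- 1 / A (U n) l - (- 1 / A (U (Suc n)) l))
        \<le> (0 / \<eta> + (d * q ^ n) * (X / (\<eta> + X))) * sqrt (Im (- 1 / A (U n) l) * Im (- 1 / A (U (Suc n)) l))"
        by (rule qve_step_contraction[OF fin, of S l "U n" "U (Suc n)" _ \<eta> z z])
           (use S l Upos d0 q Suc \<eta> Xs in \<open>auto simp: A_def \<eta>_def\<close>)
      then show "cmod (U (Suc n) l - U (Suc (Suc n)) l) \<le> d * q ^ Suc n * sqrt (Im (U (Suc n) l) * Im (U (Suc (Suc n)) l))"
        unfolding US[of n l] US[of "Suc n" l] q_def[symmetric] by (simp add: mult.assoc mult.left_commute[of _ q])
    qed
  qed
  have step: "norm (U (Suc n) l - U n l) \<le> d / \<eta> * q ^ n" if "l \<in> I" for n l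
  proof -
    have "sqrt (Im (U n l) * Im (U (Suc n) l)) \<le> sqrt (1 / \<eta> * (1 / \<eta>))"
      using UIm[OF that] Upos that \<eta> by (intro real_sqrt_le_mono mult_mono) (auto intro: less_imp_le)
    also have "sqrt (1 / \<eta> * (1 / \<eta>)) = 1 / \<eta>"
      using \<eta> by (intro real_sqrt_unique) (auto simp: power2_eq_square)
    finally have "sqrt (Im (U n l) * Im (U (Suc n) l)) \<le> 1 / \<eta>" .
    then have "d * q ^ n * sqrt (Im (U n l) * Im (U (Suc n) l)) \<le> d * q ^ n * (1 / \<eta>)"
      using d0 q by (intro mult_left_mono) auto
    then show ?thesis using dist[of l n] that by (simp add: norm_minus_commute)
  qed
  have "\<exists>x. (\<lambda>n. U n l) \<longlonglongrightarrow> x" if "l \<in> I" for l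
  proof -
    have "summable (\<lambda>n. d / \<eta> * q ^ n)"
      using q by (intro summable_mult summable_geometric) auto
    then have "summable (\<lambda>n. U (Suc n) l - U n l)"
      by (rule summable_comparison_test[rotated]) (use step[OF that] in auto)
    then have "(\<lambda>n. \<Sum>i<n. U (Suc i) l - U i l) \<longlonglongrightarrow> (\<Sum>n. U (Suc n) l - U n l)"
      by (rule summable_LIMSEQ)
    then have "(\<lambda>n. U n l - U 0 l) \<longlonglongrightarrow> (\<Sum>n. U (Suc n) l - U n l)"
      unfolding sum_lessThan_telescope[of "\<lambda>n. U n l"] .
    then have "(\<lambda>n. U n l - U 0 l + U 0 l) \<longlonglongrightarrow> (\<Sum>n. U (Suc n) l - U n l) + U 0 l"
      by (intro tendsto_intros)
    then show ?thesis by auto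
  qed
  then obtain x where x: "\<And>l. l \<in> I \<Longrightarrow> (\<lambda>n. U n l) \<longlonglongrightarrow> x l" by metis
  \<comment> \<open>A common lower bound for the imaginary parts of the iterates keeps the limit in
    the open half-plane instead of letting it reach the real line.\<close>
  define c where "c = \<eta> / (cmod z + X)\<^sup>2"
  have zX: "cmod z + X > 0" using X0 z abs_Im_le_cmod[of z] by linarith
  have c0: "c > 0" using \<eta> zX by (simp add: c_def)
  have "Im (U (Suc n) l) \<ge> c" if "l \<in> I" for n l
  proof -
    have "cmod (A (U n) l) \<le> cmod z + cmod (\<Sum>k\<in>I. of_real (S l k) * U n k)"
      unfolding A_def by (rule norm_triangle_ineq)
    also have "\<dots> \<le> cmod z + (\<Sum>k\<in>I. cmod (of_real (S l k) * U n k))"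
      by (intro add_left_mono norm_sum)
    also have "\<dots> \<le> cmod z + (\<Sum>k\<in>I. S l k * (1 / \<eta>))"
      using S that Ub by (intro add_left_mono sum_mono) (simp add: norm_mult mult_left_mono del: times_divide_eq_right)
    also have "\<dots> \<le> cmod z + X"
      using Xl[OF that] by (simp add: sum_divide_distrib)
    finally have "(cmod (A (U n) l))\<^sup>2 \<le> (cmod z + X)\<^sup>2" by (intro power_mono) auto
    moreover have "Im (A (U n) l) \<ge> \<eta>" using ImA Upos that by simp
    moreover have "A (U n) l \<noteq> 0" using calculation(2) \<eta> by auto
    ultimately show ?thesis
      unfolding US Im_neg_inverse c_def using \<eta> by (intro frac_le) auto
  qed
  then have Imx: "Im (x l) > 0" if "l \<in> I" for l
    using c0 Lim_bounded2[OF tendsto_Im[OF LIMSEQ_Suc[OF x[OF that]]], of 0 c] that by force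
  have "- 1 / x l = z + (\<Sum>k\<in>I. of_real (S l k) * x k)" if l: "l \<in> I" for l
  proof -
    have "x l \<noteq> 0" using Imx[OF l] by auto
    then have "(\<lambda>n. - 1 / U (Suc n) l) \<longlonglongrightarrow> - 1 / x l"
      by (intro tendsto_intros LIMSEQ_Suc[OF x[OF l]])
    moreover have "(\<lambda>n. - 1 / U (Suc n) l) = (\<lambda>n. z + (\<Sum>k\<in>I. of_real (S l k) * U n k))"
      unfolding US by (auto simp: A_def)
    moreover have "(\<lambda>n. z + (\<Sum>k\<in>I. of_real (S l k) * U n k)) \<longlonglongrightarrow> z + (\<Sum>k\<in>I. of_real (S l k) * x k)"
      by (intro tendsto_intros x)
    ultimately show ?thesis using LIMSEQ_unique by metis
  qed
  then show ?thesis using Imx by blast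
qed

section \<open>Solutions are algebraic functions\<close>

lemma homogeneous_system_nontrivial_solution:
  fixes c :: "'i \<Rightarrow> 'b \<Rightarrow> 'a::field"
  assumes "finite B" "finite I" "card B < card I"
  shows "\<exists>x. (\<exists>i\<in>I. x i \<noteq> 0) \<and> (\<forall>b\<in>B. (\<Sum>i\<in>I. x i * c i b) = 0)"
  using assms
proof (induction B arbitrary: I c rule: finite_induct)
  case empty
  then obtain i where "i \<in> I" by (metis card.empty card_gt_0_iff ex_in_conv)
  then show ?case by (intro exI[of _ "\<lambda>_. 1"]) auto
next
  case (insert b B)
  show ?case
  proof (cases "\<forall>i\<in>I. c i b = 0")
    case True
    then show ?thesis using insert.IH[of I c] insert.prems insert.hyps by auto
  next
    case False
    then obtain i0 where i0: "i0 \<in> I" "c i0 b \<noteq> 0" by blast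
    have "card B < card (I - {i0})" using insert.prems insert.hyps i0 by auto
    from insert.IH[OF _ this, of "\<lambda>i b'. c i b' - c i b / c i0 b * c i0 b'"] insert.prems
    obtain x where x: "\<exists>i\<in>I - {i0}. x i \<noteq> 0"
      "\<And>b'. b' \<in> B \<Longrightarrow> (\<Sum>i\<in>I - {i0}. x i * (c i b' - c i b / c i0 b * c i0 b')) = 0" by auto
    define y where "y = x(i0 := - (\<Sum>i\<in>I - {i0}. x i * c i b) / c i0 b)"
    have split: "(\<Sum>i\<in>I. y i * c i b') = y i0 * c i0 b' + (\<Sum>i\<in>I - {i0}. x i * c i b')" for b'
      using insert.prems i0 by (subst sum.remove[of I i0]) (auto simp: y_def intro!: sum.cong)
    have "(\<Sum>i\<in>I. y i * c i b') = 0" if "b' \<in> insert b B" for b'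
    proof (cases "b' = b")
      case True
      then show ?thesis unfolding split using i0 by (simp add: y_def)
    next
      case False
      then have "(\<Sum>i\<in>I - {i0}. x i * c i b') = (\<Sum>i\<in>I - {i0}. x i * c i b) / c i0 b * c i0 b'"
        using x(2)[of b'] that
        by (simp add: right_diff_distrib sum_subtractf sum_distrib_right sum_divide_distrib mult.assoc)
      then show ?thesis unfolding split by (simp add: y_def)
    qed
    moreover have "\<exists>i\<in>I. y i \<noteq> 0" using x(1) by (auto simp: y_def)
    ultimately show ?thesis by blast
  qed
qed

text \<open>The coefficients do not depend on the point \<open>p\<close>, so a linear dependence
  between elements is one relation valid for all \<open>p\<close>. The generators may be dependent;
  counting them still bounds the dimension.\<close>

definition lspan :: "('g \<Rightarrow> 'p \<Rightarrow> complex) \<Rightarrow> 'g set \<Rightarrow> ('p \<Rightarrow> complex) set" where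
  "lspan \<phi> G = {f. \<exists>c. \<forall>p. f p = (\<Sum>g\<in>G. c g * \<phi> g p)}"

lemma lspan_base:
  assumes "finite G" "g \<in> G" shows "\<phi> g \<in> lspan \<phi> G"
  unfolding lspan_def using assms
  by (auto intro!: exI[of _ "\<lambda>h. if h = g then 1 else 0"] simp: if_distrib[of "\<lambda>c. c * _"] sum.delta cong: if_cong)

lemma lspan_cmult: "f \<in> lspan \<phi> G \<Longrightarrow> (\<lambda>p. a * f p) \<in> lspan \<phi> G"
  unfolding lspan_def
proof safe
  fix c assume "\<forall>p. f p = (\<Sum>g\<in>G. c g * \<phi> g p)"
  then show "\<exists>c. \<forall>p. a * f p = (\<Sum>g\<in>G. c g * \<phi> g p)"
    by (intro exI[of _ "\<lambda>g. a * c g"]) (simp add: sum_distrib_left mult.assoc)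
qed

lemma lspan_add: "f \<in> lspan \<phi> G \<Longrightarrow> h \<in> lspan \<phi> G \<Longrightarrow> (\<lambda>p. f p + h p) \<in> lspan \<phi> G"
  unfolding lspan_def
proof safe
  fix c d assume "\<forall>p. f p = (\<Sum>g\<in>G. c g * \<phi> g p)" "\<forall>p. h p = (\<Sum>g\<in>G. d g * \<phi> g p)"
  then show "\<exists>c. \<forall>p. f p + h p = (\<Sum>g\<in>G. c g * \<phi> g p)"
    by (intro exI[of _ "\<lambda>g. c g + d g"]) (simp add: sum.distrib distrib_right)
qed

lemma lspan_sum:
  "(\<And>i. i \<in> A \<Longrightarrow> f i \<in> lspan \<phi> G) \<Longrightarrow> (\<lambda>p. \<Sum>i\<in>A. f i p) \<in> lspan \<phi> G"
proof (induction A rule: infinite_finite_induct)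
  case (insert x F)
  then show ?case using lspan_add[of "f x" \<phi> G "\<lambda>p. \<Sum>i\<in>F. f i p"] by simp
qed (auto simp: lspan_def intro!: exI[of _ "\<lambda>_. 0"])

lemma lspan_mult:
  assumes "f \<in> lspan \<phi> G" "\<And>g. g \<in> G \<Longrightarrow> (\<lambda>p. \<psi> p * \<phi> g p) \<in> lspan \<phi> G'"
  shows "(\<lambda>p. \<psi> p * f p) \<in> lspan \<phi> G'"
proof -
  obtain c where c: "\<And>p. f p = (\<Sum>g\<in>G. c g * \<phi> g p)" using assms(1) by (auto simp: lspan_def)
  have "(\<lambda>p. \<Sum>g\<in>G. c g * (\<psi> p * \<phi> g p)) \<in> lspan \<phi> G'"
    by (intro lspan_sum lspan_cmult assms(2))
  moreover have "(\<lambda>p. \<Sum>g\<in>G. c g * (\<psi> p * \<phi> g p)) = (\<lambda>p. \<psi> p * f p)"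
    by (auto simp: c sum_distrib_left mult_ac)
  ultimately show ?thesis by simp
qed

lemma lspan_trans:
  assumes "f \<in> lspan \<phi> G" "\<And>g. g \<in> G \<Longrightarrow> \<phi> g \<in> lspan \<phi> G'"
  shows "f \<in> lspan \<phi> G'"
  using lspan_mult[of f \<phi> G "\<lambda>_. 1" G'] assms by simp

text \<open>The non-degeneracy assumption says that all principal submatrices of \<open>S\<close> are invertible:
  then for every \<open>A\<close> the forms \<open>(S x)\<^sub>l\<close>, \<open>l \<in> A\<close>, and \<open>x\<^sub>l\<close>, \<open>l \<notin> A\<close>, are a basis of the linear
  forms. It makes the leading forms \<open>x\<^sub>l (S x)\<^sub>l\<close> of the equations a regular sequence, whose
  quotient vanishes above degree \<open>card I\<close>.\<close>

locale nondegenerate_qve =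
  fixes I :: "nat set" and S :: "nat \<Rightarrow> nat \<Rightarrow> complex"
    and x :: "nat \<Rightarrow> 'p \<Rightarrow> complex" and \<zeta> :: "'p \<Rightarrow> complex"
  assumes fin: "finite I"
    and rel: "\<And>l p. l \<in> I \<Longrightarrow> x l p * (\<zeta> p + (\<Sum>k\<in>I. S l k * x k p)) = - 1"
    and nondegenerate: "\<And>A k. A \<subseteq> I \<Longrightarrow> k \<in> I \<Longrightarrow>
      \<exists>c. \<forall>v. v k = (\<Sum>l\<in>I. c l * (if l \<in> A then \<Sum>j\<in>I. S l j * v j else v l))"
begin

text \<open>A monomial in \<zeta> and the unknowns. Lists name the same monomial several times,
  which is harmless because only an upper bound on the number of generators is used.\<close>

definition \<phi> :: "nat list \<times> nat \<Rightarrow> 'p \<Rightarrow> complex" where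
  "\<phi> g p = \<zeta> p ^ snd g * prod_list (map (\<lambda>i. x i p) (fst g))"

definition G :: "nat \<Rightarrow> nat \<Rightarrow> (nat list \<times> nat) set" where
  "G d e = {xs. set xs \<subseteq> I \<and> length xs \<le> d} \<times> {..e}"

definition V :: "nat \<Rightarrow> nat \<Rightarrow> ('p \<Rightarrow> complex) set" where "V d e = lspan \<phi> (G d e)"

lemma finG: "finite (G d e)"
  unfolding G_def using finite_lists_length_le[OF fin] by auto

lemma V_mono: "f \<in> V d e \<Longrightarrow> d \<le> d' \<Longrightarrow> e \<le> e' \<Longrightarrow> f \<in> V d' e'"
  unfolding V_def by (erule lspan_trans, rule lspan_base[OF finG]) (auto simp: G_def)

lemma V_zeta: "f \<in> V d e \<Longrightarrow> (\<lambda>p. \<zeta> p * f p) \<in> V d (Suc e)"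
  unfolding V_def
proof (erule lspan_mult)
  fix g assume "g \<in> G d e"
  then have "(fst g, Suc (snd g)) \<in> G d (Suc e)" by (auto simp: G_def)
  then have "\<phi> (fst g, Suc (snd g)) \<in> lspan \<phi> (G d (Suc e))" by (rule lspan_base[OF finG])
  moreover have "\<phi> (fst g, Suc (snd g)) = (\<lambda>p. \<zeta> p * \<phi> g p)" by (auto simp: \<phi>_def mult_ac)
  ultimately show "(\<lambda>p. \<zeta> p * \<phi> g p) \<in> lspan \<phi> (G d (Suc e))" by simp
qed

lemma V_zeta_pow: "f \<in> V d e \<Longrightarrow> (\<lambda>p. \<zeta> p ^ j * f p) \<in> V d (j + e)"
proof (induction j)
  case (Suc j)
  then show ?case using V_zeta[of "\<lambda>p. \<zeta> p ^ j * f p"] by (simp add: mult.assoc)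
qed auto

lemma V_x: "i \<in> I \<Longrightarrow> f \<in> V d e \<Longrightarrow> (\<lambda>p. x i p * f p) \<in> V (Suc d) e"
  unfolding V_def
proof (erule lspan_mult)
  fix g assume "i \<in> I" "g \<in> G d e"
  then have "(i # fst g, snd g) \<in> G (Suc d) e" by (auto simp: G_def)
  then have "\<phi> (i # fst g, snd g) \<in> lspan \<phi> (G (Suc d) e)" by (rule lspan_base[OF finG])
  moreover have "\<phi> (i # fst g, snd g) = (\<lambda>p. x i p * \<phi> g p)" by (auto simp: \<phi>_def mult_ac)
  ultimately show "(\<lambda>p. x i p * \<phi> g p) \<in> lspan \<phi> (G (Suc d) e)" by simp
qed

lemma V_monomial:
  assumes "A \<subseteq> I" "set xs \<subseteq> I"
  shows "(\<lambda>p. (\<Prod>l\<in>A. x l p) * prod_list (map (\<lambda>i. x i p) xs)) \<in> V (card A + length xs) 0"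
proof -
  have "finite A" using assms fin finite_subset by blast
  then show ?thesis using assms
  proof (induction A rule: finite_induct)
    case empty
    have "(xs, 0) \<in> G (length xs) 0" using empty by (auto simp: G_def)
    then have "\<phi> (xs, 0) \<in> V (length xs) 0" unfolding V_def by (rule lspan_base[OF finG])
    then show ?case by (simp add: \<phi>_def[abs_def])
  next
    case (insert l A)
    then show ?case using V_x[of l] by (simp add: mult.assoc)
  qed
qed

text \<open>The product over \<open>A\<close> is the squarefree part collected so far,
  \<open>xs\<close> the factors still to be treated. One factor is expanded in the basis adapted to
  \<open>A\<close>. For \<open>l\<close> outside \<open>A\<close> the form \<open>x l\<close>
  enlarges \<open>A\<close>. For \<open>l\<close> in \<open>A\<close> the form
  \<open>(S x) l\<close> meets the factor \<open>x l\<close>, and the equation replaces their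
  product by \<open>- 1 - \<zeta> * x l\<close>, which lowers the degree.\<close>

lemma reduce_monomial:
  assumes "A \<subseteq> I" "set xs \<subseteq> I" "xs \<noteq> []" "card A + length xs = Suc (card I)"
  shows "(\<lambda>p. (\<Prod>l\<in>A. x l p) * prod_list (map (\<lambda>i. x i p) xs)) \<in> V (card I) 1"
  using assms
proof (induction xs arbitrary: A)
  case (Cons k ys)
  have k: "k \<in> I" and ys: "set ys \<subseteq> I" and finA: "finite A"
    using Cons.prems fin finite_subset by auto
  define Y where "Y = (\<lambda>p. prod_list (map (\<lambda>i. x i p) ys))"
  define y where "y = (\<lambda>l p. \<Sum>j\<in>I. S l j * x j p)"
  obtain c where c: "\<And>v. v k = (\<Sum>l\<in>I. c l * (if l \<in> A then \<Sum>j\<in>I. S l j * v j else v l))"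
    using nondegenerate[OF Cons.prems(1) k] by blast
  have "(\<lambda>p. (if l \<in> A then y l p else x l p) * ((\<Prod>l\<in>A. x l p) * Y p)) \<in> V (card I) 1" if l: "l \<in> I" for l
  proof (cases "l \<in> A")
    case True
    have lA: "A - {l} \<subseteq> I" using Cons.prems by auto
    have "card (A - {l}) + length ys \<le> card I" using Cons.prems(4) by (auto simp: card_Diff_subset_Int)
    then have 1: "(\<lambda>p. (\<Prod>l\<in>A - {l}. x l p) * Y p) \<in> V (card I) 1"
      using V_mono[OF V_monomial[OF lA ys], of "card I" 1] by (simp add: Y_def)
    have "(\<lambda>p. (\<Prod>l\<in>A. x l p) * Y p) \<in> V (card I) 0"
      using V_monomial[OF Cons.prems(1) ys] Cons.prems(4) by (simp add: Y_def)
    then have 2: "(\<lambda>p. \<zeta> p * ((\<Prod>l\<in>A. x l p) * Y p)) \<in> V (card I) 1" using V_zeta by fastforce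
    have "(\<lambda>p. (- 1) * ((\<Prod>l\<in>A - {l}. x l p) * Y p) + (- 1) * (\<zeta> p * ((\<Prod>l\<in>A. x l p) * Y p))) \<in> V (card I) 1"
      using 1 2 unfolding V_def by (intro lspan_add lspan_cmult)
    moreover have "(- 1) * ((\<Prod>l\<in>A - {l}. x l p) * Y p) + (- 1) * (\<zeta> p * ((\<Prod>l\<in>A. x l p) * Y p))
        = y l p * ((\<Prod>l\<in>A. x l p) * Y p)" for p
    proof -
      have r: "x l p * y l p = - 1 - \<zeta> p * x l p" using rel[OF l, of p] by (simp add: y_def algebra_simps eq_neg_iff_add_eq_0)
      have pr: "(\<Prod>l\<in>A. x l p) = x l p * (\<Prod>l\<in>A - {l}. x l p)" using True finA by (simp add: prod.remove)
      have "y l p * ((\<Prod>l\<in>A. x l p) * Y p) = (x l p * y l p) * ((\<Prod>l\<in>A - {l}. x l p) * Y p)"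
        unfolding pr by (simp add: mult_ac)
      also have "\<dots> = (- 1) * ((\<Prod>l\<in>A - {l}. x l p) * Y p) + (- 1) * (\<zeta> p * ((\<Prod>l\<in>A. x l p) * Y p))"
        unfolding r pr by (simp add: algebra_simps)
      finally show ?thesis by simp
    qed
    ultimately show ?thesis using True by simp
  next
    case False
    have sub: "insert l A \<subseteq> I" using l Cons.prems by auto
    have cl: "card (insert l A) + length ys = Suc (card I)" using Cons.prems(4) False finA by simp
    \<comment> \<open>The set cannot outgrow \<open>I\<close>, so in total degree
      \<open>card I + 1\<close> the list still contains a factor; this is why the induction never
      meets the empty list.\<close>
    have "ys \<noteq> []" using cl card_mono[OF fin sub] by auto
    from Cons.IH[OF sub ys this cl] show ?thesis
      using False finA by (simp add: Y_def mult.assoc)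
  qed
  then have "(\<lambda>p. \<Sum>l\<in>I. c l * ((if l \<in> A then y l p else x l p) * ((\<Prod>l\<in>A. x l p) * Y p))) \<in> V (card I) 1"
    unfolding V_def by (intro lspan_sum lspan_cmult)
  moreover have "(\<Sum>l\<in>I. c l * ((if l \<in> A then y l p else x l p) * ((\<Prod>l\<in>A. x l p) * Y p)))
      = (\<Prod>l\<in>A. x l p) * prod_list (map (\<lambda>i. x i p) (k # ys))" for p
  proof -
    have xk: "x k p = (\<Sum>l\<in>I. c l * (if l \<in> A then y l p else x l p))"
      using c[of "\<lambda>j. x j p"] unfolding y_def .
    have "(\<Sum>l\<in>I. c l * ((if l \<in> A then y l p else x l p) * ((\<Prod>l\<in>A. x l p) * Y p)))
        = x k p * ((\<Prod>l\<in>A. x l p) * Y p)"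
      unfolding xk sum_distrib_right by (simp only: mult.assoc)
    then show ?thesis by (simp add: Y_def mult_ac)
  qed
  ultimately show ?case by simp
qed simp

text \<open>Lowering the degree in the unknowns by one costs a single power of \<zeta>, so the
  \<zeta>-degree needed for \<open>x k p ^ n\<close> grows only linearly in
  \<open>n\<close>.\<close>

lemma V_reduce: "f \<in> V (Suc (card I)) e \<Longrightarrow> f \<in> V (card I) (Suc e)"
  unfolding V_def
proof (erule lspan_trans)
  fix g assume g: "g \<in> G (Suc (card I)) e"
  show "\<phi> g \<in> lspan \<phi> (G (card I) (Suc e))"
  proof (cases "length (fst g) \<le> card I")
    case True
    then show ?thesis using g by (intro lspan_base[OF finG]) (auto simp: G_def)
  next
    case False
    then have "length (fst g) = Suc (card I)" "set (fst g) \<subseteq> I" "snd g \<le> e" using g by (auto simp: G_def)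
    then have "(\<lambda>p. prod_list (map (\<lambda>i. x i p) (fst g))) \<in> V (card I) 1"
      using reduce_monomial[of "{}" "fst g"] by (cases "fst g = []") auto
    then have "(\<lambda>p. \<zeta> p ^ snd g * prod_list (map (\<lambda>i. x i p) (fst g))) \<in> V (card I) (snd g + 1)"
      by (rule V_zeta_pow)
    then have "\<phi> g \<in> V (card I) (Suc e)"
      using \<open>snd g \<le> e\<close> by (auto simp: \<phi>_def[abs_def] elim: V_mono)
    then show ?thesis by (simp add: V_def)
  qed
qed

lemma V_power: "k \<in> I \<Longrightarrow> (\<lambda>p. x k p ^ n) \<in> V (card I) n"
proof (induction n)
  case 0
  have "([], 0) \<in> G (card I) 0" by (auto simp: G_def)
  then have "\<phi> ([], 0) \<in> V (card I) 0" unfolding V_def by (rule lspan_base[OF finG])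
  then show ?case by (simp add: \<phi>_def[abs_def])
next
  case (Suc n)
  then show ?case using V_reduce[OF V_x] by simp
qed

lemma algebraic:
  fixes N defines "N \<equiv> card {xs. set xs \<subseteq> I \<and> length xs \<le> card I}"
  assumes k: "k \<in> I"
  shows "\<exists>a. (\<exists>e\<in>{..N * N} \<times> {..N}. a e \<noteq> 0) \<and>
    (\<forall>p. (\<Sum>e\<in>{..N * N} \<times> {..N}. a e * \<zeta> p ^ fst e * x k p ^ snd e) = 0)"
proof -
  let ?E = "{..N * N} \<times> {..N}" and ?G = "G (card I) (N * N + N)"
  have "\<exists>c. \<forall>p. \<zeta> p ^ fst e * x k p ^ snd e = (\<Sum>g\<in>?G. c g * \<phi> g p)" if "e \<in> ?E" for e
  proof -
    have "(\<lambda>p. \<zeta> p ^ fst e * x k p ^ snd e) \<in> V (card I) (N * N + N)"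
      using V_zeta_pow[OF V_power[OF k]] by (rule V_mono) (use that in auto)
    then show ?thesis by (simp add: V_def lspan_def)
  qed
  then obtain c where c: "\<And>e p. e \<in> ?E \<Longrightarrow> \<zeta> p ^ fst e * x k p ^ snd e = (\<Sum>g\<in>?G. c e g * \<phi> g p)" by metis
  \<comment> \<open>The ranges \<open>N * N\<close> and \<open>N\<close> make the unknowns outnumber
    the generators by exactly one: (N^2 + 1)(N + 1) = N (N^2 + N + 1) + 1. Since \<open>N\<close>
    depends on \<open>card I\<close> alone, so does the degree of the relation.\<close>
  have "card ?G = N * Suc (N * N + N)"
    unfolding G_def card_cartesian_product N_def[symmetric] by simp
  moreover have "card ?E = Suc (N * N) * Suc N" by (simp add: card_cartesian_product)
  ultimately have lt: "card ?G < card ?E" by (simp add: algebra_simps)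
  have "finite ?E" by simp
  from homogeneous_system_nontrivial_solution[OF finG this lt, of c] obtain a where a: "\<exists>e\<in>?E. a e \<noteq> 0" "\<And>g. g \<in> ?G \<Longrightarrow> (\<Sum>e\<in>?E. a e * c e g) = 0"
    by blast
  have "(\<Sum>e\<in>?E. a e * \<zeta> p ^ fst e * x k p ^ snd e) = 0" for p
  proof -
    have "(\<Sum>e\<in>?E. a e * \<zeta> p ^ fst e * x k p ^ snd e) = (\<Sum>e\<in>?E. \<Sum>g\<in>?G. a e * c e g * \<phi> g p)"
      by (intro sum.cong) (auto simp: c mult.assoc sum_distrib_left simp del: mult_Suc)
    also have "\<dots> = (\<Sum>g\<in>?G. (\<Sum>e\<in>?E. a e * c e g) * \<phi> g p)"
      by (subst sum.swap) (simp add: sum_distrib_right)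
    also have "\<dots> = 0" using a(2) by simp
    finally show ?thesis .
  qed
  then show ?thesis using a(1) by blast
qed

end

section \<open>Perturbation to invertible principal submatrices and passage to the limit\<close>

text \<open>For each \<open>A\<close> the rows outside \<open>A\<close> are replaced by 0. Adding
  \<epsilon> times the identity gives a singular matrix only if -\<epsilon> is an eigenvalue, which
  excludes finitely many \<epsilon>, and there are finitely many sets \<open>A\<close>.\<close>

lemma principal_nondegenerate_perturbation:
  fixes S :: "nat \<Rightarrow> nat \<Rightarrow> complex"
  obtains \<epsilon>0 :: real where "\<epsilon>0 > 0" and "\<And>\<epsilon> A k. 0 < \<epsilon> \<Longrightarrow> \<epsilon> < \<epsilon>0 \<Longrightarrow> A \<subseteq> {1..n} \<Longrightarrow> k \<in> {1..n} \<Longrightarrow>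
    \<exists>c. \<forall>v. v k = (\<Sum>l\<in>{1..n}. c l * (if l \<in> A then \<Sum>j\<in>{1..n}. (S l j + (if l = j then of_real \<epsilon> else 0)) * v j else v l))"
proof -
  define M where "M = (\<lambda>A. mat n n (\<lambda>(i, j). if Suc i \<in> A then S (Suc i) (Suc j) else 0))"
  have Mc: "M A \<in> carrier_mat n n" for A by (simp add: M_def)
  have "finite {\<epsilon>::real. eigenvalue (M A) (- of_real \<epsilon>)}" for A
  proof -
    have "char_poly (M A) \<noteq> 0" using degree_monic_char_poly[OF Mc[of A]] by auto
    then have "finite {y. poly (char_poly (M A)) y = 0}" by (rule poly_roots_finite)
    then have "finite ((\<lambda>\<epsilon>::real. - complex_of_real \<epsilon>) -` {y. poly (char_poly (M A)) y = 0})"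
      by (intro finite_vimageI) (auto simp: inj_on_def)
    then show ?thesis by (simp add: vimage_def eigenvalue_root_char_poly[OF Mc])
  qed
  \<comment> \<open>The element 1 makes the set nonempty, so that its minimum exists; all members
    are positive.\<close>
  then have fin: "finite (insert 1 (\<Union>A\<in>Pow {1..n}. {\<epsilon>::real. \<epsilon> > 0 \<and> eigenvalue (M A) (- of_real \<epsilon>)}))" (is "finite ?F")
    by (intro finite.insertI finite_UN_I) (auto elim!: rev_finite_subset)
  define \<epsilon>0 where "\<epsilon>0 = Min ?F"
  have "\<epsilon>0 \<in> ?F" unfolding \<epsilon>0_def using fin by (intro Min_in) auto
  then have pos: "\<epsilon>0 > 0" by auto
  have nd: "\<exists>c. \<forall>v. v k = (\<Sum>l\<in>{1..n}. c l * (if l \<in> A then \<Sum>j\<in>{1..n}. (S l j + (if l = j then of_real \<epsilon> else 0)) * v j else v l))"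
    if \<epsilon>: "0 < \<epsilon>" "\<epsilon> < \<epsilon>0" and A: "A \<subseteq> {1..n}" and k: "k \<in> {1..n}" for \<epsilon> A k
  proof -
    have "\<not> eigenvalue (M A) (- of_real \<epsilon>)"
    proof
      assume "eigenvalue (M A) (- of_real \<epsilon>)"
      then have "\<epsilon> \<in> ?F" using \<epsilon> A by auto
      then have "\<epsilon>0 \<le> \<epsilon>" unfolding \<epsilon>0_def by (rule Min_le[OF fin])
      then show False using \<epsilon> by simp
    qed
    define C where "C = char_matrix (M A) (- of_real \<epsilon>)"
    have Cc: "C \<in> carrier_mat n n" unfolding C_def by (intro char_matrix_closed Mc)
    have det: "det C \<noteq> 0" using \<open>\<not> eigenvalue (M A) (- of_real \<epsilon>)\<close> eigenvalue_det[OF Mc] by (simp add: C_def)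
    have Cij: "C $$ (i, j) = (if Suc i \<in> A then S (Suc i) (Suc j) else 0) + (if i = j then of_real \<epsilon> else 0)"
      if "i < n" "j < n" for i j
      using that by (simp add: C_def char_matrix_def M_def)
    define B where "B = adj_mat C"
    have Bc: "B \<in> carrier_mat n n" and BC: "B * C = det C \<cdot>\<^sub>m 1\<^sub>m n" unfolding B_def using adj_mat[OF Cc] by auto
    obtain k' where k': "k = Suc k'" "k' < n" using k by (cases k) auto
    \<comment> \<open>Row \<open>k\<close> of the inverse of \<open>C\<close>. The rows of
      \<open>C\<close> outside \<open>A\<close> give \<open>\<epsilon> * v l\<close> instead of
      \<open>v l\<close>, hence the extra factor \<epsilon> there.\<close>
    define c where "c = (\<lambda>l. B $$ (k', l - 1) / det C * (if l \<in> A then 1 else of_real \<epsilon>))"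
    have "v k = (\<Sum>l\<in>{1..n}. c l * (if l \<in> A then \<Sum>j\<in>{1..n}. (S l j + (if l = j then of_real \<epsilon> else 0)) * v j else v l))" for v
    proof -
      have row: "(\<Sum>l<n. B $$ (k', l) * C $$ (l, j)) = (if k' = j then det C else 0)" if "j < n" for j
      proof -
        have "(B * C) $$ (k', j) = (\<Sum>l<n. B $$ (k', l) * C $$ (l, j))"
          using Bc Cc k' that by (simp add: scalar_prod_def lessThan_atLeast0)
        moreover have "(B * C) $$ (k', j) = (if k' = j then det C else 0)"
          unfolding BC using k' that by simp
        ultimately show ?thesis by simp
      qed
      have rowC: "(\<Sum>j<n. C $$ (l, j) * v (Suc j)) = (if Suc l \<in> A then \<Sum>j<n. (S (Suc l) (Suc j) + (if l = j then of_real \<epsilon> else 0)) * v (Suc j) else of_real \<epsilon> * v (Suc l))"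
        if "l < n" for l
      proof (cases "Suc l \<in> A")
        case True
        then show ?thesis using that by (auto simp: Cij intro!: sum.cong)
      next
        case False
        then have "(\<Sum>j<n. C $$ (l, j) * v (Suc j)) = (\<Sum>j<n. if l = j then of_real \<epsilon> * v (Suc j) else 0)"
          using that by (intro sum.cong) (auto simp: Cij)
        then show ?thesis using False that by (simp add: sum.delta')
      qed
      have "det C * v k = (\<Sum>j<n. (\<Sum>l<n. B $$ (k', l) * C $$ (l, j)) * v (Suc j))"
        using k' by (simp add: row if_distrib[of "\<lambda>c. c * _"] sum.delta' cong: if_cong)
      also have "\<dots> = (\<Sum>l<n. B $$ (k', l) * (\<Sum>j<n. C $$ (l, j) * v (Suc j)))"
        unfolding sum_distrib_right sum_distrib_left by (subst sum.swap) (simp add: mult.assoc)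
      finally have "v k = (\<Sum>l<n. B $$ (k', l) * (\<Sum>j<n. C $$ (l, j) * v (Suc j))) / det C"
        using det by (simp add: field_simps)
      also have "\<dots> = (\<Sum>l<n. B $$ (k', l) / det C * (\<Sum>j<n. C $$ (l, j) * v (Suc j)))"
        by (simp add: sum_divide_distrib)
      also have "\<dots> = (\<Sum>l<n. c (Suc l) * (if Suc l \<in> A then \<Sum>j<n. (S (Suc l) (Suc j) + (if Suc l = Suc j then of_real \<epsilon> else 0)) * v (Suc j) else v (Suc l)))"
        by (intro sum.cong) (auto simp: rowC c_def)
      also have "\<dots> = (\<Sum>l\<in>{1..n}. c l * (if l \<in> A then \<Sum>j\<in>{1..n}. (S l j + (if l = j then of_real \<epsilon> else 0)) * v j else v l))"
        unfolding One_nat_def sum.atLeast1_atMost_eq by simp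
      finally show ?thesis .
    qed
    then show ?thesis by blast
  qed
  show thesis by (rule that[OF pos nd])
qed

lemma finite_family_convergent_subsequence:
  fixes b :: "nat \<Rightarrow> 'e \<Rightarrow> 'a::heine_borel"
  assumes "finite F" "\<And>e. e \<in> F \<Longrightarrow> bounded (range (\<lambda>i. b i e))"
  shows "\<exists>r l. strict_mono r \<and> (\<forall>e\<in>F. (\<lambda>i. b (r i) e) \<longlonglongrightarrow> l e)"
  using assms
proof (induction F rule: finite_induct)
  case empty
  show ?case by (intro exI[of _ "\<lambda>i. i"]) (auto simp: strict_mono_def)
next
  case (insert e F)
  then obtain r l where r: "strict_mono r" "\<And>e. e \<in> F \<Longrightarrow> (\<lambda>i. b (r i) e) \<longlonglongrightarrow> l e" by auto
  have "bounded (range (\<lambda>i. b (r i) e))"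
    using insert.prems[of e] by (rule bounded_subset) auto
  then obtain s l' where s: "strict_mono (s :: nat \<Rightarrow> nat)" "(\<lambda>i. b (r (s i)) e) \<longlonglongrightarrow> l'"
    using bounded_imp_convergent_subsequence[of "\<lambda>i. b (r i) e"] by (auto simp: o_def)
  have "(\<lambda>i. b (r (s i)) f) \<longlonglongrightarrow> (l(e := l')) f" if "f \<in> insert e F" for f
    using that s(2) LIMSEQ_subseq_LIMSEQ[OF r(2) s(1), of f] insert.hyps by (auto simp: o_def)
  then show ?case using strict_mono_o[OF r(1) s(1)] by (intro exI[of _ "r \<circ> s"] exI[of _ "l(e := l')"]) (auto simp: o_def)
qed

text \<open>The relations for \<open>S\<close> plus a small multiple of the identity have exponents
  in one fixed finite set. Compactness of the normalised coefficients gives a limit relation along a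
  subsequence, and stability gives convergence of the solutions.\<close>

lemma qve_algebraic:
  fixes S :: "nat \<Rightarrow> nat \<Rightarrow> real" and m :: "nat \<Rightarrow> complex \<Rightarrow> complex"
  assumes S: "\<And>l k. l \<in> {1..n} \<Longrightarrow> k \<in> {1..n} \<Longrightarrow> 0 \<le> S l k"
    and m: "\<And>z l. Im z > 0 \<Longrightarrow> l \<in> {1..n} \<Longrightarrow>
       Im (m l z) > 0 \<and> - 1 / m l z = z + (\<Sum>k\<in>{1..n}. of_real (S l k) * m k z)"
    and k: "k \<in> {1..n}"
  shows "\<exists>E a. finite E \<and> E \<noteq> {} \<and> (\<forall>e\<in>E. a e \<noteq> (0::complex)) \<and>
    (\<forall>z. Im z > 0 \<longrightarrow> (\<Sum>e\<in>E. a e * z ^ fst e * m k z ^ snd e) = 0)"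
proof -
  let ?I = "{1..n}"
  obtain \<epsilon>0 where \<epsilon>0: "\<epsilon>0 > 0" and nd: "\<And>\<epsilon> A k. 0 < \<epsilon> \<Longrightarrow> \<epsilon> < \<epsilon>0 \<Longrightarrow> A \<subseteq> ?I \<Longrightarrow> k \<in> ?I \<Longrightarrow>
    \<exists>c. \<forall>v. v k = (\<Sum>l\<in>?I. c l * (if l \<in> A then \<Sum>j\<in>?I. (complex_of_real (S l j) + (if l = j then of_real \<epsilon> else 0)) * v j else v l))"
    by (rule principal_nondegenerate_perturbation[where n = n and S = "\<lambda>l j. of_real (S l j)"]) (rule that)
  define \<epsilon> where "\<epsilon> = (\<lambda>i. \<epsilon>0 / real (i + 2))"
  have \<epsilon>: "0 < \<epsilon> i" "\<epsilon> i < \<epsilon>0" for i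
    using \<epsilon>0 by (auto simp: \<epsilon>_def field_simps intro: add_pos_nonneg)
  have \<epsilon>lim: "\<epsilon> \<longlonglongrightarrow> 0" unfolding \<epsilon>_def
    using LIMSEQ_ignore_initial_segment[OF lim_const_over_n, of \<epsilon>0 2] .
  define Se where "Se = (\<lambda>i l j. S l j + (if l = j then \<epsilon> i else 0))"
  have Se0: "0 \<le> Se i l k" if "l \<in> ?I" "k \<in> ?I" for i l k
    using S[OF that] \<epsilon>(1)[of i] by (simp add: Se_def)
  define sol where "sol = (\<lambda>i z u. \<forall>l\<in>?I. Im (u l) > 0 \<and> - 1 / u l = z + (\<Sum>k\<in>?I. of_real (Se i l k) * u k))"
  define u where "u = (\<lambda>i z. SOME u. sol i z u)"
  have "\<exists>u. sol i z u" if "Im z > 0" for i z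
    unfolding sol_def by (rule qve_exists) (use Se0 that in auto)
  then have "sol i z (u i z)" if "Im z > 0" for i z
    unfolding u_def using that by (intro someI_ex[of "sol i z"]) blast
  then have u: "Im (u i z l) > 0 \<and> - 1 / u i z l = z + (\<Sum>k\<in>?I. of_real (Se i l k) * u i z k)"
    if "Im z > 0" "l \<in> ?I" for i z l
    using that unfolding sol_def by blast
  define N where "N = card {xs. set xs \<subseteq> ?I \<and> length xs \<le> card ?I}"
  define F where "F = {..N * N} \<times> {..N}"
  \<comment> \<open>The points \<open>p\<close> of the locale range over a whole type; outside the
    half-plane \<open>h\<close> takes the default value \<open>\<i>\<close>, so the equations hold
    at every \<open>p\<close>.\<close>
  define h where "h = (\<lambda>z. if Im z > 0 then z else \<i>)"
  have h: "Im (h z) > 0" for z by (simp add: h_def)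
  have "\<exists>a. (\<exists>e\<in>F. a e \<noteq> 0) \<and> (\<forall>p. (\<Sum>e\<in>F. a e * h p ^ fst e * u i (h p) k ^ snd e) = 0)" for i
  proof -
    interpret nondegenerate_qve ?I "\<lambda>l j. of_real (Se i l j)" "\<lambda>l p. u i (h p) l" h
    proof
      fix l p assume l: "l \<in> ?I"
      then have "u i (h p) l \<noteq> 0" using u[OF h[of p] l, of i] by auto
      moreover have e: "h p + (\<Sum>k\<in>?I. of_real (Se i l k) * u i (h p) k) = - 1 / u i (h p) l"
        using u[OF h[of p] l, of i] by simp
      ultimately show "u i (h p) l * (h p + (\<Sum>k\<in>?I. of_real (Se i l k) * u i (h p) k)) = - 1"
        unfolding e by simp
    next
      fix A k assume "A \<subseteq> ?I" "k \<in> ?I"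
      then show "\<exists>c. \<forall>v. v k = (\<Sum>l\<in>?I. c l * (if l \<in> A then \<Sum>j\<in>?I. complex_of_real (Se i l j) * v j else v l))"
      proof -
        have "(of_real (Se i l j) :: complex) = of_real (S l j) + (if l = j then of_real (\<epsilon> i) else 0)" for l j
          by (simp add: Se_def)
        then show ?thesis using nd[OF \<epsilon>(1)[of i] \<epsilon>(2)[of i] \<open>A \<subseteq> ?I\<close> \<open>k \<in> ?I\<close>] by (simp only:)
      qed
    qed auto
    show ?thesis using algebraic[OF k] unfolding F_def N_def by simp
  qed
  then obtain a where a: "\<And>i. \<exists>e\<in>F. a i e \<noteq> 0"
    "\<And>i p. (\<Sum>e\<in>F. a i e * h p ^ fst e * u i (h p) k ^ snd e) = 0" by metis
  have finF: "finite F" by (simp add: F_def)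
  define s where "s = (\<lambda>i. \<Sum>e\<in>F. norm (a i e))"
  have s: "s i > 0" for i
  proof -
    obtain e where "e \<in> F" "a i e \<noteq> 0" using a(1)[of i] by blast
    then show ?thesis unfolding s_def using finF by (intro sum_pos2[of F e]) auto
  qed
  \<comment> \<open>Without normalisation the coefficients could tend to 0 and the limit relation
    would be trivial.\<close>
  define b where "b = (\<lambda>i e. a i e / of_real (s i))"
  have sumb: "(\<Sum>e\<in>F. norm (b i e)) = 1" for i
  proof -
    have "(\<Sum>e\<in>F. norm (b i e)) = (\<Sum>e\<in>F. norm (a i e) / s i)"
      using s[of i] by (simp add: b_def norm_divide)
    also have "\<dots> = s i / s i" by (simp only: s_def sum_divide_distrib[symmetric])
    finally have "(\<Sum>e\<in>F. norm (b i e)) = s i / s i" .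
    then show ?thesis using s[of i] by simp
  qed
  have bb: "norm (b i e) \<le> 1" if "e \<in> F" for i e
    using member_le_sum[of e F "\<lambda>e. norm (b i e)"] that finF sumb[of i] by simp
  have "\<exists>r l. strict_mono r \<and> (\<forall>e\<in>F. (\<lambda>i. b (r i) e) \<longlonglongrightarrow> l e)"
    by (rule finite_family_convergent_subsequence[OF finF]) (use bb in \<open>auto simp: bounded_iff\<close>)
  then obtain r l where r: "strict_mono r" "\<And>e. e \<in> F \<Longrightarrow> (\<lambda>i. b (r i) e) \<longlonglongrightarrow> l e" by blast
  have "(\<lambda>i. \<Sum>e\<in>F. norm (b (r i) e)) \<longlonglongrightarrow> (\<Sum>e\<in>F. norm (l e))" by (intro tendsto_intros r)
  then have l1: "(\<Sum>e\<in>F. norm (l e)) = 1" by (simp add: sumb LIMSEQ_const_iff)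
  have lim: "(\<lambda>i. u (r i) z k) \<longlonglongrightarrow> m k z" if z: "Im z > 0" for z
  proof -
    define X where "X = (\<Sum>l\<in>?I. \<Sum>k\<in>?I. S l k) / Im z"
    have ub: "cmod (u i z l) \<le> 1 / Im z" if "l \<in> ?I" for i l
      by (rule qve_solution_bound[of ?I "Se i" l "u i z" "Im z" z]) (use Se0 u z that in auto)
    \<comment> \<open>The perturbation is moved into the inhomogeneity: \<open>u i z\<close> solves
      the equation for \<open>S\<close> with \<open>z + \<epsilon> i * u i z l\<close> in row
      \<open>l\<close>. This only increases the imaginary part and moves \<open>z\<close> by at most
      \<open>\<epsilon> i / Im z\<close>.\<close>
    have "cmod (m k z - u i z k) \<le> (\<epsilon> i / Im z) * (Im z + X) / Im z ^ 3" for i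
      unfolding X_def
    proof (rule qve_stability[of ?I S "\<lambda>l. m l z" "\<lambda>_. z" "u i z" "\<lambda>l. z + of_real (\<epsilon> i) * u i z l"])
      fix l assume l: "l \<in> ?I"
      have "(\<Sum>k\<in>?I. of_real (Se i l k) * u i z k) = (\<Sum>k\<in>?I. of_real (S l k) * u i z k + (if l = k then of_real (\<epsilon> i) * u i z k else 0))"
        by (intro sum.cong) (auto simp: Se_def algebra_simps)
      also have "\<dots> = (\<Sum>k\<in>?I. of_real (S l k) * u i z k) + of_real (\<epsilon> i) * u i z l"
        using l by (simp add: sum.distrib sum.delta)
      finally show "0 < Im (u i z l) \<and> - 1 / u i z l = z + of_real (\<epsilon> i) * u i z l + (\<Sum>k\<in>?I. of_real (S l k) * u i z k)"
        using u[OF z l, of i] by simp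
      have "cmod (z - (z + of_real (\<epsilon> i) * u i z l)) = \<epsilon> i * cmod (u i z l)"
        using \<epsilon>(1)[of i] by (simp add: norm_mult)
      also have "\<dots> \<le> \<epsilon> i * (1 / Im z)" using ub[OF l, of i] \<epsilon>(1)[of i] by (intro mult_left_mono) auto
      finally show "Im z \<le> Im z \<and> Im z \<le> Im (z + of_real (\<epsilon> i) * u i z l) \<and> cmod (z - (z + of_real (\<epsilon> i) * u i z l)) \<le> \<epsilon> i / Im z"
        using u[OF z l, of i] \<epsilon>(1)[of i] by simp
    qed (use S m z k in auto)
    then have "\<forall>i. norm (u (r i) z k - m k z) \<le> (\<epsilon> (r i) / Im z) * (Im z + X) / Im z ^ 3"
      by (simp add: norm_minus_commute)
    moreover have "(\<lambda>i. (\<epsilon> (r i) / Im z) * (Im z + X) / Im z ^ 3) \<longlonglongrightarrow> (0 / Im z) * (Im z + X) / Im z ^ 3"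
      using z by (intro tendsto_intros LIMSEQ_subseq_LIMSEQ[OF \<epsilon>lim r(1), unfolded o_def]) auto
    ultimately have "(\<lambda>i. u (r i) z k - m k z) \<longlonglongrightarrow> 0"
      by (intro Lim_null_comparison[of "\<lambda>i. u (r i) z k - m k z"]) auto
    then show ?thesis by (simp add: LIM_zero_iff)
  qed
  \<comment> \<open>Only the exponents with nonzero limit coefficient are kept; the total modulus 1
    shows that some remain.\<close>
  define E where "E = {e \<in> F. l e \<noteq> 0}"
  have "(\<Sum>e\<in>E. l e * z ^ fst e * m k z ^ snd e) = 0" if z: "Im z > 0" for z
  proof -
    have hz: "h z = z" using z by (simp add: h_def)
    have "(\<Sum>e\<in>F. b i e * z ^ fst e * u i z k ^ snd e) = (\<Sum>e\<in>F. a i e * z ^ fst e * u i z k ^ snd e) / of_real (s i)" for i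
      by (simp add: b_def sum_divide_distrib)
    then have "(\<Sum>e\<in>F. b i e * z ^ fst e * u i z k ^ snd e) = 0" for i using a(2)[of i z] hz by simp
    moreover have "(\<lambda>i. \<Sum>e\<in>F. b (r i) e * z ^ fst e * u (r i) z k ^ snd e) \<longlonglongrightarrow> (\<Sum>e\<in>F. l e * z ^ fst e * m k z ^ snd e)"
      by (intro tendsto_intros r lim z)
    ultimately have "(\<Sum>e\<in>F. l e * z ^ fst e * m k z ^ snd e) = 0"
      by (simp add: LIMSEQ_const_iff)
    moreover have "(\<Sum>e\<in>E. l e * z ^ fst e * m k z ^ snd e) = (\<Sum>e\<in>F. l e * z ^ fst e * m k z ^ snd e)"
      unfolding E_def using finF by (intro sum.mono_neutral_left) auto
    ultimately show ?thesis by simp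
  qed
  moreover have "E \<noteq> {}"
  proof
    assume "E = {}"
    then have "l e = 0" if "e \<in> F" for e using that unfolding E_def by blast
    then have "(\<Sum>e\<in>F. norm (l e)) = 0" by simp
    then show False using l1 by simp
  qed
  ultimately show ?thesis using finF by (intro exI[of _ E] exI[of _ l]) (auto simp: E_def)
qed

section \<open>Leading terms of algebraic functions in the half-plane\<close>

text \<open>The image of a small half-disc is connected and contained in disjoint balls around the
  points of \<open>F\<close>, hence in one of them. This selects both the exponent and the leading
  coefficient below.\<close>

lemma tendsto_finite_set_connected:
  fixes f :: "complex \<Rightarrow> 'a::metric_space"
  assumes F: "finite F" and cont: "continuous_on ({z. Im z > 0} \<inter> ball 0 1) f"
    and near: "\<And>\<epsilon>. \<epsilon> > 0 \<Longrightarrow> \<forall>\<^sub>F z in at 0 within {z. Im z > 0}. \<exists>p\<in>F. dist (f z) p < \<epsilon>"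
  shows "\<exists>p\<in>F. (f \<longlongrightarrow> p) (at 0 within {z. Im z > 0})"
proof -
  \<comment> \<open>Half the least distance between two points of \<open>F\<close>, with 1 inserted
    for the case that there are no two; balls of radius \<open>s\<close> are then disjoint.\<close>
  define s where "s = Min (insert 1 ((\<lambda>(p, q). dist p q) ` {(p, q) \<in> F \<times> F. p \<noteq> q})) / 2"
  have finD: "finite (insert 1 ((\<lambda>(p, q). dist p q) ` {(p, q) \<in> F \<times> F. p \<noteq> q}))"
    using F by (intro finite.insertI finite_imageI finite_subset[OF _ finite_cartesian_product[OF F F]]) auto
  have s: "s > 0" unfolding s_def using finD by (subst zero_less_divide_iff) auto
  have sep: "p = q" if "p \<in> F" "q \<in> F" "dist p q < 2 * s" for p q
  proof (rule ccontr)
    assume "p \<noteq> q"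
    then have "dist p q \<in> insert 1 ((\<lambda>(p, q). dist p q) ` {(p, q) \<in> F \<times> F. p \<noteq> q})" using that by force
    then have "2 * s \<le> dist p q" unfolding s_def using Min_le[OF finD] by simp
    then show False using that by simp
  qed
  obtain \<delta>' where \<delta>': "\<delta>' > 0" "\<And>z. Im z > 0 \<Longrightarrow> z \<noteq> 0 \<Longrightarrow> dist z 0 < \<delta>' \<Longrightarrow> \<exists>p\<in>F. dist (f z) p < s"
    using near[OF s] unfolding eventually_at by auto
  define \<delta> where "\<delta> = min \<delta>' 1"
  have \<delta>: "\<delta> > 0" "\<delta> \<le> 1" "\<And>z. Im z > 0 \<Longrightarrow> norm z < \<delta> \<Longrightarrow> \<exists>p\<in>F. dist (f z) p < s"
    using \<delta>'(1) by (simp_all add: \<delta>_def) (use \<delta>'(2) in force)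
  define X where "X = {z. Im z > 0} \<inter> ball 0 \<delta>"
  have "convex X" unfolding X_def by (intro convex_Int convex_halfspace_Im_gt convex_ball)
  then have conX: "connected X" by (rule convex_connected)
  have "continuous_on X f" by (rule continuous_on_subset[OF cont]) (use \<delta> in \<open>auto simp: X_def\<close>)
  then have con: "connected (f ` X)" using conX by (rule connected_continuous_image)
  have z0: "\<i> * of_real (\<delta> / 2) \<in> X" using \<delta> by (simp add: X_def norm_mult)
  then obtain p where p: "p \<in> F" "dist (f (\<i> * of_real (\<delta> / 2))) p < s" using \<delta>(3) by (force simp: X_def)
  define B where "B = (\<Union>q\<in>F - {p}. ball q s)"
  have disj: "ball p s \<inter> B \<inter> f ` X = {}"
  proof -
    have False if "dist p y < s" "q \<in> F" "q \<noteq> p" "dist q y < s" for y q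
    proof -
      have "dist p q < 2 * s" using that dist_triangle2[of p q y] by simp
      then show False using sep p that by blast
    qed
    then show ?thesis unfolding B_def by fastforce
  qed
  have cover: "f ` X \<subseteq> ball p s \<union> B" using \<delta>(3) by (force simp: X_def B_def dist_commute)
  have "ball p s \<inter> f ` X = {} \<or> B \<inter> f ` X = {}"
    by (rule connectedD[OF con]) (use disj cover in \<open>auto simp: B_def\<close>)
  moreover have "ball p s \<inter> f ` X \<noteq> {}" using z0 p(2) by (auto simp: dist_commute)
  ultimately have allp: "dist (f z) p < s" if "z \<in> X" for z using cover that by (force simp: dist_commute)
  have "(f \<longlongrightarrow> p) (at 0 within {z. Im z > 0})"
  proof (rule tendstoI)
    fix \<epsilon> :: real assume "\<epsilon> > 0"
    then have "\<forall>\<^sub>F z in at 0 within {z. Im z > 0}. \<exists>q\<in>F. dist (f z) q < min \<epsilon> s"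
      using near[of "min \<epsilon> s"] s by simp
    moreover have "\<forall>\<^sub>F z in at 0 within {z. Im z > 0}. z \<in> X"
      unfolding eventually_at X_def using \<delta>(1) by auto
    ultimately show "\<forall>\<^sub>F z in at 0 within {z. Im z > 0}. dist (f z) p < \<epsilon>"
    proof eventually_elim
      case (elim z)
      then obtain q where q: "q \<in> F" "dist (f z) q < min \<epsilon> s" by blast
      have "dist p q < 2 * s" using q allp[OF elim(2)] dist_triangle3[of p q "f z"] by simp
      then have "p = q" using sep p q by blast
      then show ?case using q by simp
    qed
  qed
  then show ?thesis using p by blast
qed

text \<open>A sum of terms can vanish only if the two largest are comparable, so
  \<open>ln (norm (w z))\<close> is, up to a bounded error, one of finitely many multiples of
  \<open>ln (norm z)\<close>. After division by that power, \<open>w\<close> stays bounded, bounded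
  away from 0, and close to the finitely many nonzero roots of the polynomial of an edge of the
  Newton polygon. No series is constructed.\<close>

lemma puiseux_leading_term:
  fixes w :: "complex \<Rightarrow> complex" and a :: "nat \<times> nat \<Rightarrow> complex"
  assumes E: "finite E" "E \<noteq> {}" and a: "\<And>e. e \<in> E \<Longrightarrow> a e \<noteq> 0"
    and cont: "continuous_on {z. Im z > 0} w" and w0: "\<And>z. Im z > 0 \<Longrightarrow> w z \<noteq> 0"
    and eq: "\<And>z. Im z > 0 \<Longrightarrow> (\<Sum>e\<in>E. a e * z ^ fst e * w z ^ snd e) = 0"
  shows "\<exists>r C. C \<noteq> 0 \<and> ((\<lambda>z. w z * z powr (- of_real r)) \<longlongrightarrow> C) (at 0 within {z. Im z > 0})"
proof -
  let ?H = "{z. Im z > 0}" let ?F = "at 0 within ?H"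
  define L where "L = (\<lambda>z::complex. ln (norm z))"
  define W where "W = (\<lambda>z. ln (norm (w z)))"
  define A0 where "A0 = (\<Sum>e\<in>E. \<bar>ln (norm (a e))\<bar>)"
  \<comment> \<open>On the logarithmic scale, \<open>ln (card E)\<close> comes from comparing two
    terms and each of their two coefficients contributes at most \<open>A0\<close>.\<close>
  define B where "B = ln (card E) + 2 * A0"
  have A0: "\<bar>ln (norm (a e))\<bar> \<le> A0" if "e \<in> E" for e
    unfolding A0_def using E that by (intro member_le_sum) auto
  have cE: "card E \<ge> 1" using E by (simp add: Suc_le_eq card_gt_0_iff)
  have B0: "B \<ge> 0" using cE by (auto simp: B_def A0_def intro!: add_nonneg_nonneg sum_nonneg)
  have inH: "\<forall>\<^sub>F z in ?F. Im z > 0" unfolding eventually_at by (auto intro: exI[of _ 1])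
  define T where "T = (\<lambda>e z. norm (a e * z ^ fst e * w z ^ snd e))"
  have Tpos: "T e z > 0" if "e \<in> E" "Im z > 0" for e z
    using a[OF that(1)] w0[OF that(2)] that(2) by (auto simp: T_def)
  have lnT: "ln (T e z) = ln (norm (a e)) + real (fst e) * L z + real (snd e) * W z" if "e \<in> E" "Im z > 0" for e z
  proof -
    have "z \<noteq> 0" using that by auto
    then show ?thesis using a[OF that(1)] w0[OF that(2)]
      by (simp add: T_def L_def W_def norm_mult norm_power ln_mult ln_realpow)
  qed
  have two: "\<exists>e\<in>E. \<exists>e'\<in>E. e \<noteq> e' \<and> \<bar>ln (T e z) - ln (T e' z)\<bar> \<le> ln (card E)" if z: "Im z > 0" for z
  proof -
    obtain e where e: "e \<in> E" "\<And>e'. e' \<in> E \<Longrightarrow> T e' z \<le> T e z"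
    proof -
      have "Max ((\<lambda>e. T e z) ` E) \<in> (\<lambda>e. T e z) ` E" using E by (intro Max_in) auto
      then obtain e where "e \<in> E" "T e z = Max ((\<lambda>e. T e z) ` E)" by auto
      then show thesis using E by (intro that[of e]) auto
    qed
    \<comment> \<open>If the largest term exceeded \<open>card E\<close> times each of the others,
      those others could not cancel it.\<close>
    have "\<exists>e'\<in>E - {e}. T e z \<le> card E * T e' z"
    proof (rule ccontr)
      assume "\<not> ?thesis"
      then have lt: "card E * T e' z \<le> T e z" if "e' \<in> E - {e}" for e' using that by force
      have "a e * z ^ fst e * w z ^ snd e = - (\<Sum>e\<in>E - {e}. a e * z ^ fst e * w z ^ snd e)"
        using eq[OF z] sum.remove[OF E(1) e(1), of "\<lambda>e. a e * z ^ fst e * w z ^ snd e"]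
        by (simp add: eq_neg_iff_add_eq_0)
      then have "T e z \<le> (\<Sum>e\<in>E - {e}. T e z)"
        unfolding T_def by (simp only: norm_minus_cancel norm_sum)
      then have "card E * T e z \<le> (\<Sum>e'\<in>E - {e}. card E * T e' z)"
        unfolding sum_distrib_left[symmetric] by (intro mult_left_mono) auto
      also have "\<dots> \<le> (\<Sum>e'\<in>E - {e}. T e z)" by (intro sum_mono lt)
      also have "\<dots> = (card E - 1) * T e z" using E e by simp
      also have "\<dots> < card E * T e z" using Tpos[OF e(1) z] cE by simp
      finally show False by simp
    qed
    then obtain e' where e': "e' \<in> E" "e' \<noteq> e" "T e z \<le> card E * T e' z" by auto
    have "ln (T e z) \<le> ln (card E * T e' z)" using e' Tpos z e cE by simp
    also have "\<dots> = ln (card E) + ln (T e' z)" using Tpos[OF e'(1) z] cE by (simp add: ln_mult)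
    finally have "ln (T e z) - ln (T e' z) \<le> ln (card E)" by simp
    moreover have "ln (T e' z) \<le> ln (T e z)" using e e' Tpos z by simp
    ultimately show ?thesis using e e' by (intro bexI[of _ e] bexI[of _ e']) auto
  qed
  \<comment> \<open>All candidate slopes. Pairs with equal second component contribute the value 0
    of a division by zero; only finiteness of \<open>R\<close> matters for them.\<close>
  define R where "R = (\<lambda>(e, e'). - (real (fst e) - real (fst e')) / (real (snd e) - real (snd e'))) ` (E \<times> E)"
  have finR: "finite R" unfolding R_def using E by auto
  have slope: "\<exists>r\<in>R. \<bar>W z - r * L z\<bar> \<le> B" if z: "Im z > 0" and Lz: "L z < - B" for z
  proof -
    obtain e e' where e: "e \<in> E" "e' \<in> E" "e \<noteq> e'" "\<bar>ln (T e z) - ln (T e' z)\<bar> \<le> ln (card E)"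
      using two[OF z] by blast
    define x where "x = real (fst e) - real (fst e')"
    define y where "y = real (snd e) - real (snd e')"
    have "ln (T e z) - ln (T e' z) = (ln (norm (a e)) - ln (norm (a e'))) + (x * L z + y * W z)"
      using lnT e z by (simp add: x_def y_def algebra_simps)
    then have bd: "\<bar>x * L z + y * W z\<bar> \<le> B" using e(4) A0[OF e(1)] A0[OF e(2)] unfolding B_def by linarith
    \<comment> \<open>Two terms with the same power of \<open>w\<close> differ by at least one power
      of \<open>z\<close>, and for \<open>L z < - B\<close> this is too much for them to be
      comparable.\<close>
    have "y \<noteq> 0"
    proof
      assume "y = 0"
      then have "x \<noteq> 0" using e(3) by (auto simp: x_def y_def prod_eq_iff)
      then have "\<bar>x\<bar> \<ge> 1" by (auto simp: x_def)
      then have "\<bar>L z\<bar> \<le> \<bar>x\<bar> * \<bar>L z\<bar>" by (simp add: mult_le_cancel_right1)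
      moreover have "\<bar>x\<bar> * \<bar>L z\<bar> \<le> B" using bd \<open>y = 0\<close> by (simp add: abs_mult)
      ultimately show False using Lz B0 by linarith
    qed
    then have y1: "\<bar>y\<bar> \<ge> 1" by (auto simp: y_def)
    have "W z - (- x / y) * L z = (x * L z + y * W z) / y"
      using \<open>y \<noteq> 0\<close> by (simp add: field_simps)
    then have "\<bar>W z - (- x / y) * L z\<bar> = \<bar>x * L z + y * W z\<bar> / \<bar>y\<bar>"
      by (simp only: abs_divide)
    also have "\<dots> \<le> \<bar>x * L z + y * W z\<bar> / 1" using y1 by (intro divide_left_mono) auto
    finally have "\<bar>W z - (- x / y) * L z\<bar> \<le> B" using bd by simp
    moreover have "- x / y \<in> R" unfolding R_def x_def y_def using e by force
    ultimately show ?thesis by blast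
  qed
  have Lbot: "filterlim L at_bot ?F" unfolding L_def
    by (rule filterlim_compose[OF ln_at_0]) (auto simp: filterlim_at intro!: tendsto_eq_intros eventually_mono[OF inH])
  have "filterlim (\<lambda>z. \<bar>L z\<bar>) at_top ?F"
    unfolding filterlim_at_top
  proof
    fix Z :: real
    have "\<forall>\<^sub>F z in ?F. L z < - \<bar>Z\<bar>" using Lbot by (auto simp: filterlim_at_bot_dense)
    then show "\<forall>\<^sub>F z in ?F. Z \<le> \<bar>L z\<bar>" by eventually_elim linarith
  qed
  then have BL: "((\<lambda>z. B / \<bar>L z\<bar>) \<longlongrightarrow> 0) ?F"
    by (intro tendsto_divide_0[OF tendsto_const] filterlim_at_top_imp_at_infinity)
  have Lneg: "\<forall>\<^sub>F z in ?F. L z < - B \<and> L z < 0"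
    using Lbot by (auto simp: filterlim_at_bot_dense eventually_conj_iff)
  have slope': "\<forall>\<^sub>F z in ?F. \<exists>r\<in>R. \<bar>W z - r * L z\<bar> \<le> B"
    using inH Lneg by eventually_elim (use slope in auto)
  have ratio: "\<bar>W z / L z - r\<bar> \<le> B / \<bar>L z\<bar>" if "\<bar>W z - r * L z\<bar> \<le> B" "L z < 0" for z r
  proof -
    have "W z / L z - r = (W z - r * L z) / L z" using that by (simp add: field_simps)
    then have "\<bar>W z / L z - r\<bar> = \<bar>W z - r * L z\<bar> / \<bar>L z\<bar>" by (simp add: abs_divide)
    also have "\<dots> \<le> B / \<bar>L z\<bar>" using that(1) by (rule divide_right_mono) simp
    finally show ?thesis .
  qed
  have ln_ne: "ln (norm z) \<noteq> 0" if "Im z > 0" "norm z < 1" for z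
  proof -
    have "0 < norm z" using that(1) by auto
    then show ?thesis using ln_less_zero[of "norm z"] that(2) by linarith
  qed
  \<comment> \<open>The restriction to the unit disc keeps the denominator \<open>L z\<close> away
    from its zeros on the unit circle.\<close>
  have contW: "continuous_on ({z. Im z > 0} \<inter> ball 0 1) (\<lambda>z. W z / L z)"
    unfolding W_def L_def
    by (intro continuous_intros continuous_on_subset[OF cont]) (use w0 ln_ne in auto)
  have "\<exists>r\<in>R. ((\<lambda>z. W z / L z) \<longlongrightarrow> r) ?F"
  proof (rule tendsto_finite_set_connected[OF finR contW])
    fix \<epsilon> :: real assume "\<epsilon> > 0"
    then have "\<forall>\<^sub>F z in ?F. B / \<bar>L z\<bar> < \<epsilon>" using BL order_tendstoD(2) by blast
    with slope' Lneg show "\<forall>\<^sub>F z in ?F. \<exists>p\<in>R. dist (W z / L z) p < \<epsilon>"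
      by eventually_elim (use ratio in \<open>force simp: dist_real_def\<close>)
  qed
  then obtain r where r: "r \<in> R" "((\<lambda>z. W z / L z) \<longlongrightarrow> r) ?F" by blast
  \<comment> \<open>Convergence of the ratio alone does not bound \<open>W z - r * L z\<close>. But
    the slopes form a finite set and \<open>B / \<bar>L z\<bar>\<close> tends to 0, so eventually no
    slope other than \<open>r\<close> can satisfy the estimate, and \<open>r\<close> satisfies it
    with the same constant \<open>B\<close>.\<close>
  have "\<forall>\<^sub>F z in ?F. \<forall>r'\<in>R - {r}. B / \<bar>L z\<bar> < \<bar>W z / L z - r'\<bar>"
  proof (rule eventually_ball_finite)
    show "\<forall>r'\<in>R - {r}. \<forall>\<^sub>F z in ?F. B / \<bar>L z\<bar> < \<bar>W z / L z - r'\<bar>"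
    proof
      fix r' assume "r' \<in> R - {r}"
      moreover have "((\<lambda>z. \<bar>W z / L z - r'\<bar> - B / \<bar>L z\<bar>) \<longlongrightarrow> \<bar>r - r'\<bar> - 0) ?F"
        by (intro tendsto_intros r BL)
      ultimately have "\<forall>\<^sub>F z in ?F. 0 < \<bar>W z / L z - r'\<bar> - B / \<bar>L z\<bar>"
        by (intro order_tendstoD(1)) auto
      then show "\<forall>\<^sub>F z in ?F. B / \<bar>L z\<bar> < \<bar>W z / L z - r'\<bar>" by eventually_elim simp
    qed
  qed (use finR in auto)
  with slope' Lneg have WL: "\<forall>\<^sub>F z in ?F. \<bar>W z - r * L z\<bar> \<le> B"
  proof eventually_elim
    case (elim z)
    then obtain r' where r': "r' \<in> R" "\<bar>W z - r' * L z\<bar> \<le> B" by blast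
    then have "r' = r" using ratio[of z r'] elim by force
    then show ?case using r' by simp
  qed
  define u where "u = (\<lambda>z. w z * z powr (- of_real r))"
  have zp: "norm (z powr of_real x) = exp (x * L z)" if "z \<noteq> 0" for z :: complex and x :: real
    using that by (simp add: powr_def L_def norm_exp_eq_Re)
  have ub: "\<forall>\<^sub>F z in ?F. exp (- B) \<le> norm (u z) \<and> norm (u z) \<le> exp B"
    using WL inH
  proof eventually_elim
    case (elim z)
    have "norm (u z) = exp (W z) * exp (- r * L z)"
    proof -
      have "z \<noteq> 0" using elim(2) by auto
      then show ?thesis using zp[of z "- r"] w0[OF elim(2)] by (simp add: u_def norm_mult W_def)
    qed
    also have "\<dots> = exp (W z - r * L z)" by (simp add: exp_add[symmetric])
    finally show ?case using elim by auto
  qed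
  \<comment> \<open>\<open>g e\<close> is the order of the term \<open>e\<close> when
    \<open>w\<close> has order \<open>r\<close>, and \<open>Q\<close> collects the terms of lowest
    order \<mu>.\<close>
  define g where "g = (\<lambda>e. real (fst e) + r * real (snd e))"
  define \<mu> where "\<mu> = Min (g ` E)"
  define Q where "Q = (\<lambda>y. \<Sum>e\<in>{e\<in>E. g e = \<mu>}. a e * y ^ snd e)"
  have g\<mu>: "g e \<ge> \<mu>" if "e \<in> E" for e unfolding \<mu>_def using E that by simp
  have "\<mu> \<in> g ` E" unfolding \<mu>_def using E by (intro Min_in) auto
  then obtain e0 where e0: "e0 \<in> E" "g e0 = \<mu>" by auto
  define P where "P = (\<Sum>e\<in>{e\<in>E. g e = \<mu>}. monom (a e) (snd e))"
  have QP: "Q y = poly P y" for y by (simp add: Q_def P_def poly_sum poly_monom)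
  \<comment> \<open>On one edge of the Newton polygon the power of \<open>w\<close> determines the
    power of \<open>z\<close>, so no two coefficients merge and \<open>P\<close> is nonzero.\<close>
  have inj: "e = e0" if "e \<in> E" "g e = \<mu>" "snd e = snd e0" for e
    using that e0 by (auto simp: g_def prod_eq_iff)
  have "coeff P (snd e0) = (\<Sum>e\<in>{e\<in>E. g e = \<mu>}. if e = e0 then a e else 0)"
    unfolding P_def coeff_sum using inj by (intro sum.cong) auto
  also have "\<dots> = a e0" using E e0 by (subst sum.delta) auto
  finally have "P \<noteq> 0" using a[OF e0(1)] by auto
  define Z where "Z = {y. Q y = 0 \<and> exp (- B) \<le> norm y \<and> norm y \<le> exp B}"
  have finZ: "finite Z" unfolding Z_def QP using poly_roots_finite[OF \<open>P \<noteq> 0\<close>] by (rule rev_finite_subset) auto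
  have Q_le: "\<forall>\<^sub>F z in ?F. norm (Q (u z)) \<le> (\<Sum>e\<in>{e\<in>E. g e \<noteq> \<mu>}. norm (a e) * exp ((g e - \<mu>) * L z) * exp B ^ snd e)"
    using ub inH
  proof eventually_elim
    case (elim z)
    have z0: "z \<noteq> 0" using elim by auto
    have wu: "w z = u z * z powr of_real r"
      using z0 by (simp add: u_def powr_minus field_simps)
    have t: "a e * z ^ fst e * w z ^ snd e * z powr of_real (- \<mu>) = a e * z powr of_real (g e - \<mu>) * u z ^ snd e" for e
    proof -
      have "z ^ fst e = z powr of_real (real (fst e))" using z0 by (simp add: powr_nat')
      moreover have "(z powr of_real r) ^ snd e = z powr of_real (r * real (snd e))"
        using z0 by (simp add: powr_def exp_of_nat_mult[symmetric] algebra_simps)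
      moreover have "z powr of_real (g e - \<mu>) = z powr of_real (real (fst e)) * z powr of_real (r * real (snd e)) * z powr of_real (- \<mu>)"
        unfolding powr_add[symmetric] g_def by (simp add: algebra_simps)
      ultimately show ?thesis unfolding wu power_mult_distrib by (simp add: algebra_simps)
    qed
    have "(\<Sum>e\<in>E. a e * z powr of_real (g e - \<mu>) * u z ^ snd e) = 0"
      unfolding t[symmetric] sum_distrib_right[symmetric] using eq[OF elim(2)] by simp
    moreover have "(\<Sum>e\<in>E. a e * z powr of_real (g e - \<mu>) * u z ^ snd e)
       = (\<Sum>e\<in>{e\<in>E. g e = \<mu>}. a e * z powr of_real (g e - \<mu>) * u z ^ snd e)
       + (\<Sum>e\<in>{e\<in>E. g e \<noteq> \<mu>}. a e * z powr of_real (g e - \<mu>) * u z ^ snd e)"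
      using E by (subst sum.union_disjoint[symmetric]) (auto intro!: sum.cong)
    moreover have "(\<Sum>e\<in>{e\<in>E. g e = \<mu>}. a e * z powr of_real (g e - \<mu>) * u z ^ snd e) = Q (u z)"
      unfolding Q_def using z0 by (intro sum.cong) auto
    ultimately have "Q (u z) = - (\<Sum>e\<in>{e\<in>E. g e \<noteq> \<mu>}. a e * z powr of_real (g e - \<mu>) * u z ^ snd e)"
      by (simp add: eq_neg_iff_add_eq_0)
    then have "norm (Q (u z)) \<le> (\<Sum>e\<in>{e\<in>E. g e \<noteq> \<mu>}. norm (a e * z powr of_real (g e - \<mu>) * u z ^ snd e))"
      by (simp only: norm_minus_cancel norm_sum)
    also have "\<dots> \<le> (\<Sum>e\<in>{e\<in>E. g e \<noteq> \<mu>}. norm (a e) * exp ((g e - \<mu>) * L z) * exp B ^ snd e)"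
      unfolding norm_mult norm_power zp[OF z0] using elim by (intro sum_mono mult_left_mono power_mono) auto
    finally show ?case .
  qed
  have "((\<lambda>z. \<Sum>e\<in>{e\<in>E. g e \<noteq> \<mu>}. norm (a e) * exp ((g e - \<mu>) * L z) * exp B ^ snd e)
      \<longlongrightarrow> (\<Sum>e\<in>{e\<in>E. g e \<noteq> \<mu>}. norm (a e) * 0 * exp B ^ snd e)) ?F"
  proof (intro tendsto_intros)
    fix e assume "e \<in> {e\<in>E. g e \<noteq> \<mu>}"
    then have "g e - \<mu> > 0" using g\<mu>[of e] by auto
    then show "((\<lambda>z. exp ((g e - \<mu>) * L z)) \<longlongrightarrow> 0) ?F"
      by (intro filterlim_compose[OF exp_at_bot] filterlim_tendsto_pos_mult_at_bot[OF tendsto_const] Lbot)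
  qed
  then have "((\<lambda>z. \<Sum>e\<in>{e\<in>E. g e \<noteq> \<mu>}. norm (a e) * exp ((g e - \<mu>) * L z) * exp B ^ snd e) \<longlongrightarrow> 0) ?F"
    by (simp only: mult_zero_right mult_zero_left sum.neutral_const)
  then have Q0: "((\<lambda>z. norm (Q (u z))) \<longlongrightarrow> 0) ?F"
    by (rule tendsto_sandwich[OF always_eventually Q_le tendsto_const, rotated]) simp
  have contu: "continuous_on ({z. Im z > 0} \<inter> ball 0 1) u"
    unfolding u_def
    by (intro continuous_intros continuous_on_subset[OF cont]) (auto simp: complex_nonpos_Reals_iff)
  have "\<exists>p\<in>Z. (u \<longlongrightarrow> p) ?F"
  proof (rule tendsto_finite_set_connected[OF finZ contu])
    fix \<epsilon> :: real assume \<epsilon>: "\<epsilon> > 0"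
    \<comment> \<open>On the compact annulus without neighbourhoods of the roots \<open>Q\<close> is
      bounded below, whereas \<open>Q (u z)\<close> tends to 0; so \<open>u z\<close> must approach
      a root.\<close>
    define D where "D = {y. exp (- B) \<le> norm y \<and> norm y \<le> exp B} - (\<Union>p\<in>Z. ball p \<epsilon>)"
    have "bounded D" unfolding D_def bounded_iff by (auto intro!: exI[of _ "exp B"])
    moreover have "closed D" unfolding D_def
      by (intro closed_Diff closed_Collect_conj closed_Collect_le continuous_intros) auto
    ultimately have "compact D" by (simp add: compact_eq_bounded_closed)
    have "\<exists>c>0. \<forall>y\<in>D. c \<le> norm (Q y)"
    proof (cases "D = {}")
      case False
      have "continuous_on D (\<lambda>y. norm (Q y))" unfolding Q_def by (intro continuous_intros)
      then obtain y where y: "y \<in> D" "\<And>x. x \<in> D \<Longrightarrow> norm (Q y) \<le> norm (Q x)"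
        using continuous_attains_inf[OF \<open>compact D\<close> False] by blast
      have "Q y \<noteq> 0" using y(1) \<epsilon> by (auto simp: D_def Z_def)
      then show ?thesis using y by (intro exI[of _ "norm (Q y)"]) auto
    qed (auto intro: exI[of _ 1])
    then obtain c where c: "c > 0" "\<And>y. y \<in> D \<Longrightarrow> c \<le> norm (Q y)" by blast
    have "\<forall>\<^sub>F z in ?F. norm (Q (u z)) < c" using order_tendstoD(2)[OF Q0 c(1)] .
    with ub show "\<forall>\<^sub>F z in ?F. \<exists>p\<in>Z. dist (u z) p < \<epsilon>"
    proof eventually_elim
      case (elim z)
      then have "u z \<notin> D" using c(2)[of "u z"] by linarith
      then show ?case using elim by (auto simp: D_def dist_commute)
    qed
  qed
  then obtain p where p: "p \<in> Z" "(u \<longlongrightarrow> p) ?F" by blast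
  have "0 < exp (- B)" by simp
  also have "exp (- B) \<le> norm p" using p(1) by (simp add: Z_def)
  finally have "p \<noteq> 0" by auto
  then show ?thesis using p(2) unfolding u_def by blast
qed

section \<open>The exponents\<close>

text \<open>If \<open>i\<close> has the smallest gap, then so has the nearest successor of \<open>i\<close>, and the nearest
  predecessor. Hence a chain with constant gap \<open>\<gamma>\<close> joins the boundary values \<open>1\<close> and \<open>-1\<close>; along
  a longest chain all gaps are at least \<open>\<gamma>\<close>, so both chains have the same length.\<close>

lemma min_exponent:
  fixes f :: "nat \<Rightarrow> real" and N :: nat
  assumes N: "N \<ge> 1"
    and E: "\<And>i j. E i j \<Longrightarrow> i \<in> {1..N} \<and> j \<in> {1..N} \<and> i < j"
    and mono: "\<And>i j. E i j \<Longrightarrow> f j \<le> f i"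
    and bounds: "\<And>i. i \<in> {1..N} \<Longrightarrow> - 1 \<le> f i \<and> f i \<le> 1"
    and balance1: "\<And>i x. i \<in> {1..N} \<Longrightarrow> x \<in> insert (- 1) (f ` {j. E i j}) \<Longrightarrow>
      \<exists>y\<in>insert 1 (f ` {j. E j i}). y - f i \<le> f i - x"
    and balance2: "\<And>i y. i \<in> {1..N} \<Longrightarrow> y \<in> insert 1 (f ` {j. E j i}) \<Longrightarrow>
      \<exists>x\<in>insert (- 1) (f ` {j. E i j}). f i - x \<le> y - f i"
  defines "lmax \<equiv> Max {n. \<exists>s. (\<forall>a\<le>n. s a \<in> {1..N}) \<and> (\<forall>a<n. E (s a) (s (Suc a)))}"
  shows "Min (f ` {1..N}) = - (real lmax / (real lmax + 2))"
proof -
  define lo where "lo = (\<lambda>i. Max (insert (- 1) (f ` {j. E i j})))"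
  define hi where "hi = (\<lambda>i. Min (insert 1 (f ` {j. E j i})))"
  define g where "g = (\<lambda>i. f i - lo i)"
  have fin: "finite (insert (- 1) (f ` {j. E i j}))" "finite (insert 1 (f ` {j. E j i}))" for i
    using E by (auto intro!: finite_imageI finite_subset[of _ "{1..N}"])
  have lo_in: "lo i \<in> insert (- 1) (f ` {j. E i j})" for i
    unfolding lo_def using fin(1) by (rule Max_in) simp
  have lo_ge: "x \<le> lo i" if "x \<in> insert (- 1) (f ` {j. E i j})" for i x
    unfolding lo_def using fin(1) that by (rule Max_ge)
  have hi_in: "hi i \<in> insert 1 (f ` {j. E j i})" for i
    unfolding hi_def using fin(2) by (rule Min_in) simp
  have hi_le: "hi i \<le> x" if "x \<in> insert 1 (f ` {j. E j i})" for i x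
    unfolding hi_def using fin(2) that by (rule Min_le)
  \<comment> \<open>Taken at the extremal values \<open>lo i\<close> and \<open>hi i\<close>, the
    two balance hypotheses say that \<open>f i\<close> is the midpoint between them.\<close>
  have gap: "hi i - f i = g i" if i: "i \<in> {1..N}" for i
  proof (rule antisym)
    obtain y where "y \<in> insert 1 (f ` {j. E j i})" "y - f i \<le> f i - lo i" using balance1[OF i lo_in] by blast
    then show "hi i - f i \<le> g i" using hi_le[of y i] unfolding g_def by linarith
    obtain x where "x \<in> insert (- 1) (f ` {j. E i j})" "f i - x \<le> hi i - f i" using balance2[OF i hi_in] by blast
    then show "g i \<le> hi i - f i" using lo_ge[of x i] unfolding g_def by linarith
  qed
  define \<gamma> where "\<gamma> = Min (g ` {1..N})"
  have g_ge: "\<gamma> \<le> g i" if "i \<in> {1..N}" for i unfolding \<gamma>_def using that by (intro Min_le) auto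
  have "\<gamma> \<in> g ` {1..N}" unfolding \<gamma>_def using N by (intro Min_in) auto
  then obtain i0 where i0: "i0 \<in> {1..N}" "g i0 = \<gamma>" by auto
  \<comment> \<open>An edge is at least as long as the gap at either end. If its length is the
    minimal gap \<gamma>, then both ends have gap \<gamma>, and the chain can be continued.\<close>
  have edge_gap: "g i \<le> f i - f j" "g j \<le> f i - f j" if "E i j" for i j
    using lo_ge[of "f j" i] hi_le[of "f i" j] gap[of j] E[OF that] that by (auto simp: g_def)
  have top: "\<exists>i\<in>{1..N}. g i = \<gamma> \<and> f i = 1 - \<gamma>" if "i \<in> {1..N}" "g i = \<gamma>" for i
    using that
  proof (induction i rule: less_induct)
    case (less i)
    show ?case
    proof (cases "hi i = 1")
      case True
      then have "f i = 1 - \<gamma>" using gap less.prems by force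
      then show ?thesis using less.prems by blast
    next
      case False
      then obtain j where j: "E j i" "hi i = f j" using hi_in[of i] by auto
      have "f j - f i = \<gamma>" using gap[OF less.prems(1)] less.prems(2) j(2) by simp
      then have "g j = \<gamma>" using edge_gap(1)[OF j(1)] g_ge[of j] E[OF j(1)] by auto
      then show ?thesis using less.IH[of j] E[OF j(1)] by auto
    qed
  qed
  have down: "\<exists>m s. s 0 = i \<and> (\<forall>a\<le>m. s a \<in> {1..N}) \<and> (\<forall>a<m. E (s a) (s (Suc a))) \<and> f (s m) = f i - real m * \<gamma> \<and> f (s m) = - 1 + \<gamma>"
    if "i \<in> {1..N}" "g i = \<gamma>" for i
    using that
  proof (induction "N - i" arbitrary: i rule: less_induct)
    case less
    show ?case
    proof (cases "lo i = - 1")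
      case True
      then have "f i = - 1 + \<gamma>" using less.prems by (simp add: g_def)
      then show ?thesis using less.prems by (intro exI[of _ 0] exI[of _ "\<lambda>_. i"]) auto
    next
      case False
      then obtain j where j: "E i j" "lo i = f j" using lo_in[of i] by auto
      have fj: "f i - f j = \<gamma>" using less.prems(2) j(2) by (simp add: g_def)
      then have "g j = \<gamma>" using edge_gap(2)[OF j(1)] g_ge[of j] E[OF j(1)] by auto
      moreover have "N - j < N - i" using E[OF j(1)] by auto
      ultimately obtain m s where s: "s 0 = j" "\<forall>a\<le>m. s a \<in> {1..N}" "\<forall>a<m. E (s a) (s (Suc a))"
        "f (s m) = f j - real m * \<gamma>" "f (s m) = - 1 + \<gamma>"
        using less.hyps[of j] E[OF j(1)] by blast
      define t where "t = (\<lambda>a. case a of 0 \<Rightarrow> i | Suc a \<Rightarrow> s a)"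
      have "t 0 = i" "\<forall>a\<le>Suc m. t a \<in> {1..N}"
        using s(2) less.prems by (auto simp: t_def split: nat.splits)
      moreover have "\<forall>a<Suc m. E (t a) (t (Suc a))"
        using s(1,3) j(1) by (auto simp: t_def split: nat.splits)
      moreover have "f (t (Suc m)) = f i - real (Suc m) * \<gamma>" "f (t (Suc m)) = - 1 + \<gamma>"
        using s(4,5) fj by (auto simp: t_def algebra_simps)
      ultimately show ?thesis by blast
    qed
  qed
  obtain i1 where i1: "i1 \<in> {1..N}" "g i1 = \<gamma>" "f i1 = 1 - \<gamma>" using top[OF i0] by blast
  obtain m s where s: "\<forall>a\<le>m. s a \<in> {1..N}" "\<forall>a<m. E (s a) (s (Suc a))"
    "f (s m) = f i1 - real m * \<gamma>" "f (s m) = - 1 + \<gamma>"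
    using down[OF i1(1,2)] by blast
  \<comment> \<open>\<open>m\<close> edges and the two boundary gaps, all of length \<gamma>, fill
    the interval from -1 to 1.\<close>
  have "(real m + 2) * \<gamma> = 2" using s(3,4) i1(3) by (simp add: algebra_simps)
  then have \<gamma>: "\<gamma> = 2 / (real m + 2)" by (simp add: field_simps)
  then have \<gamma>0: "\<gamma> > 0" by simp
  \<comment> \<open>Any chain loses at least \<gamma> at each edge and stays \<gamma> away from both
    1 and -1, so it has at most \<open>m\<close> edges.\<close>
  have len: "n \<le> m" if t: "\<forall>a\<le>n. t a \<in> {1..N}" "\<forall>a<n. E (t a) (t (Suc a))" for n t
  proof -
    have "f (t a) \<le> 1 - \<gamma> - real a * \<gamma>" if "a \<le> n" for a
      using that
    proof (induction a)
      case 0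
      have "\<gamma> \<le> hi (t 0) - f (t 0)" using gap g_ge t(1) by simp
      moreover have "hi (t 0) \<le> 1" using hi_le by blast
      ultimately show ?case by simp
    next
      case (Suc a)
      have "\<gamma> \<le> f (t a) - f (t (Suc a))"
        using edge_gap(1) g_ge t Suc.prems by (meson Suc_le_lessD less_imp_le order_trans)
      then show ?case using Suc by (simp add: algebra_simps)
    qed
    then have "f (t n) \<le> 1 - \<gamma> - real n * \<gamma>" by blast
    moreover have "- 1 + \<gamma> \<le> f (t n)"
      using g_ge[of "t n"] lo_ge[of "- 1" "t n"] t(1) unfolding g_def by force
    ultimately have "(real n + 2) * \<gamma> \<le> 2" by (simp add: algebra_simps)
    then have "(real n + 2) * \<gamma> \<le> (real m + 2) * \<gamma>" using \<open>(real m + 2) * \<gamma> = 2\<close> by simp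
    then show ?thesis using \<gamma>0 by simp
  qed
  have "lmax = m" unfolding lmax_def
  proof (rule Max_eqI)
    show "finite {n. \<exists>s. (\<forall>a\<le>n. s a \<in> {1..N}) \<and> (\<forall>a<n. E (s a) (s (Suc a)))}"
      by (rule finite_subset[of _ "{..m}"]) (use len in auto)
  qed (use len s in auto)
  have "Min (f ` {1..N}) = - 1 + \<gamma>"
  proof (rule Min_eqI)
    fix y assume "y \<in> f ` {1..N}"
    then obtain i where "i \<in> {1..N}" "y = f i" by auto
    then show "- 1 + \<gamma> \<le> y" using g_ge[of i] lo_ge[of "- 1" i] unfolding g_def by force
  qed (use s in \<open>auto intro!: image_eqI[of _ f "s m"]\<close>)
  also have "\<dots> = - (real lmax / (real lmax + 2))" unfolding \<gamma> \<open>lmax = m\<close> by (simp add: field_simps)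
  finally show ?thesis .
qed

section \<open>Potentials on fully indecomposable matrices\<close>

lemma sorted_enumeration:
  fixes r :: "'a \<Rightarrow> 'b::linorder"
  assumes "finite A"
  obtains \<alpha> where "bij_betw \<alpha> {..<card A} A" "\<And>i j. i \<le> j \<Longrightarrow> j < card A \<Longrightarrow> r (\<alpha> i) \<le> r (\<alpha> j)"
proof -
  obtain xs where xs: "set xs = A" "distinct xs" using finite_distinct_list[OF assms] by blast
  define ys where "ys = sort_key r xs"
  have ys: "set ys = A" "distinct ys" "length ys = card A" "sorted (map r ys)"
    using xs distinct_card[of xs] by (auto simp: ys_def)
  show thesis
  proof (rule that[of "\<lambda>i. ys ! i"])
    show "bij_betw ((!) ys) {..<card A} A" using bij_betw_nth[OF ys(2)] ys by simp
    show "r (ys ! i) \<le> r (ys ! j)" if "i \<le> j" "j < card A" for i j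
      using sorted_nth_mono[OF ys(4), of i j] that ys(3) by simp
  qed
qed

text \<open>Order the values as \<open>r\<^sub>1 \<le> \<dots> \<le> r\<^sub>k\<close> and \<open>q\<^sub>1 \<le> \<dots> \<le> q\<^sub>k\<close>. Full indecomposability, applied to
  the \<open>j\<close> smallest rows and the \<open>k - j\<close> largest columns, gives \<open>q\<^sub>j\<^sub>+\<^sub>1 \<le> r\<^sub>j\<close>.\<close>

lemma fully_indecomposable_potential:
  fixes r :: "'a \<Rightarrow> real" and q :: "'b \<Rightarrow> real"
  assumes fin: "finite A" "finite B" and card: "card A = card B" "card A \<ge> 1"
    and FID: "\<And>I J. I \<subseteq> A \<Longrightarrow> J \<subseteq> B \<Longrightarrow> I \<noteq> {} \<Longrightarrow> J \<noteq> {} \<Longrightarrow> card A \<le> card I + card J \<Longrightarrow> \<exists>i\<in>I. \<exists>j\<in>J. P i j"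
    and le: "\<And>a b. a \<in> A \<Longrightarrow> b \<in> B \<Longrightarrow> P a b \<Longrightarrow> q b \<le> r a"
  shows "sum q B \<le> sum r A"
    and "sum r A \<le> sum q B \<Longrightarrow> \<exists>f. (\<forall>a\<in>A. r a = f) \<and> (\<forall>b\<in>B. q b = f)"
proof -
  define k where "k = card A"
  obtain \<alpha> where \<alpha>: "bij_betw \<alpha> {..<k} A" "\<And>i j. i \<le> j \<Longrightarrow> j < k \<Longrightarrow> r (\<alpha> i) \<le> r (\<alpha> j)"
    using sorted_enumeration[OF fin(1), of r] unfolding k_def by blast
  obtain \<beta> where \<beta>: "bij_betw \<beta> {..<k} B" "\<And>i j. i \<le> j \<Longrightarrow> j < k \<Longrightarrow> q (\<beta> i) \<le> q (\<beta> j)"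
    using sorted_enumeration[OF fin(2), of q] unfolding k_def card(1) by blast
  \<comment> \<open>The case \<open>j' = j\<close> gives the inequality of the sums, the borderline
    case \<open>j' = Suc j\<close> the rigidity; the latter is where the two sets of indices have
    total size exactly \<open>k\<close>.\<close>
  have key: "q (\<beta> j') \<le> r (\<alpha> j)" if j: "j < k" "j' < k" "j' \<le> Suc j" for j j'
  proof -
    have sub: "{..j} \<subseteq> {..<k}" "{j'..<k} \<subseteq> {..<k}" using j by auto
    have "card (\<alpha> ` {..j}) = Suc j"
      using card_image[OF inj_on_subset[OF bij_betw_imp_inj_on[OF \<alpha>(1)] sub(1)]] by simp
    moreover have "card (\<beta> ` {j'..<k}) = k - j'"
      using card_image[OF inj_on_subset[OF bij_betw_imp_inj_on[OF \<beta>(1)] sub(2)]] by simp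
    ultimately have c: "card A \<le> card (\<alpha> ` {..j}) + card (\<beta> ` {j'..<k})"
      using j by (simp add: k_def[symmetric])
    have s1: "\<alpha> ` {..j} \<subseteq> A"
      using image_mono[OF sub(1), of \<alpha>] unfolding bij_betw_imp_surj_on[OF \<alpha>(1)] .
    have s2: "\<beta> ` {j'..<k} \<subseteq> B"
      using image_mono[OF sub(2), of \<beta>] unfolding bij_betw_imp_surj_on[OF \<beta>(1)] .
    have "\<exists>a\<in>\<alpha> ` {..j}. \<exists>b\<in>\<beta> ` {j'..<k}. P a b"
      by (rule FID[OF s1 s2 _ _ c]) (use j in simp_all)
    then obtain i i' where i: "i \<in> {..j}" "i' \<in> {j'..<k}" "P (\<alpha> i) (\<beta> i')" by blast
    then have i: "i \<le> j" "j' \<le> i'" "i' < k" "P (\<alpha> i) (\<beta> i')" by simp_all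
    have "q (\<beta> j') \<le> q (\<beta> i')" by (rule \<beta>(2)[OF i(2,3)])
    moreover have "i < k" using i(1) j(1) by linarith
    then have "\<alpha> i \<in> A" "\<beta> i' \<in> B"
      using bij_betw_apply[OF \<alpha>(1)] bij_betw_apply[OF \<beta>(1)] i(3) by blast+
    then have "q (\<beta> i') \<le> r (\<alpha> i)" using i(4) by (rule le)
    moreover have "r (\<alpha> i) \<le> r (\<alpha> j)" by (rule \<alpha>(2)[OF i(1) j(1)])
    ultimately show ?thesis by linarith
  qed
  have sums: "sum r A = (\<Sum>j<k. r (\<alpha> j))" "sum q B = (\<Sum>j<k. q (\<beta> j))"
    using sum.reindex_bij_betw[OF \<alpha>(1), of r] sum.reindex_bij_betw[OF \<beta>(1), of q] by simp_all
  show "sum q B \<le> sum r A" unfolding sums by (intro sum_mono key) auto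
  assume "sum r A \<le> sum q B"
  \<comment> \<open>Equal sums force equality term by term; together with \<open>key\<close> at
    \<open>Suc j\<close> the increasing sequence of \<open>q\<close>-values cannot grow.\<close>
  then have eq: "r (\<alpha> j) = q (\<beta> j)" if "j < k" for j
    using sum_mono_inv[of "\<lambda>j. q (\<beta> j)" "{..<k}" "\<lambda>j. r (\<alpha> j)" j] key that
      \<open>sum q B \<le> sum r A\<close> unfolding sums by auto
  have const: "q (\<beta> j) = q (\<beta> 0)" if "j < k" for j
    using that
  proof (induction j)
    case (Suc j)
    have "q (\<beta> (Suc j)) \<le> q (\<beta> j)" using key[of j "Suc j"] eq[of j] Suc.prems by linarith
    moreover have "q (\<beta> j) \<le> q (\<beta> (Suc j))" by (rule \<beta>(2)) (use Suc.prems in simp_all)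
    moreover have "q (\<beta> j) = q (\<beta> 0)" by (rule Suc.IH) (use Suc.prems in simp)
    ultimately show ?case by linarith
  qed simp
  have "r (\<alpha> j) = q (\<beta> 0)" if "j < k" for j
    using eq[OF that] const[OF that] by (rule trans)
  then have "\<forall>a\<in>\<alpha> ` {..<k}. r a = q (\<beta> 0)" "\<forall>b\<in>\<beta> ` {..<k}. q b = q (\<beta> 0)"
    using const by blast+
  then have "\<forall>a\<in>A. r a = q (\<beta> 0)" "\<forall>b\<in>B. q b = q (\<beta> 0)"
    unfolding bij_betw_imp_surj_on[OF \<alpha>(1)] bij_betw_imp_surj_on[OF \<beta>(1)] .
  then show "\<exists>f. (\<forall>a\<in>A. r a = f) \<and> (\<forall>b\<in>B. q b = f)" by blast
qed

section \<open>Comparison of powers at the origin\<close>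

lemma powr_tendsto_0_at_right: "a > 0 \<Longrightarrow> ((\<lambda>\<eta>::real. \<eta> powr a) \<longlongrightarrow> 0) (at_right 0)"
  by (rule tendsto_zero_powrI[OF tendsto_ident_at tendsto_const])
     (auto intro: eventually_mono[OF eventually_at_right_less])

lemma exponent_nonneg_of_bounded:
  fixes b :: "real \<Rightarrow> real"
  assumes "((\<lambda>\<eta>. b \<eta> * \<eta> powr (- e)) \<longlongrightarrow> C) (at_right 0)" "C > 0" "\<And>\<eta>. \<eta> > 0 \<Longrightarrow> b \<eta> \<le> B"
  shows "e \<ge> 0"
proof (rule ccontr)
  assume "\<not> e \<ge> 0"
  then have "((\<lambda>\<eta>. B * \<eta> powr (- e)) \<longlongrightarrow> B * 0) (at_right 0)"
    by (intro tendsto_intros powr_tendsto_0_at_right) auto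
  moreover have "\<forall>\<^sub>F \<eta> in at_right 0. b \<eta> * \<eta> powr (- e) \<le> B * \<eta> powr (- e)"
    by (rule eventually_mono[OF eventually_at_right_less]) (use assms(3) in \<open>auto intro: mult_right_mono\<close>)
  ultimately have "C \<le> B * 0" using assms(1) by (intro tendsto_le[of "at_right (0::real)"]) auto
  then show False using assms(2) by simp
qed

lemma exponent_nonpos_of_bounded_below:
  fixes b :: "real \<Rightarrow> real"
  assumes "((\<lambda>\<eta>. b \<eta> * \<eta> powr (- e)) \<longlongrightarrow> C) (at_right 0)" "c > 0" "\<forall>\<^sub>F \<eta> in at_right 0. c \<le> b \<eta>"
  shows "e \<le> 0"
proof (rule ccontr)
  assume "\<not> e \<le> 0"
  then have "((\<lambda>\<eta>. b \<eta> * \<eta> powr (- e) * \<eta> powr e) \<longlongrightarrow> C * 0) (at_right 0)"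
    by (intro tendsto_intros assms powr_tendsto_0_at_right) auto
  moreover have "\<forall>\<^sub>F \<eta> in at_right 0. c \<le> b \<eta> * \<eta> powr (- e) * \<eta> powr e"
    using assms(3) eventually_at_right_less[of "0::real"]
    by eventually_elim (simp add: mult.assoc powr_add[symmetric])
  ultimately have "c \<le> C * 0" by (intro tendsto_lowerbound[of _ _ "at_right (0::real)"]) auto
  then show False using assms(2) by simp
qed

text \<open>The terms on the left do not cancel, so the sum on the right is at least as large as
  \<open>b t\<close>, and some term on the right must decay no faster.\<close>

lemma dominating_term:
  fixes b :: "'s \<Rightarrow> real \<Rightarrow> real" and b' :: "'t \<Rightarrow> real \<Rightarrow> real"
  assumes fin: "finite T" "finite T'" and t: "t \<in> T"
    and eq: "\<And>\<eta>. \<eta> > 0 \<Longrightarrow> (\<Sum>t\<in>T. b t \<eta>) = (\<Sum>t\<in>T'. b' t \<eta>)"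
    and pos: "\<And>t \<eta>. t \<in> T \<Longrightarrow> \<eta> > 0 \<Longrightarrow> b t \<eta> \<ge> 0"
    and lim: "((\<lambda>\<eta>. b t \<eta> * \<eta> powr (- e t)) \<longlongrightarrow> C) (at_right 0)" "C > 0"
    and lim': "\<And>t. t \<in> T' \<Longrightarrow> ((\<lambda>\<eta>. b' t \<eta> * \<eta> powr (- e' t)) \<longlongrightarrow> C' t) (at_right 0)"
  shows "\<exists>t'\<in>T'. e' t' \<le> e t"
proof (rule ccontr)
  assume "\<not> ?thesis"
  then have "((\<lambda>\<eta>. \<Sum>t'\<in>T'. b' t' \<eta> * \<eta> powr (- e' t') * \<eta> powr (e' t' - e t)) \<longlongrightarrow> (\<Sum>t'\<in>T'. C' t' * 0)) (at_right 0)"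
    by (intro tendsto_intros lim' powr_tendsto_0_at_right) auto
  moreover have "\<forall>\<^sub>F \<eta> in at_right 0. b t \<eta> * \<eta> powr (- e t) \<le> (\<Sum>t'\<in>T'. b' t' \<eta> * \<eta> powr (- e' t') * \<eta> powr (e' t' - e t))"
  proof (rule eventually_mono[OF eventually_at_right_less])
    fix \<eta> :: real assume \<eta>: "0 < \<eta>"
    have "b t \<eta> \<le> (\<Sum>t\<in>T. b t \<eta>)" using fin t pos[OF _ \<eta>] by (intro member_le_sum) auto
    then have "b t \<eta> * \<eta> powr (- e t) \<le> (\<Sum>t'\<in>T'. b' t' \<eta>) * \<eta> powr (- e t)"
      unfolding eq[OF \<eta>] by (rule mult_right_mono) simp
    also have "\<dots> = (\<Sum>t'\<in>T'. b' t' \<eta> * \<eta> powr (- e' t') * \<eta> powr (e' t' - e t))"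
      by (simp add: sum_distrib_right mult.assoc powr_add[symmetric])
    finally show "b t \<eta> * \<eta> powr (- e t) \<le> \<dots>" .
  qed
  ultimately have "C \<le> (\<Sum>t'\<in>T'. C' t' * 0)"
    using lim(1) by (intro tendsto_le[of "at_right (0::real)"]) auto
  then show False using lim(2) by simp
qed

text \<open>Up to sign, \<open>\<Sum>\<^sub>l ln (v l)\<close> is bounded by the value at \<open>v = 1\<close> of the functional
  \<open>v \<mapsto> v \<cdot> S v / 2 + \<eta> \<Sum>\<^sub>l v l - \<Sum>\<^sub>l ln (v l)\<close>, which is convex in \<open>ln v\<close> and critical at the solution.\<close>

lemma sum_ln_solution_ge:
  fixes S :: "'i \<Rightarrow> 'i \<Rightarrow> real" and v :: "'i \<Rightarrow> real"
  assumes fin: "finite I" and sym: "\<And>l k. l \<in> I \<Longrightarrow> k \<in> I \<Longrightarrow> S l k = S k l"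
    and S: "\<And>l k. l \<in> I \<Longrightarrow> k \<in> I \<Longrightarrow> 0 \<le> S l k" and \<eta>: "\<eta> \<ge> 0"
    and v: "\<And>l. l \<in> I \<Longrightarrow> v l > 0 \<and> v l * (\<eta> + (\<Sum>k\<in>I. S l k * v k)) = 1"
  shows "(\<Sum>l\<in>I. ln (v l)) \<ge> - ((\<Sum>l\<in>I. \<Sum>k\<in>I. S l k) / 2 + \<eta> * card I)"
proof -
  \<comment> \<open>The inequality \<open>1 + s \<le> exp s\<close> at \<open>s = - ln x\<close>:
    the graph of the exponential lies above its tangent.\<close>
  have exp_ge: "x * (1 - ln x) \<le> 1" if "x > 0" for x :: real
  proof -
    have "1 - ln x \<le> exp (- ln x)" using exp_ge_add_one_self[of "- ln x"] by simp
    then show ?thesis using that by (simp add: exp_minus field_simps)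
  qed
  have 1: "S l k * (v l * v k * (1 - ln (v l) - ln (v k))) \<le> S l k" if "l \<in> I" "k \<in> I" for l k
    using exp_ge[of "v l * v k"] v[OF that(1)] v[OF that(2)] S[OF that]
      mult_left_mono[of "v l * v k * (1 - ln (v l) - ln (v k))" 1 "S l k"] by (simp add: ln_mult algebra_simps)
  have 2: "\<eta> * (v l * (1 - ln (v l))) \<le> \<eta>" if "l \<in> I" for l
    using exp_ge[of "v l"] v[OF that] \<eta> mult_left_mono[of "v l * (1 - ln (v l))" 1 \<eta>] by simp
  define Q where "Q = (\<Sum>l\<in>I. \<Sum>k\<in>I. S l k * v l * v k)"
  define Ql where "Ql = (\<Sum>l\<in>I. \<Sum>k\<in>I. S l k * v l * v k * ln (v l))"
  have Qk: "(\<Sum>l\<in>I. \<Sum>k\<in>I. S l k * v l * v k * ln (v k)) = Ql"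
    unfolding Ql_def by (subst sum.swap) (auto intro!: sum.cong simp: sym mult_ac)
  have Q0: "Q \<ge> 0" unfolding Q_def using S v by (intro sum_nonneg mult_nonneg_nonneg) (auto intro: less_imp_le)
  have V0: "(\<Sum>l\<in>I. \<eta> * v l) \<ge> 0" using \<eta> v by (intro sum_nonneg mult_nonneg_nonneg) (auto intro: less_imp_le)
  have "Q - 2 * Ql = (\<Sum>l\<in>I. \<Sum>k\<in>I. S l k * (v l * v k * (1 - ln (v l) - ln (v k))))"
  proof -
    have "Q - Ql - (\<Sum>l\<in>I. \<Sum>k\<in>I. S l k * v l * v k * ln (v k)) = (\<Sum>l\<in>I. \<Sum>k\<in>I. S l k * (v l * v k * (1 - ln (v l) - ln (v k))))"
      unfolding Q_def Ql_def by (simp add: sum_subtractf[symmetric] algebra_simps)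
    then show ?thesis unfolding Qk by simp
  qed
  also have "\<dots> \<le> (\<Sum>l\<in>I. \<Sum>k\<in>I. S l k)" by (intro sum_mono 1)
  finally have A: "Q - 2 * Ql \<le> (\<Sum>l\<in>I. \<Sum>k\<in>I. S l k)" .
  have "(\<Sum>l\<in>I. \<eta> * v l) - (\<Sum>l\<in>I. \<eta> * v l * ln (v l)) = (\<Sum>l\<in>I. \<eta> * (v l * (1 - ln (v l))))"
    by (simp add: sum_subtractf[symmetric] algebra_simps)
  also have "\<dots> \<le> (\<Sum>l\<in>I. \<eta>)" by (intro sum_mono 2)
  finally have B: "(\<Sum>l\<in>I. \<eta> * v l) - (\<Sum>l\<in>I. \<eta> * v l * ln (v l)) \<le> \<eta> * card I" by (simp add: mult.commute)
  \<comment> \<open>Criticality enters here: each logarithm is multiplied by the left-hand side of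
    its equation, which equals 1.\<close>
  have "(\<Sum>l\<in>I. ln (v l)) = (\<Sum>l\<in>I. v l * (\<eta> + (\<Sum>k\<in>I. S l k * v k)) * ln (v l))"
    using v by (intro sum.cong) auto
  also have "\<dots> = (\<Sum>l\<in>I. \<eta> * v l * ln (v l)) + Ql"
    unfolding Ql_def sum.distrib[symmetric] by (intro sum.cong) (simp_all add: algebra_simps sum_distrib_left sum_distrib_right)
  finally have "(\<Sum>l\<in>I. ln (v l)) = (\<Sum>l\<in>I. \<eta> * v l * ln (v l)) + Ql" .
  then show ?thesis using A B Q0 V0 by (simp add: field_simps)
qed

section \<open>Block structures and the balance of exponents\<close>

lemma compl_index_in: "i \<in> {1..L + 2 * M} \<Longrightarrow> compl_index L M i \<in> {1..L + 2 * M}"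
  by (auto simp: compl_index_def)

lemma compl_index_invol: "i \<in> {1..L + 2 * M} \<Longrightarrow> compl_index L M (compl_index L M i) = i"
  by (auto simp: compl_index_def)

text \<open>A normal form with its blocks kept as sets of original indices, so that the exponents
  can be treated without the permutation. The zero pattern enters through \<open>triangular\<close>:
  the relation between block indices strictly increases them.\<close>

locale block_structure =
  fixes n :: nat and S :: "nat \<Rightarrow> nat \<Rightarrow> real" and L M :: nat and C :: "nat \<Rightarrow> nat set"
  assumes nonneg: "\<And>a b. a \<in> {1..n} \<Longrightarrow> b \<in> {1..n} \<Longrightarrow> 0 \<le> S a b"
    and sym: "\<And>a b. a \<in> {1..n} \<Longrightarrow> b \<in> {1..n} \<Longrightarrow> S a b = S b a"
    and LM: "L + 2 * M \<ge> 1"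
    and disjoint: "\<And>i j. i \<in> {1..L + 2 * M} \<Longrightarrow> j \<in> {1..L + 2 * M} \<Longrightarrow> i \<noteq> j \<Longrightarrow> C i \<inter> C j = {}"
    and cover: "(\<Union>i\<in>{1..L + 2 * M}. C i) = {1..n}"
    and nonempty: "\<And>i. i \<in> {1..L + 2 * M} \<Longrightarrow> C i \<noteq> {}"
    and card_compl: "\<And>i. i \<in> {1..L + 2 * M} \<Longrightarrow> card (C (compl_index L M i)) = card (C i)"
    and FID: "\<And>i I J. i \<in> {1..L + 2 * M} \<Longrightarrow> I \<subseteq> C i \<Longrightarrow> J \<subseteq> C (compl_index L M i) \<Longrightarrow> I \<noteq> {} \<Longrightarrow> J \<noteq> {} \<Longrightarrow>
      card (C i) \<le> card I + card J \<Longrightarrow> \<exists>a\<in>I. \<exists>b\<in>J. S a b \<noteq> 0"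
    and triangular: "\<And>i j. i \<in> {1..L + 2 * M} \<Longrightarrow> j \<in> {1..L + 2 * M} \<Longrightarrow> i \<noteq> j \<Longrightarrow>
      (\<exists>a\<in>C i. \<exists>b\<in>C (compl_index L M j). S a b \<noteq> 0) \<Longrightarrow> i < j"
begin

abbreviation "N \<equiv> L + 2 * M"
abbreviation "hat \<equiv> compl_index L M"

definition edge :: "nat \<Rightarrow> nat \<Rightarrow> bool" where
  "edge i j \<longleftrightarrow> i \<in> {1..N} \<and> j \<in> {1..N} \<and> i \<noteq> j \<and> (\<exists>a\<in>C i. \<exists>b\<in>C (hat j). S a b \<noteq> 0)"

lemma C_sub: "i \<in> {1..N} \<Longrightarrow> C i \<subseteq> {1..n}"
  using cover by blast

lemma finC: "i \<in> {1..N} \<Longrightarrow> finite (C i)"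
  using C_sub finite_subset by blast

lemma sum_blocks: "(\<Sum>i\<in>{1..N}. sum g (C i)) = (sum g {1..n} :: real)"
  unfolding cover[symmetric] by (rule sum.UNION_disjoint[symmetric]) (use finC disjoint in auto)

lemma bij_hat: "bij_betw hat {1..N} {1..N}"
  by (rule bij_betw_byWitness[where f' = hat]) (use compl_index_in compl_index_invol in auto)

lemma exponents:
  fixes v :: "nat \<Rightarrow> real \<Rightarrow> real" and r c :: "nat \<Rightarrow> real"
  assumes v: "\<And>l \<eta>. l \<in> {1..n} \<Longrightarrow> \<eta> > 0 \<Longrightarrow> v l \<eta> > 0 \<and> v l \<eta> * (\<eta> + (\<Sum>k\<in>{1..n}. S l k * v k \<eta>)) = 1"
    and asym: "\<And>l. l \<in> {1..n} \<Longrightarrow> c l > 0 \<and> ((\<lambda>\<eta>. v l \<eta> * \<eta> powr (- r l)) \<longlongrightarrow> c l) (at_right 0)"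
  shows "Min (r ` {1..n}) = - (let d = real (Max {m. \<exists>s. (\<forall>a\<le>m. s a \<in> {1..N}) \<and> (\<forall>a<m. edge (s a) (s (Suc a)))}) in d / (d + 2))"
proof -
  have prod_asym: "((\<lambda>\<eta>. (x \<eta> * y \<eta>) * \<eta> powr (- (p + q))) \<longlongrightarrow> X * Y) (at_right 0)"
    if "((\<lambda>\<eta>. x \<eta> * \<eta> powr (- p)) \<longlongrightarrow> X) (at_right 0)" "((\<lambda>\<eta>. y \<eta> * \<eta> powr (- q)) \<longlongrightarrow> Y) (at_right 0)"
    for x y :: "real \<Rightarrow> real" and p q X Y
  proof -
    have "((\<lambda>\<eta>. (x \<eta> * \<eta> powr (- p)) * (y \<eta> * \<eta> powr (- q))) \<longlongrightarrow> X * Y) (at_right 0)"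
      by (intro tendsto_mult that)
    moreover have "(x \<eta> * \<eta> powr (- p)) * (y \<eta> * \<eta> powr (- q)) = (x \<eta> * y \<eta>) * \<eta> powr (- (p + q))" for \<eta>
    proof -
      have "\<eta> powr (- (p + q)) = \<eta> powr (- p) * \<eta> powr (- q)" by (simp add: powr_add[symmetric])
      then show ?thesis by simp
    qed
    ultimately show ?thesis by simp
  qed
  have \<eta>_asym: "((\<lambda>\<eta>::real. \<eta> * \<eta> powr (- 1)) \<longlongrightarrow> 1) (at_right 0)"
    by (rule tendsto_eventually, rule eventually_mono[OF eventually_at_right_less]) (auto simp: powr_minus)
  have v_le: "S l k * v k \<eta> * v l \<eta> \<le> 1" "\<eta> * v l \<eta> \<le> 1" if "l \<in> {1..n}" "k \<in> {1..n}" "\<eta> > 0" for l k \<eta>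
  proof -
    have nn: "S l j * v j \<eta> \<ge> 0" if "j \<in> {1..n}" for j
      using nonneg v that \<open>l \<in> _\<close> \<open>\<eta> > 0\<close> by (intro mult_nonneg_nonneg) (auto intro: less_imp_le)
    have "S l k * v k \<eta> \<le> (\<Sum>k\<in>{1..n}. S l k * v k \<eta>)" using that nn by (intro member_le_sum) auto
    moreover have "0 \<le> (\<Sum>k\<in>{1..n}. S l k * v k \<eta>)" using nn by (intro sum_nonneg)
    ultimately have le: "S l k * v k \<eta> \<le> \<eta> + (\<Sum>k\<in>{1..n}. S l k * v k \<eta>)"
       "\<eta> \<le> \<eta> + (\<Sum>k\<in>{1..n}. S l k * v k \<eta>)"
      using that(3) by auto
    have vl: "v l \<eta> \<ge> 0" "(\<eta> + (\<Sum>k\<in>{1..n}. S l k * v k \<eta>)) * v l \<eta> = 1"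
      using v[OF that(1,3)] by (simp_all add: mult.commute)
    show "S l k * v k \<eta> * v l \<eta> \<le> 1" "\<eta> * v l \<eta> \<le> 1"
      using mult_right_mono[OF le(1) vl(1)] mult_right_mono[OF le(2) vl(1)] unfolding vl(2) .
  qed
  \<comment> \<open>In the equation for \<open>v l\<close> all summands are nonnegative, so each is
    at most 1: the \<eta>-term gives this bound, the term of a nonzero entry \<open>S l k\<close>
    the next one.\<close>
  have r_ge: "r l \<ge> - 1" if l: "l \<in> {1..n}" for l
    using exponent_nonneg_of_bounded[OF prod_asym[OF \<eta>_asym conjunct2[OF asym[OF l]]], of 1] v_le(2)[OF l l] asym[OF l] by simp
  have r_pair: "r l + r k \<ge> 0" if l: "l \<in> {1..n}" "k \<in> {1..n}" "S l k \<noteq> 0" for l k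
  proof -
    have "S l k > 0" using nonneg[OF l(1,2)] l(3) by simp
    then show ?thesis
      using exponent_nonneg_of_bounded[OF prod_asym[OF conjunct2[OF asym[OF l(1)]] conjunct2[OF asym[OF l(2)]]], of "1 / S l k"]
        v_le(1)[OF l(1,2)] asym l by (simp add: field_simps)
  qed
  have r_sum: "sum r {1..n} \<le> 0"
  proof (rule exponent_nonpos_of_bounded_below)
    have "((\<lambda>\<eta>. \<Prod>l\<in>{1..n}. v l \<eta> * \<eta> powr (- r l)) \<longlongrightarrow> (\<Prod>l\<in>{1..n}. c l)) (at_right 0)"
      using asym by (intro tendsto_prod) auto
    then show "((\<lambda>\<eta>. (\<Prod>l\<in>{1..n}. v l \<eta>) * \<eta> powr (- sum r {1..n})) \<longlongrightarrow> (\<Prod>l\<in>{1..n}. c l)) (at_right 0)"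
    proof (rule Lim_transform_eventually, intro eventually_mono[OF eventually_at_right_less])
      fix \<eta> :: real assume "0 < \<eta>"
      then show "(\<Prod>l\<in>{1..n}. v l \<eta> * \<eta> powr (- r l)) = (\<Prod>l\<in>{1..n}. v l \<eta>) * \<eta> powr (- sum r {1..n})"
        by (simp add: prod.distrib powr_def exp_sum[symmetric] sum_negf[symmetric] sum_distrib_right)
    qed
    define B where "B = (\<Sum>l\<in>{1..n}. \<Sum>k\<in>{1..n}. S l k) / 2 + real n"
    show "exp (- B) > 0" by simp
    show "\<forall>\<^sub>F \<eta> in at_right 0. exp (- B) \<le> (\<Prod>l\<in>{1..n}. v l \<eta>)"
    proof -
      have "exp (- B) \<le> (\<Prod>l\<in>{1..n}. v l \<eta>)" if \<eta>: "0 < \<eta>" "\<eta> < 1" for \<eta>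
      proof -
        have "(\<Sum>l\<in>{1..n}. ln (v l \<eta>)) \<ge> - ((\<Sum>l\<in>{1..n}. \<Sum>k\<in>{1..n}. S l k) / 2 + \<eta> * card {1..n})"
          by (rule sum_ln_solution_ge) (use sym nonneg v \<eta> in auto)
        moreover have "\<eta> * card {1..n} \<le> n" using \<eta> by (simp add: mult_left_le_one_le)
        ultimately have "- B \<le> (\<Sum>l\<in>{1..n}. ln (v l \<eta>))" unfolding B_def by linarith
        then have "exp (- B) \<le> exp (\<Sum>l\<in>{1..n}. ln (v l \<eta>))" by simp
        also have "\<dots> = (\<Prod>l\<in>{1..n}. v l \<eta>)" using v[OF _ \<eta>(1)] by (simp add: exp_sum)
        finally show ?thesis .
      qed
      then show ?thesis unfolding eventually_at_right_field by (intro exI[of _ 1]) auto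
    qed
  qed
  \<comment> \<open>The potentials are \<open>r\<close> on the rows and \<open>- r\<close> on the
    columns of the block; \<open>r_pair\<close> is the required inequality across nonzero
    entries.\<close>
  have pot_le: "sum (\<lambda>b. - r b) (C (hat i)) \<le> sum r (C i)"
    and pot_eq: "sum r (C i) \<le> sum (\<lambda>b. - r b) (C (hat i)) \<Longrightarrow> \<exists>f. (\<forall>a\<in>C i. r a = f) \<and> (\<forall>b\<in>C (hat i). - r b = f)"
    if i: "i \<in> {1..N}" for i
  proof -
    have hi: "hat i \<in> {1..N}" using compl_index_in[OF i] .
    have c: "card (C i) = card (C (hat i))" "card (C i) \<ge> 1"
      using card_compl[OF i] nonempty[OF i] finC[OF i] by (auto simp: Suc_le_eq card_gt_0_iff)
    have le: "- r b \<le> r a" if "a \<in> C i" "b \<in> C (hat i)" "S a b \<noteq> 0" for a b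
      using r_pair[of a b] that C_sub[OF i] C_sub[OF hi] by force
    note P = fully_indecomposable_potential[OF finC[OF i] finC[OF hi] c, of "\<lambda>a b. S a b \<noteq> 0" "\<lambda>b. - r b" r, OF FID[OF i] le]
    show "sum (\<lambda>b. - r b) (C (hat i)) \<le> sum r (C i)" by (rule P(1))
    show "sum r (C i) \<le> sum (\<lambda>b. - r b) (C (hat i)) \<Longrightarrow> \<exists>f. (\<forall>a\<in>C i. r a = f) \<and> (\<forall>b\<in>C (hat i). - r b = f)" by (rule P(2))
  qed
  \<comment> \<open>The sums over a block and its complement are nonnegative and add up to
    \<open>2 * sum r {1..n}\<close>, which is at most 0. So all of them vanish and the rigidity of
    potentials applies in every block.\<close>
  have tot: "(\<Sum>i\<in>{1..N}. sum r (C i) + sum r (C (hat i))) = 2 * sum r {1..n}"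
    using sum.reindex_bij_betw[OF bij_hat, of "\<lambda>i. sum r (C i)"] sum_blocks[of r] by (simp add: sum.distrib)
  have zero: "sum r (C i) + sum r (C (hat i)) = 0" if i: "i \<in> {1..N}" for i
  proof -
    have nn: "0 \<le> sum r (C i) + sum r (C (hat i))" if "i \<in> {1..N}" for i using pot_le[OF that] by (simp add: sum_negf)
    have "sum r (C i) + sum r (C (hat i)) \<le> (\<Sum>i\<in>{1..N}. sum r (C i) + sum r (C (hat i)))"
      using nn i by (intro member_le_sum) auto
    then show ?thesis using nn[OF i] tot r_sum by simp
  qed
  have "sum r (C i) \<le> sum (\<lambda>b. - r b) (C (hat i))" if "i \<in> {1..N}" for i
    using zero[OF that] by (simp add: sum_negf)
  then have "\<forall>i\<in>{1..N}. \<exists>f. (\<forall>a\<in>C i. r a = f) \<and> (\<forall>b\<in>C (hat i). - r b = f)"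
    using pot_eq by blast
  from bchoice[OF this] obtain f
    where "\<forall>i\<in>{1..N}. (\<forall>a\<in>C i. r a = f i) \<and> (\<forall>b\<in>C (hat i). - r b = f i)" ..
  then have f: "\<And>i a. i \<in> {1..N} \<Longrightarrow> a \<in> C i \<Longrightarrow> r a = f i"
    "\<And>i b. i \<in> {1..N} \<Longrightarrow> b \<in> C (hat i) \<Longrightarrow> - r b = f i" by blast+
  have f_hat: "f (hat i) = - f i" if i: "i \<in> {1..N}" for i
  proof -
    obtain b where "b \<in> C (hat i)" using nonempty[OF compl_index_in[OF i]] by blast
    then show ?thesis using f(1)[OF compl_index_in[OF i], of b] f(2)[OF i, of b] by simp
  qed
  have f_ge: "f i \<ge> - 1" if i: "i \<in> {1..N}" for i
  proof -
    obtain a where "a \<in> C i" using nonempty[OF i] by blast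
    then show ?thesis using f(1)[OF i, of a] r_ge[of a] C_sub[OF i] by auto
  qed
  have f_le: "f i \<le> 1" if i: "i \<in> {1..N}" for i
    using f_ge[OF compl_index_in[OF i]] f_hat[OF i] by simp
  have f_mono: "f j \<le> f i" if e: "edge i j" for i j
  proof -
    obtain a b where ab: "i \<in> {1..N}" "j \<in> {1..N}" "a \<in> C i" "b \<in> C (hat j)" "S a b \<noteq> 0"
      using e unfolding edge_def by blast
    have "r a + r b \<ge> 0"
      using C_sub[OF ab(1)] C_sub[OF compl_index_in[OF ab(2)]] ab(3-5) by (intro r_pair) auto
    then show ?thesis using f(1)[OF ab(1,3)] f(2)[OF ab(2,4)] by simp
  qed

  text \<open>The index \<open>0\<close> stands for the \<open>\<eta>\<close>-term of the equation.\<close>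
  define T where "T = (\<lambda>i. SIGMA a:C i. insert 0 {b \<in> {1..n} - C (hat i). S a b \<noteq> 0})"
  define w where "w = (\<lambda>(a, b) \<eta>. if b = 0 then \<eta> * v a \<eta> else S a b * (v a \<eta> * v b \<eta>))"
  define e where "e = (\<lambda>(a, b::nat). if b = 0 then 1 + r a else r a + r b)"
  define D where "D = (\<lambda>(a, b::nat). if b = 0 then c a else S a b * (c a * c b))"
  have finT: "finite (T i)" if "i \<in> {1..N}" for i unfolding T_def using finC[OF that] by (intro finite_SigmaI) auto
  have T_in: "fst t \<in> {1..n} \<and> (snd t = 0 \<or> snd t \<in> {1..n} \<and> S (fst t) (snd t) > 0)" if "i \<in> {1..N}" "t \<in> T i" for i t
    using that C_sub[OF that(1)] nonneg[of "fst t" "snd t"] by (fastforce simp: T_def)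
  have T_asym: "D t > 0 \<and> ((\<lambda>\<eta>. w t \<eta> * \<eta> powr (- e t)) \<longlongrightarrow> D t) (at_right 0)" if i: "i \<in> {1..N}" "t \<in> T i" for i t
  proof -
    obtain a b where t: "t = (a, b)" by fastforce
    have a: "a \<in> {1..n}" and b: "b = 0 \<or> b \<in> {1..n} \<and> S a b > 0" using T_in[OF i] t by auto
    show ?thesis
    proof (cases "b = 0")
      case True
      then show ?thesis using prod_asym[OF \<eta>_asym conjunct2[OF asym[OF a]]] asym[OF a] by (simp add: t w_def e_def D_def)
    next
      case False
      then have b: "b \<in> {1..n}" "S a b > 0" using b by auto
      have "((\<lambda>\<eta>. S a b * ((v a \<eta> * v b \<eta>) * \<eta> powr (- (r a + r b)))) \<longlongrightarrow> S a b * (c a * c b)) (at_right 0)"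
        using asym[OF a] asym[OF b(1)] by (intro tendsto_mult tendsto_const prod_asym) auto
      then show ?thesis using False b asym[OF a] asym[OF b(1)] by (simp add: t w_def e_def D_def mult.assoc)
    qed
  qed
  have T_nonneg: "w t \<eta> \<ge> 0" if i: "i \<in> {1..N}" "t \<in> T i" and "\<eta> > 0" for i t \<eta>
  proof -
    obtain a b where t: "t = (a, b)" by fastforce
    have "a \<in> {1..n}" "b = 0 \<or> b \<in> {1..n} \<and> S a b > 0" using T_in[OF i] t by auto
    then show ?thesis using v[OF _ \<open>\<eta> > 0\<close>] \<open>\<eta> > 0\<close> by (auto simp: t w_def less_imp_le)
  qed
  have T_sum: "(\<Sum>t\<in>T i. w t \<eta>) = card (C i) - (\<Sum>a\<in>C i. \<Sum>b\<in>C (hat i). S a b * (v a \<eta> * v b \<eta>))"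
    if i: "i \<in> {1..N}" and \<eta>: "\<eta> > 0" for i \<eta>
  proof -
    have hs: "C (hat i) \<subseteq> {1..n}" using C_sub compl_index_in i by blast
    have "(\<Sum>b\<in>insert 0 {b \<in> {1..n} - C (hat i). S a b \<noteq> 0}. w (a, b) \<eta>) = 1 - (\<Sum>b\<in>C (hat i). S a b * (v a \<eta> * v b \<eta>))"
      if a: "a \<in> C i" for a
    proof -
      have "(\<Sum>b\<in>insert 0 {b \<in> {1..n} - C (hat i). S a b \<noteq> 0}. w (a, b) \<eta>)
          = \<eta> * v a \<eta> + (\<Sum>b\<in>{b \<in> {1..n} - C (hat i). S a b \<noteq> 0}. S a b * (v a \<eta> * v b \<eta>))"
        by (subst sum.insert) (auto simp: w_def intro!: sum.cong)
      also have "(\<Sum>b\<in>{b \<in> {1..n} - C (hat i). S a b \<noteq> 0}. S a b * (v a \<eta> * v b \<eta>)) = (\<Sum>b\<in>{1..n} - C (hat i). S a b * (v a \<eta> * v b \<eta>))"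
        by (rule sum.mono_neutral_left) auto
      also have "\<dots> = (\<Sum>b\<in>{1..n}. S a b * (v a \<eta> * v b \<eta>)) - (\<Sum>b\<in>C (hat i). S a b * (v a \<eta> * v b \<eta>))"
        using hs by (intro sum_diff) auto
      also have "\<eta> * v a \<eta> + ((\<Sum>b\<in>{1..n}. S a b * (v a \<eta> * v b \<eta>)) - (\<Sum>b\<in>C (hat i). S a b * (v a \<eta> * v b \<eta>)))
         = v a \<eta> * (\<eta> + (\<Sum>b\<in>{1..n}. S a b * v b \<eta>)) - (\<Sum>b\<in>C (hat i). S a b * (v a \<eta> * v b \<eta>))"
        by (simp add: algebra_simps sum_distrib_left)
      also have "v a \<eta> * (\<eta> + (\<Sum>b\<in>{1..n}. S a b * v b \<eta>)) = 1" using v[OF _ \<eta>] a C_sub[OF i] by blast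
      finally show ?thesis .
    qed
    then have "(\<Sum>a\<in>C i. \<Sum>b\<in>insert 0 {b \<in> {1..n} - C (hat i). S a b \<noteq> 0}. w (a, b) \<eta>)
       = (\<Sum>a\<in>C i. 1 - (\<Sum>b\<in>C (hat i). S a b * (v a \<eta> * v b \<eta>)))" by (intro sum.cong) auto
    moreover have "(\<Sum>t\<in>T i. w t \<eta>) = (\<Sum>a\<in>C i. \<Sum>b\<in>insert 0 {b \<in> {1..n} - C (hat i). S a b \<noteq> 0}. w (a, b) \<eta>)"
      unfolding T_def using finC[OF i] by (subst sum.Sigma) (auto simp: split_def)
    ultimately show ?thesis by (simp add: sum_subtractf)
  qed
  \<comment> \<open>The part split off in \<open>T_sum\<close> is the same for \<open>i\<close> and
    \<open>hat i\<close>, since the two blocks are transposes of each other. Its terms have exponent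
    0 and would hide all terms of positive exponent; what remains can be compared by order.\<close>
  have T_eq: "(\<Sum>t\<in>T i. w t \<eta>) = (\<Sum>t\<in>T (hat i). w t \<eta>)" if i: "i \<in> {1..N}" and \<eta>: "\<eta> > 0" for i \<eta>
  proof -
    have hi: "hat i \<in> {1..N}" using compl_index_in[OF i] .
    have "(\<Sum>a\<in>C i. \<Sum>b\<in>C (hat i). S a b * (v a \<eta> * v b \<eta>)) = (\<Sum>b\<in>C (hat i). \<Sum>a\<in>C i. S b a * (v b \<eta> * v a \<eta>))"
      by (subst sum.swap) (use sym C_sub[OF i] C_sub[OF hi] in \<open>auto intro!: sum.cong simp: mult_ac subset_iff\<close>)
    then show ?thesis unfolding T_sum[OF i \<eta>] T_sum[OF hi \<eta>] compl_index_invol[OF i] card_compl[OF i] by simp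
  qed
  have compare: "\<exists>t'\<in>T (hat i). e t' \<le> e t" if i: "i \<in> {1..N}" and t: "t \<in> T i" for i t
  proof -
    have hi: "hat i \<in> {1..N}" using compl_index_in[OF i] .
    show ?thesis
      by (rule dominating_term[OF finT[OF i] finT[OF hi] t, where b = w and b' = w and C = "D t" and C' = D])
         (use T_eq[OF i] T_nonneg[OF i] T_asym[OF i t] T_asym[OF hi] in auto)
  qed
  \<comment> \<open>An entry in column block \<open>h\<close> is an edge from \<open>i\<close> to
    \<open>hat h\<close>. It contributes the exponent \<open>f i + f h\<close>, and
    \<open>f h = - f (hat h)\<close>.\<close>
  have term_edge: "e (a, b) = f i - f (hat h) \<and> edge i (hat h)" if i: "i \<in> {1..N}" and ab: "(a, b) \<in> T i" "b \<noteq> 0" and h: "h \<in> {1..N}" "b \<in> C h" for i a b h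
  proof -
    have a: "a \<in> C i" "S a b \<noteq> 0" "b \<notin> C (hat i)" using ab by (auto simp: T_def)
    have "i \<noteq> hat h" using a(3) h compl_index_invol[OF h(1)] by auto
    then have "edge i (hat h)" using i a h compl_index_in[OF h(1)] compl_index_invol[OF h(1)] by (auto simp: edge_def)
    moreover have "e (a, b) = f i + f h" using f(1)[OF i a(1)] f(1)[OF h] ab(2) by (simp add: e_def)
    ultimately show ?thesis using f_hat[OF h(1)] by simp
  qed
  have term_cases: "e t = 1 + f i \<or> (\<exists>g. edge i g \<and> e t = f i - f g)" if i: "i \<in> {1..N}" and t: "t \<in> T i" for i t
  proof -
    obtain a b where ab: "t = (a, b)" by fastforce
    show ?thesis
    proof (cases "b = 0")
      case True
      then show ?thesis using f(1)[OF i, of a] t by (auto simp: ab e_def T_def)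
    next
      case False
      then have "b \<in> {1..n}" using T_in[OF i t] ab by auto
      then obtain h where "h \<in> {1..N}" "b \<in> C h" using cover by blast
      then show ?thesis using term_edge[OF i _ False, of a h] t ab by auto
    qed
  qed
  have edge_hat: "edge (hat g) (hat i)" if e: "edge i g" for i g
  proof -
    obtain a b where ab: "i \<in> {1..N}" "g \<in> {1..N}" "i \<noteq> g" "a \<in> C i" "b \<in> C (hat g)" "S a b \<noteq> 0"
      using e unfolding edge_def by blast
    have "hat g \<noteq> hat i" using ab(1-3) compl_index_invol by metis
    moreover have "S b a \<noteq> 0" using sym[of a b] ab C_sub[OF ab(1)] C_sub[OF compl_index_in[OF ab(2)]] by force
    ultimately show ?thesis using ab compl_index_in compl_index_invol by (auto simp: edge_def)
  qed
  have term_of_edge: "\<exists>t\<in>T i. e t = f i - x" if i: "i \<in> {1..N}" and x: "x \<in> insert (- 1) (f ` {j. edge i j})" for i x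
  proof (cases "x = - 1")
    case True
    obtain a where a: "a \<in> C i" using nonempty[OF i] by blast
    then have "(a, 0) \<in> T i" by (auto simp: T_def)
    then show ?thesis using True f(1)[OF i a] by (intro bexI[of _ "(a, 0)"]) (auto simp: e_def)
  next
    case False
    then obtain j where "edge i j" "x = f j" using x by auto
    then obtain a b where ab: "j \<in> {1..N}" "i \<noteq> j" "a \<in> C i" "b \<in> C (hat j)" "S a b \<noteq> 0"
      unfolding edge_def by blast
    have hj: "hat j \<in> {1..N}" and hi: "hat i \<in> {1..N}" using compl_index_in ab i by auto
    have "hat i \<noteq> hat j" using ab(1,2) i compl_index_invol by metis
    then have "b \<notin> C (hat i)" using disjoint[OF hi hj] ab(4) by blast
    moreover have b: "b \<in> {1..n}" using C_sub[OF hj] ab by blast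
    ultimately have t: "(a, b) \<in> T i" using ab by (auto simp: T_def)
    have "b \<noteq> 0" using b by simp
    from term_edge[OF i t this hj ab(4)] show ?thesis
      using t \<open>x = f j\<close> compl_index_invol[OF ab(1)] by auto
  qed
  \<comment> \<open>A term for \<open>i\<close> is dominated by one for \<open>hat i\<close>. Edges
    out of \<open>hat i\<close> are the reversed edges into \<open>i\<close>, and the \<eta>-terms
    account for the boundary values: their exponents are \<open>f i - (- 1)\<close> and
    \<open>1 - f i\<close>.\<close>
  have balance: "\<exists>y\<in>insert 1 (f ` {j. edge j i}). y - f i \<le> f i - x" if i: "i \<in> {1..N}" and x: "x \<in> insert (- 1) (f ` {j. edge i j})" for i x
  proof -
    have hi: "hat i \<in> {1..N}" using compl_index_in[OF i] .
    obtain t where t: "t \<in> T i" "e t = f i - x" using term_of_edge[OF i x] by blast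
    obtain t' where t': "t' \<in> T (hat i)" "e t' \<le> e t" using compare[OF i t(1)] by blast
    from term_cases[OF hi t'(1)] show ?thesis
    proof
      assume "e t' = 1 + f (hat i)"
      then show ?thesis using t' t f_hat[OF i] by (intro bexI[of _ 1]) auto
    next
      assume "\<exists>g. edge (hat i) g \<and> e t' = f (hat i) - f g"
      then obtain g where g: "edge (hat i) g" "e t' = f (hat i) - f g" by blast
      have gN: "g \<in> {1..N}" using g(1) by (auto simp: edge_def)
      have "edge (hat g) i" using edge_hat[OF g(1)] compl_index_invol[OF i] by simp
      moreover have "f (hat g) - f i \<le> f i - x" using g(2) t' t f_hat[OF i] f_hat[OF gN] by simp
      ultimately show ?thesis by blast
    qed
  qed
  \<comment> \<open>The previous fact at \<open>hat i\<close>, transported back by the duality,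
    which reverses edges and changes the sign of \<open>f\<close>.\<close>
  have balance': "\<exists>x\<in>insert (- 1) (f ` {j. edge i j}). f i - x \<le> y - f i" if i: "i \<in> {1..N}" and y: "y \<in> insert 1 (f ` {j. edge j i})" for i y
  proof -
    have hi: "hat i \<in> {1..N}" using compl_index_in[OF i] .
    have "- y \<in> insert (- 1) (f ` {j. edge (hat i) j})"
    proof (cases "y = 1")
      case False
      then obtain j where j: "edge j i" "y = f j" using y by auto
      then have "j \<in> {1..N}" by (auto simp: edge_def)
      then show ?thesis using edge_hat[OF j(1)] j(2) f_hat by (auto intro!: image_eqI[of _ f "hat j"])
    qed simp
    then obtain x where x: "x \<in> insert 1 (f ` {j. edge j (hat i)})" "x - f (hat i) \<le> f (hat i) - (- y)"
      using balance[OF hi] by blast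
    have "- x \<in> insert (- 1) (f ` {j. edge i j})"
    proof (cases "x = 1")
      case False
      then obtain j where j: "edge j (hat i)" "x = f j" using x(1) by auto
      then have "j \<in> {1..N}" by (auto simp: edge_def)
      then show ?thesis using edge_hat[OF j(1)] j(2) f_hat compl_index_invol[OF i] by (auto intro!: image_eqI[of _ f "hat j"])
    qed simp
    then show ?thesis using x(2) f_hat[OF i] by (intro bexI[of _ "- x"]) auto
  qed
  have "r ` {1..n} = f ` {1..N}"
  proof safe
    fix a assume "a \<in> {1..n}"
    then obtain i where "i \<in> {1..N}" "a \<in> C i" using cover by blast
    then show "r a \<in> f ` {1..N}" using f(1) by auto
  next
    fix i assume i: "i \<in> {1..N}"
    then obtain a where a: "a \<in> C i" using nonempty by blast
    then show "f i \<in> r ` {1..n}" using f(1)[OF i a] C_sub[OF i] by (intro image_eqI[of _ r a]) auto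
  qed
  moreover have "Min (f ` {1..N}) = - (let d = real (Max {m. \<exists>s. (\<forall>a\<le>m. s a \<in> {1..N}) \<and> (\<forall>a<m. edge (s a) (s (Suc a)))}) in d / (d + 2))"
    unfolding Let_def
  proof (rule min_exponent[OF LM])
    show "i \<in> {1..N} \<and> j \<in> {1..N} \<and> i < j" if "edge i j" for i j
      using that triangular[of i j] by (auto simp: edge_def)
    show "- 1 \<le> f i \<and> f i \<le> 1" if "i \<in> {1..N}" for i
      using f_ge[OF that] f_le[OF that] by simp
  qed (fact f_mono balance balance')+
  ultimately show ?thesis by simp
qed

end

section \<open>Normal forms\<close>

definition block_element :: "(nat \<Rightarrow> nat) \<Rightarrow> (nat \<Rightarrow> nat) \<Rightarrow> nat \<Rightarrow> nat \<Rightarrow> nat" where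
  "block_element p k i a = p ((\<Sum>l\<in>{1..<i}. k l) + a)"

lemma block_permuted: "block k (\<lambda>i j. S (p i) (p j)) i j a b = S (block_element p k i a) (block_element p k j b)"
  by (simp add: block_def block_element_def)

lemma offset_mono:
  fixes k :: "nat \<Rightarrow> nat"
  assumes "1 \<le> i" "i < j"
  shows "(\<Sum>l\<in>{1..<i}. k l) + k i \<le> (\<Sum>l\<in>{1..<j}. k l)"
proof -
  have "(\<Sum>l\<in>{1..<i}. k l) + k i = sum k {1..<Suc i}" using assms by simp
  also have "\<dots> \<le> sum k {1..<j}" using assms by (intro sum_mono2) auto
  finally show ?thesis .
qed

lemma offset_cover:
  fixes k :: "nat \<Rightarrow> nat"
  shows "(\<Union>i\<in>{1..m}. (\<lambda>a. (\<Sum>l\<in>{1..<i}. k l) + a) ` {1..k i}) = {1..\<Sum>l\<in>{1..m}. k l}"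
proof (induction m)
  case (Suc m)
  have s: "(\<Sum>l\<in>{1..<Suc m}. k l) = (\<Sum>l\<in>{1..m}. k l)" by (simp add: atLeastLessThanSuc_atLeastAtMost)
  have "(\<lambda>a. (\<Sum>l\<in>{1..m}. k l) + a) ` {1..k (Suc m)} = {Suc (\<Sum>l\<in>{1..m}. k l)..(\<Sum>l\<in>{1..m}. k l) + k (Suc m)}"
    using image_add_atLeastAtMost[of "\<Sum>l\<in>{1..m}. k l" 1 "k (Suc m)"] by simp
  moreover have "{1..Suc m} = insert (Suc m) {1..m}" by auto
  ultimately show ?case using Suc s by auto
qed auto

lemma block_element_blocks:
  fixes k :: "nat \<Rightarrow> nat"
  assumes p: "p permutes {1..n}" and k: "(\<Sum>i\<in>{1..m}. k i) = n"
  shows "i \<in> {1..m} \<Longrightarrow> inj_on (block_element p k i) {1..k i}"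
    and "i \<in> {1..m} \<Longrightarrow> j \<in> {1..m} \<Longrightarrow> i \<noteq> j \<Longrightarrow> block_element p k i ` {1..k i} \<inter> block_element p k j ` {1..k j} = {}"
    and "(\<Union>i\<in>{1..m}. block_element p k i ` {1..k i}) = {1..n}"
proof -
  have injp: "inj p" using p by (rule permutes_inj)
  show "inj_on (block_element p k i) {1..k i}" if "i \<in> {1..m}"
    by (rule inj_onI) (simp add: block_element_def inj_eq[OF injp])
  have disj: "block_element p k i ` {1..k i} \<inter> block_element p k j ` {1..k j} = {}" if "i \<ge> 1" "i < j" for i j
  proof -
    have False if a: "a \<in> {1..k i}" and b: "b \<in> {1..k j}" and eq: "block_element p k i a = block_element p k j b" for a b
    proof -
      have "(\<Sum>l\<in>{1..<i}. k l) + a = (\<Sum>l\<in>{1..<j}. k l) + b"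
        using eq by (simp add: block_element_def inj_eq[OF injp])
      then show False using offset_mono[OF \<open>i \<ge> 1\<close> \<open>i < j\<close>, of k] a b by simp
    qed
    then show ?thesis by blast
  qed
  show "block_element p k i ` {1..k i} \<inter> block_element p k j ` {1..k j} = {}"
    if i: "i \<in> {1..m}" and j: "j \<in> {1..m}" and ij: "i \<noteq> j"
  proof (cases "i < j")
    case True
    then show ?thesis using i by (intro disj) simp_all
  next
    case False
    then have "j < i" using ij by simp
    then show ?thesis using j disj[of j i] by (simp only: Int_commute atLeastAtMost_iff)
  qed
  have "(\<Union>i\<in>{1..m}. block_element p k i ` {1..k i}) = p ` (\<Union>i\<in>{1..m}. (\<lambda>a. (\<Sum>l\<in>{1..<i}. k l) + a) ` {1..k i})"
    by (simp only: block_element_def[abs_def] image_UN image_image)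
  then show "(\<Union>i\<in>{1..m}. block_element p k i ` {1..k i}) = {1..n}"
    unfolding offset_cover k using permutes_image[OF p] by simp
qed

lemma zero_block_permuted:
  "zero_block k (\<lambda>i j. S (p i) (p j)) i j \<longleftrightarrow>
    (\<forall>a\<in>block_element p k i ` {1..k i}. \<forall>b\<in>block_element p k j ` {1..k j}. S a b = 0)"
  by (simp add: zero_block_def block_permuted)

lemma normal_form_block_structure:
  assumes S: "symmetric_matrix n S" "nonneg_matrix n S" and p: "p permutes {1..n}"
    and nf: "normal_form n (\<lambda>i j. S (p i) (p j)) L M k"
  defines "C \<equiv> \<lambda>i. block_element p k i ` {1..k i}"
  shows "block_structure n S L M C"
    and "longest_increasing L M (zero_one_mask k (\<lambda>i j. S (p i) (p j)))
      = Max {m. \<exists>s. (\<forall>a\<le>m. s a \<in> {1..L + 2 * M}) \<and> (\<forall>a<m. block_structure.edge S L M C (s a) (s (Suc a)))}"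
proof -
  let ?R = "\<lambda>i j. S (p i) (p j)" and ?N = "L + 2 * M"
  have LM: "1 \<le> ?N" and k1: "\<And>i. i \<in> {1..?N} \<Longrightarrow> 1 \<le> k i \<and> k (compl_index L M i) = k i"
    and ksum: "(\<Sum>i\<in>{1..?N}. k i) = n"
    and fid: "\<And>i. i \<in> {1..?N} \<Longrightarrow> fully_indecomposable (k i) (block k ?R i (compl_index L M i))"
    and zero: "\<And>i j. i \<in> {1..?N} \<Longrightarrow> j \<in> {1..?N} \<Longrightarrow>
        (i \<noteq> j \<and> M < i \<and> i \<le> M + L \<and> M < j \<and> j \<le> M + L \<longrightarrow> zero_block k ?R i j) \<and>
        ((M < i \<and> i \<le> M + L \<and> M + L < j) \<or> (M < j \<and> j \<le> M + L \<and> M + L < i) \<or> (M + L < i \<and> M + L < j) \<longrightarrow> zero_block k ?R i j) \<and>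
        (((i \<le> M \<and> M + L < j) \<or> (j \<le> M \<and> M + L < i)) \<and> L + 2 * M + 1 < i + j \<longrightarrow> zero_block k ?R i j)"
    using nf unfolding normal_form_def by blast+
  note blocks = block_element_blocks[OF p ksum]
  have cardC: "card (C i) = k i" if "i \<in> {1..?N}" for i
    unfolding C_def using card_image[OF blocks(1)[OF that]] by simp
  show bs: "block_structure n S L M C"
  proof
    show "0 \<le> S a b" "S a b = S b a" if "a \<in> {1..n}" "b \<in> {1..n}" for a b
      using S that by (auto simp: nonneg_matrix_def symmetric_matrix_def)
    show "C i \<inter> C j = {}" if "i \<in> {1..?N}" "j \<in> {1..?N}" "i \<noteq> j" for i j
      unfolding C_def using blocks(2)[OF that] .
    show "(\<Union>i\<in>{1..?N}. C i) = {1..n}" unfolding C_def by (rule blocks(3))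
    show "C i \<noteq> {}" if "i \<in> {1..?N}" for i unfolding C_def using k1[OF that] by simp
    show "card (C (compl_index L M i)) = card (C i)" if "i \<in> {1..?N}" for i
      using cardC[OF that] cardC[OF compl_index_in[OF that]] k1[OF that] by simp
    show "\<exists>a\<in>I. \<exists>b\<in>J. S a b \<noteq> 0"
      if i: "i \<in> {1..?N}" and I: "I \<subseteq> C i" "I \<noteq> {}" and J: "J \<subseteq> C (compl_index L M i)" "J \<noteq> {}"
        and card: "card (C i) \<le> card I + card J" for i I J
    proof -
      let ?j = "compl_index L M i"
      have j: "?j \<in> {1..?N}" using compl_index_in[OF i] .
      obtain I' where I': "I' \<subseteq> {1..k i}" "I = block_element p k i ` I'" using I(1) unfolding C_def by (meson subset_imageE)
      obtain J' where J': "J' \<subseteq> {1..k ?j}" "J = block_element p k ?j ` J'" using J(1) unfolding C_def by (meson subset_imageE)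
      have "card I = card I'" unfolding I'(2) by (rule card_image[OF inj_on_subset[OF blocks(1)[OF i] I'(1)]])
      moreover have "card J = card J'" unfolding J'(2) by (rule card_image[OF inj_on_subset[OF blocks(1)[OF j] J'(1)]])
      ultimately have "k i \<le> card I' + card J'" using card cardC[OF i] by simp
      moreover have "J' \<subseteq> {1..k i}" using J'(1) k1[OF i] by simp
      moreover have "I' \<noteq> {}" "J' \<noteq> {}" using I(2) J(2) I'(2) J'(2) by auto
      ultimately have "\<exists>a\<in>I'. \<exists>b\<in>J'. block k ?R i ?j a b \<noteq> 0"
        using fid[OF i] I'(1) unfolding fully_indecomposable_def by blast
      then show ?thesis unfolding I'(2) J'(2) block_permuted by blast
    qed
    show "i < j" if i: "i \<in> {1..?N}" and j: "j \<in> {1..?N}" and ij: "i \<noteq> j"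
      and nz: "\<exists>a\<in>C i. \<exists>b\<in>C (compl_index L M j). S a b \<noteq> 0" for i j
    proof (rule ccontr)
      assume "\<not> i < j"
      then have "j < i" using ij by simp
      moreover have "\<not> zero_block k ?R i (compl_index L M j)"
        using nz unfolding zero_block_permuted C_def by blast
      \<comment> \<open>For \<open>j < i\<close> the positions \<open>i\<close> and
        \<open>compl_index L M j\<close> always fall under one of the three vanishing conditions of
        the normal form.\<close>
      ultimately show False
        using zero[OF i compl_index_in[OF j]] i j by (auto simp: compl_index_def split: if_splits)
    qed
  qed (use LM in simp)
  interpret block_structure n S L M C by (rule bs)
  have lhd_iff: "lhd L M (zero_one_mask k ?R) i j \<longleftrightarrow> edge i j" if "i \<in> {1..?N}" "j \<in> {1..?N}" for i j
  proof -
    have "zero_block k ?R i j' \<longleftrightarrow> (\<forall>a\<in>C i. \<forall>b\<in>C j'. S a b = 0)" for j'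
      unfolding zero_block_permuted C_def ..
    then show ?thesis using that unfolding lhd_def zero_one_mask_def edge_def by auto
  qed
  have inc: "increasing_seq L M (zero_one_mask k ?R) m s \<longleftrightarrow> (\<forall>a\<le>m. s a \<in> {1..?N}) \<and> (\<forall>a<m. edge (s a) (s (Suc a)))" for m s
  proof (cases "\<forall>a\<le>m. s a \<in> {1..?N}")
    case True
    then have "lhd L M (zero_one_mask k ?R) (s a) (s (Suc a)) \<longleftrightarrow> edge (s a) (s (Suc a))" if "a < m" for a
      using that by (intro lhd_iff) auto
    then have "(\<forall>a<m. lhd L M (zero_one_mask k ?R) (s a) (s (Suc a))) \<longleftrightarrow> (\<forall>a<m. edge (s a) (s (Suc a)))"
      by blast
    then show ?thesis unfolding increasing_seq_def by (rule arg_cong)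
  qed (auto simp: increasing_seq_def)
  show "longest_increasing L M (zero_one_mask k ?R) = Max {m. \<exists>s. (\<forall>a\<le>m. s a \<in> {1..?N}) \<and> (\<forall>a<m. edge (s a) (s (Suc a)))}"
    unfolding longest_increasing_def inc ..
qed

section \<open>Existence of a normal form\<close>

text \<open>\<open>center\<close> serves the blocks between different central indices; every other
  block that has to vanish is at a position with \<open>hat j < i\<close> and is covered by
  \<open>triangular\<close>.\<close>

lemma normal_form_of_block_structure:
  assumes S: "symmetric_matrix n S" "nonneg_matrix n S" and "block_structure n S L M C"
    and center: "\<And>i j. block_structure.edge S L M C i j \<Longrightarrow> \<not> (M < i \<and> j \<le> M + L)"
  shows "\<exists>p k. p permutes {1..n} \<and> normal_form n (\<lambda>i j. S (p i) (p j)) L M k"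
proof -
  interpret block_structure n S L M C by fact
  define k where "k = (\<lambda>i. card (C i))"
  have ksum: "(\<Sum>i\<in>{1..N}. k i) = n"
  proof -
    have "card (\<Union>i\<in>{1..N}. C i) = (\<Sum>i\<in>{1..N}. card (C i))"
      by (rule card_UN_disjoint) (use finC disjoint in auto)
    then show ?thesis unfolding cover k_def by simp
  qed
  note blocks = block_element_blocks[OF permutes_id ksum]
  \<comment> \<open>With the identity as permutation, \<open>?B i\<close> is the interval of
    positions of block \<open>i\<close>; \<open>p\<close> is glued from bijections of these
    intervals onto the sets \<open>C i\<close>.\<close>
  let ?B = "\<lambda>i. block_element id k i ` {1..k i}"
  have "\<exists>g. bij_betw g (?B i) (C i)" if "i \<in> {1..N}" for i
    using card_image[OF blocks(1)[OF that]] finC[OF that] by (intro finite_same_card_bij) (auto simp: k_def)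
  then have "\<forall>i\<in>{1..N}. \<exists>g. bij_betw g (?B i) (C i)" by blast
  from bchoice[OF this] obtain g where g: "\<forall>i\<in>{1..N}. bij_betw (g i) (?B i) (C i)" ..
  define idx where "idx = (\<lambda>x. SOME i. i \<in> {1..N} \<and> x \<in> ?B i)"
  have idx: "idx x = i" if "i \<in> {1..N}" "x \<in> ?B i" for i x
  proof -
    have "idx x \<in> {1..N} \<and> x \<in> ?B (idx x)" unfolding idx_def by (rule someI[of _ i]) (use that in blast)
    then show ?thesis using blocks(2)[of "idx x" i] that by blast
  qed
  define p where "p = (\<lambda>x. if x \<in> {1..n} then g (idx x) x else x)"
  have B_sub: "?B i \<subseteq> {1..n}" if "i \<in> {1..N}" for i using blocks(3) that by blast
  have p_eq: "p x = g i x" if "i \<in> {1..N}" "x \<in> ?B i" for i x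
    using idx[OF that] B_sub[OF that(1)] that(2) unfolding p_def by auto
  have pB: "p ` ?B i = C i" if "i \<in> {1..N}" for i
  proof -
    have "p ` ?B i = g i ` ?B i" using p_eq[OF that] by (intro image_cong) auto
    then show ?thesis using g that bij_betw_imp_surj_on by metis
  qed
  have "p ` {1..n} = {1..n}"
  proof -
    have "p ` {1..n} = (\<Union>i\<in>{1..N}. p ` ?B i)" unfolding blocks(3)[symmetric] by (simp add: image_UN)
    also have "\<dots> = {1..n}" using pB cover by simp
    finally show ?thesis .
  qed
  then have "bij_betw p {1..n} {1..n}"
    by (simp add: bij_betw_def eq_card_imp_inj_on)
  then have p: "p permutes {1..n}" by (rule bij_imp_permutes) (auto simp: p_def)
  have pC: "block_element p k i ` {1..k i} = C i" if "i \<in> {1..N}" for i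
    using pB[OF that] unfolding block_element_def[abs_def] image_image id_apply .
  let ?R = "\<lambda>i j. S (p i) (p j)"
  have zb: "zero_block k ?R i j" if i: "i \<in> {1..N}" and j: "j \<in> {1..N}" and ij: "i \<noteq> hat j" and ne: "\<not> edge i (hat j)" for i j
    unfolding zero_block_permuted pC[OF i] pC[OF j]
    using ne i ij compl_index_in[OF j] compl_index_invol[OF j] unfolding edge_def by auto
  have edge_lt: "i < j \<and> \<not> (M < i \<and> j \<le> M + L)" if "edge i j" for i j
    using that center[OF that] triangular[of i j] unfolding edge_def by blast
  have "fully_indecomposable (k i) (block k ?R i (hat i))" if i: "i \<in> {1..N}" for i
    unfolding fully_indecomposable_def
  proof (intro allI impI)
    fix I J assume IJ: "I \<subseteq> {1..k i} \<and> J \<subseteq> {1..k i} \<and> I \<noteq> {} \<and> J \<noteq> {} \<and> k i \<le> card I + card J"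
    have j: "hat i \<in> {1..N}" using compl_index_in[OF i] .
    have kj: "k (hat i) = k i" using card_compl[OF i] by (simp add: k_def)
    note b = block_element_blocks(1)[OF p ksum]
    have "card (block_element p k i ` I) = card I" using IJ by (intro card_image inj_on_subset[OF b[OF i]]) auto
    moreover have "card (block_element p k (hat i) ` J) = card J" using IJ kj by (intro card_image inj_on_subset[OF b[OF j]]) auto
    moreover have "block_element p k i ` I \<subseteq> C i" using IJ pC[OF i] by blast
    moreover have "block_element p k (hat i) ` J \<subseteq> C (hat i)" using IJ pC[OF j] kj by auto
    ultimately have "\<exists>a\<in>block_element p k i ` I. \<exists>b\<in>block_element p k (hat i) ` J. S a b \<noteq> 0"
      using IJ by (intro FID[OF i]) (auto simp: k_def)
    then show "\<exists>a\<in>I. \<exists>b\<in>J. block k ?R i (hat i) a b \<noteq> 0" by (simp add: block_permuted)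
  qed
  moreover have "symmetric_matrix n ?R" "nonneg_matrix n ?R"
  proof -
    have pV: "p i \<in> {1..n}" if "i \<in> {1..n}" for i using permutes_in_image[OF p] that by blast
    show "symmetric_matrix n ?R" using S(1) pV unfolding symmetric_matrix_def by blast
    show "nonneg_matrix n ?R" using S(2) pV unfolding nonneg_matrix_def by blast
  qed
  moreover have "\<forall>i\<in>{1..N}. 1 \<le> k i \<and> k (hat i) = k i"
    using nonempty finC card_compl by (auto simp: k_def Suc_le_eq card_gt_0_iff)
  moreover have "(i \<noteq> j \<and> M < i \<and> i \<le> M + L \<and> M < j \<and> j \<le> M + L \<longrightarrow> zero_block k ?R i j) \<and>
        ((M < i \<and> i \<le> M + L \<and> M + L < j) \<or> (M < j \<and> j \<le> M + L \<and> M + L < i) \<or> (M + L < i \<and> M + L < j) \<longrightarrow> zero_block k ?R i j) \<and>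
        (((i \<le> M \<and> M + L < j) \<or> (j \<le> M \<and> M + L < i)) \<and> L + 2 * M + 1 < i + j \<longrightarrow> zero_block k ?R i j)"
    if i: "i \<in> {1..N}" and j: "j \<in> {1..N}" for i j
  proof -
    have zz: "zero_block k ?R i j" if "hat j < i \<or> i \<noteq> hat j \<and> M < i \<and> hat j \<le> M + L"
      by (rule zb[OF i j]) (use that edge_lt[of i "hat j"] in auto)
    have "hat j < i \<or> i \<noteq> hat j \<and> M < i \<and> hat j \<le> M + L"
      if "i \<noteq> j \<and> M < i \<and> i \<le> M + L \<and> M < j \<and> j \<le> M + L \<or> M < i \<and> i \<le> M + L \<and> M + L < j
        \<or> M < j \<and> j \<le> M + L \<and> M + L < i \<or> M + L < i \<and> M + L < j
        \<or> ((i \<le> M \<and> M + L < j) \<or> (j \<le> M \<and> M + L < i)) \<and> L + 2 * M + 1 < i + j"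
    proof (cases "M < j \<and> j \<le> M + L")
      case True
      then have "hat j = j" by (simp add: compl_index_def)
      then show ?thesis using that True by presburger
    next
      case False
      then have "hat j = N + 1 - j" by (auto simp: compl_index_def)
      then show ?thesis using that False i j unfolding atLeastAtMost_iff by presburger
    qed
    then show ?thesis using zz by blast
  qed
  ultimately have "normal_form n ?R L M k"
    unfolding normal_form_def using LM ksum by blast
  then show ?thesis using p by blast
qed

text \<open>The permutation of the support need not be an involution, so it does not pair off
  indices. Its square, however, maps each strongly connected component to itself, and therefore
  complementation is an involution on components.\<close>

lemma ex_normal_form:
  assumes n: "1 \<le> n" and S: "symmetric_matrix n S" "nonneg_matrix n S" and supp: "has_support n S"
  shows "\<exists>p L M k. p permutes {1..n} \<and> normal_form n (\<lambda>i j. S (p i) (p j)) L M k"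
proof -
  define V where "V = {1..n}"
  obtain \<pi> where \<pi>: "\<pi> permutes V" "\<And>x. x \<in> V \<Longrightarrow> S x (\<pi> x) > 0"
    using supp unfolding has_support_def V_def by blast
  have finV: "finite V" by (simp add: V_def)
  have sym: "S a b = S b a" if "a \<in> V" "b \<in> V" for a b
    using S(1) that unfolding symmetric_matrix_def V_def by blast
  have nonneg: "0 \<le> S a b" if "a \<in> V" "b \<in> V" for a b
    using S(2) that unfolding nonneg_matrix_def V_def by blast
  have \<pi>V: "\<pi> x \<in> V \<longleftrightarrow> x \<in> V" for x using permutes_in_image[OF \<pi>(1)] .
  have inj\<pi>: "inj \<pi>" using permutes_inj[OF \<pi>(1)] .
  have \<pi>inv: "\<pi> (inv_into UNIV \<pi> x) = x" "inv_into UNIV \<pi> (\<pi> x) = x" for x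
    using permutes_inverses[OF \<pi>(1)] by auto
  have invV: "inv_into UNIV \<pi> x \<in> V \<longleftrightarrow> x \<in> V" for x using permutes_in_image[OF permutes_inv[OF \<pi>(1)]] .

  text \<open>Identifying column \<open>\<pi> y\<close> with row \<open>y\<close> turns the support of \<open>S\<close> into a digraph with loops,
    whose strongly connected components are the blocks; \<open>\<pi>\<close> reverses its reachability relation.\<close>
  define R where "R = {(x, y). x \<in> V \<and> y \<in> V \<and> S x (\<pi> y) > 0}"
  define reach where "reach = (\<lambda>x y. (x, y) \<in> R\<^sup>*)"
  have reach_refl: "reach x x" for x by (simp add: reach_def)
  have reach_trans: "reach x y \<Longrightarrow> reach y z \<Longrightarrow> reach x z" for x y z by (simp add: reach_def)
  have R_reach: "(x, y) \<in> R \<Longrightarrow> reach x y" for x y by (simp add: reach_def)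
  have R_dual: "(\<pi> y, inv_into UNIV \<pi> x) \<in> R" if "(x, y) \<in> R" for x y
    using that sym[of x "\<pi> y"] by (simp add: R_def \<pi>V invV \<pi>inv)
  have R_loop: "(x, x) \<in> R" if "x \<in> V" for x using that \<pi>(2) by (simp add: R_def)
  \<comment> \<open>The power -2 of \<open>\<pi>\<close>: dualising the loop at the preimage of
    \<open>x\<close> gives the edge from \<open>x\<close> to \<open>\<sigma> x\<close>.\<close>
  define \<sigma> where "\<sigma> = inv_into UNIV \<pi> \<circ> inv_into UNIV \<pi>"
  have \<sigma>: "\<sigma> permutes V" unfolding \<sigma>_def by (intro permutes_compose permutes_inv \<pi>(1))
  have R_\<sigma>: "(x, \<sigma> x) \<in> R" if "x \<in> V" for x
    using R_dual[OF R_loop[of "inv_into UNIV \<pi> x"]] that by (simp add: invV \<pi>inv \<sigma>_def)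
  have \<sigma>V: "(\<sigma> ^^ j) x \<in> V" if "x \<in> V" for x j
    using that permutes_in_image[OF \<sigma>] by (induction j) auto
  have reach_\<sigma>: "reach x ((\<sigma> ^^ j) x)" if "x \<in> V" for x j
  proof (induction j)
    case (Suc j)
    then show ?case using R_reach[OF R_\<sigma>[OF \<sigma>V[OF that, of j]]] reach_trans by auto
  qed (simp add: reach_refl)
  \<comment> \<open>A permutation of a finite set has finite order, so following the edges of
    \<open>\<sigma>\<close> from \<open>x\<close> leads around the cycle to its predecessor
    \<open>\<pi> (\<pi> x)\<close>.\<close>
  have reach_\<pi>\<pi>: "reach x (\<pi> (\<pi> x))" if "x \<in> V" for x
  proof -
    have "permutation \<sigma>" using \<sigma> finV permutation_permutes by blast
    then obtain m where m: "\<sigma> ^^ m = id" "m > 0" by (rule permutation_is_nilpotent)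
    obtain m' where m': "m = Suc m'" using m(2) by (cases m) auto
    have "\<sigma> ((\<sigma> ^^ m') x) = x" using m(1) unfolding m' by (metis comp_apply funpow.simps(2) id_apply)
    moreover have "\<sigma> (\<pi> (\<pi> x)) = x" by (simp add: \<sigma>_def \<pi>inv)
    ultimately have "(\<sigma> ^^ m') x = \<pi> (\<pi> x)" using permutes_inj[OF \<sigma>] by (metis injD)
    then show ?thesis using reach_\<sigma>[OF that, of m'] by simp
  qed
  have reach_\<pi>\<pi>': "reach (\<pi> (\<pi> x)) x" if "x \<in> V" for x
    using R_reach[OF R_\<sigma>[of "\<pi> (\<pi> x)"]] that by (simp add: \<sigma>_def \<pi>inv \<pi>V)
  have reach_V: "x \<in> V \<Longrightarrow> y \<in> V" if "reach x y" for x y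
    using that unfolding reach_def by (induction rule: rtrancl_induct) (auto simp: R_def)
  have reach_dual: "reach (\<pi> y) (\<pi> x)" if "reach x y" for x y
    using that unfolding reach_def
  proof (induction rule: rtrancl_induct)
    case (step y z)
    have y: "inv_into UNIV \<pi> y \<in> V" using step(2) by (simp add: R_def invV)
    have "reach (\<pi> z) (inv_into UNIV \<pi> y)" using R_reach[OF R_dual[OF step(2)]] .
    moreover have "reach (inv_into UNIV \<pi> y) (\<pi> y)" using reach_\<pi>\<pi>[OF y] by (simp add: \<pi>inv)
    ultimately have "reach (\<pi> z) (\<pi> y)" by (rule reach_trans)
    then show ?case using step(3) unfolding reach_def by (rule rtrancl_trans)
  qed simp
  have reach_dual_iff: "reach (\<pi> y) (\<pi> x) \<longleftrightarrow> reach x y" if "x \<in> V" "y \<in> V" for x y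
  proof
    assume "reach (\<pi> y) (\<pi> x)"
    then have "reach (\<pi> (\<pi> x)) (\<pi> (\<pi> y))" by (rule reach_dual)
    then show "reach x y" using reach_\<pi>\<pi>[OF that(1)] reach_\<pi>\<pi>'[OF that(2)] reach_trans by blast
  qed (rule reach_dual)

  \<comment> \<open>Strongly connected classes, their duals and their heights\<close>
  define cls where "cls = (\<lambda>x. {y \<in> V. reach x y \<and> reach y x})"
  \<comment> \<open>Either count alone is monotone along reachability; their difference is moreover
    odd under \<open>\<pi>\<close>, which exchanges the two. Sorting by it is thus compatible with
    complementation.\<close>
  define h where "h = (\<lambda>x. int (card {y \<in> V. reach x y}) - int (card {y \<in> V. reach y x}))"
  have cls_self: "x \<in> cls x" if "x \<in> V" for x using that reach_refl by (simp add: cls_def)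
  have cls_eq: "cls x = cls y" if "y \<in> cls x" for x y
    using that reach_trans unfolding cls_def by blast
  have cls_dual: "cls (\<pi> x) = \<pi> ` cls x" if x: "x \<in> V" for x
  proof
    show "\<pi> ` cls x \<subseteq> cls (\<pi> x)" using reach_dual by (auto simp: cls_def \<pi>V)
    show "cls (\<pi> x) \<subseteq> \<pi> ` cls x"
    proof
      fix y assume y: "y \<in> cls (\<pi> x)"
      define z where "z = inv_into UNIV \<pi> y"
      have "y = \<pi> z" "z \<in> V" using y by (auto simp: z_def \<pi>inv invV cls_def)
      then show "y \<in> \<pi> ` cls x" using y x reach_dual_iff by (auto simp: cls_def)
    qed
  qed
  have h_dual: "h (\<pi> x) = - h x" if x: "x \<in> V" for x
  proof -
    have "{y \<in> V. reach (\<pi> x) y} = \<pi> ` {y \<in> V. reach y x}" "{y \<in> V. reach y (\<pi> x)} = \<pi> ` {y \<in> V. reach x y}"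
    proof -
      have "y \<in> \<pi> ` {y \<in> V. P y} \<longleftrightarrow> y \<in> V \<and> P (inv_into UNIV \<pi> y)" for y P
        by (metis (mono_tags, lifting) \<pi>inv imageE image_eqI invV mem_Collect_eq)
      note im = this
      have "reach (\<pi> x) y \<longleftrightarrow> reach (inv_into UNIV \<pi> y) x" "reach y (\<pi> x) \<longleftrightarrow> reach x (inv_into UNIV \<pi> y)" if "y \<in> V" for y
        using reach_dual_iff[of "inv_into UNIV \<pi> y" x] reach_dual_iff[of x "inv_into UNIV \<pi> y"] x that by (simp_all add: \<pi>inv invV)
      then show "{y \<in> V. reach (\<pi> x) y} = \<pi> ` {y \<in> V. reach y x}" "{y \<in> V. reach y (\<pi> x)} = \<pi> ` {y \<in> V. reach x y}"
        unfolding set_eq_iff im by auto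
    qed
    then show ?thesis unfolding h_def using card_image[OF inj_on_subset[OF inj\<pi> subset_UNIV]] by simp
  qed
  have h_less: "h y < h x" if "reach x y" "\<not> reach y x" "x \<in> V" for x y
  proof -
    have "{z \<in> V. reach y z} \<subset> {z \<in> V. reach x z}" using that reach_trans reach_refl by blast
    then have "card {z \<in> V. reach y z} < card {z \<in> V. reach x z}" using finV by (intro psubset_card_mono) auto
    moreover have "card {z \<in> V. reach z x} \<le> card {z \<in> V. reach z y}"
      using that reach_trans finV by (intro card_mono) auto
    ultimately show ?thesis by (simp add: h_def)
  qed
  have h_cls: "h y = h x" if "y \<in> cls x" for x y
  proof -
    have "{z \<in> V. reach y z} = {z \<in> V. reach x z}" "{z \<in> V. reach z y} = {z \<in> V. reach z x}"
      using that reach_trans unfolding cls_def by blast+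
    then show ?thesis by (simp add: h_def)
  qed

  define CC where "CC = cls ` V"
  define H where "H = (\<lambda>X. h (Min X))"
  have finCC: "finite CC" using finV by (simp add: CC_def)
  have CC_elem: "X = cls x" "x \<in> V" if "X \<in> CC" "x \<in> X" for X x
    using that cls_eq by (auto simp: CC_def cls_def)
  have CC_ne: "X \<noteq> {}" if "X \<in> CC" for X using that cls_self by (auto simp: CC_def)
  have CC_sub: "X \<subseteq> V" if "X \<in> CC" for X using that by (auto simp: CC_def cls_def)
  have CC_fin: "finite X" if "X \<in> CC" for X using finite_subset[OF CC_sub[OF that] finV] .
  have CC_disj: "X \<inter> Y = {}" if "X \<in> CC" "Y \<in> CC" "X \<noteq> Y" for X Y using CC_elem that by blast
  have CC_cover: "\<Union> CC = V" using CC_sub cls_self by (auto simp: CC_def)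
  have H_eq: "H X = h x" if "X \<in> CC" "x \<in> X" for X x
  proof -
    have "Min X \<in> X" using CC_ne[OF that(1)] CC_fin[OF that(1)] by (intro Min_in)
    then show ?thesis unfolding H_def using h_cls CC_elem[OF that] by blast
  qed
  define dual where "dual = (\<lambda>X. \<pi> ` X)"
  have dual_CC: "dual X \<in> CC" if X: "X \<in> CC" for X
  proof -
    obtain x where x: "x \<in> V" "X = cls x" using X by (auto simp: CC_def)
    have "dual X = cls (\<pi> x)" using cls_dual[OF x(1)] x(2) by (simp add: dual_def)
    then show ?thesis using x(1) \<pi>V by (simp add: CC_def)
  qed
  have dual_dual: "dual (dual X) = X" if X: "X \<in> CC" for X
  proof -
    obtain x where x: "x \<in> V" "X = cls x" using X by (auto simp: CC_def)
    have "dual (dual X) = cls (\<pi> (\<pi> x))" using cls_dual x \<pi>V by (simp add: dual_def)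
    also have "\<dots> = cls x" using reach_\<pi>\<pi> reach_\<pi>\<pi>' x \<pi>V by (intro cls_eq[symmetric]) (simp add: cls_def)
    finally show ?thesis using x by simp
  qed
  have H_dual: "H (dual X) = - H X" if X: "X \<in> CC" for X
  proof -
    obtain x where x: "x \<in> X" using CC_ne[OF X] by blast
    then have "\<pi> x \<in> dual X" by (simp add: dual_def)
    then show ?thesis using H_eq[OF dual_CC[OF X]] H_eq[OF X x] h_dual[of x] CC_sub[OF X] x by auto
  qed
  have card_dual: "card (dual X) = card X" for X
    unfolding dual_def using card_image[OF inj_on_subset[OF inj\<pi> subset_UNIV]] .
  have edge_H: "H Y < H X" if XY: "X \<in> CC" "Y \<in> CC" "X \<noteq> Y" and e: "a \<in> X" "b \<in> dual Y" "S a b \<noteq> 0" for X Y a b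
  proof -
    obtain y where y: "y \<in> Y" "b = \<pi> y" using e(2) by (auto simp: dual_def)
    have V: "a \<in> V" "y \<in> V" using CC_sub XY e y by blast+
    then have "(a, y) \<in> R" using e(3) nonneg[of a "\<pi> y"] y \<pi>V by (auto simp: R_def)
    then have "reach a y" by (rule R_reach)
    moreover have "\<not> reach y a"
    proof
      assume "reach y a"
      then have "y \<in> cls a" using \<open>reach a y\<close> V by (simp add: cls_def)
      then show False using CC_elem(1)[OF XY(1) e(1)] XY y CC_disj by blast
    qed
    ultimately show ?thesis using h_less[of a y] V H_eq[OF XY(1) e(1)] H_eq[OF XY(2) y(1)] by simp
  qed
  \<comment> \<open>A zero submatrix of this size would, because of the loops, split the class into
    two nonempty parts with no edge from the first to the second.\<close>
  have strong: "\<exists>a\<in>I. \<exists>b\<in>J. S a b \<noteq> 0"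
    if X: "X \<in> CC" and I: "I \<subseteq> X" "I \<noteq> {}" and J: "J \<subseteq> dual X" "J \<noteq> {}" and card: "card X \<le> card I + card J" for X I J
  proof (rule ccontr)
    assume neg: "\<not> ?thesis"
    define J' where "J' = {y \<in> X. \<pi> y \<in> J}"
    have JJ: "J = \<pi> ` J'" using J(1) by (auto simp: J'_def dual_def)
    have cJ: "card J = card J'" unfolding JJ using card_image[OF inj_on_subset[OF inj\<pi> subset_UNIV]] .
    have no_edge: "(x, y) \<notin> R" if "x \<in> I" "y \<in> J'" for x y
      using neg that by (auto simp: R_def J'_def)
    have disj: "I \<inter> J' = {}" using no_edge R_loop I(1) CC_sub[OF X] by blast
    have "I \<union> J' = X"
    proof (rule card_subset_eq)
      show "finite X" using CC_fin[OF X] .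
      show sub: "I \<union> J' \<subseteq> X" using I by (auto simp: J'_def)
      have "finite I" "finite J'" using sub finite_subset[OF _ CC_fin[OF X]] by auto
      then have "card (I \<union> J') = card I + card J'" using disj by (rule card_Un_disjoint)
      then show "card (I \<union> J') = card X" using card cJ card_mono[OF CC_fin[OF X] sub] by simp
    qed
    obtain x where x: "x \<in> I" using I(2) by blast
    obtain y where y: "y \<in> J'" using J(2) JJ by blast
    have xX: "X = cls x" "x \<in> V" using CC_elem[OF X] x I(1) by blast+
    have "y \<in> cls x" using y xX(1) by (auto simp: J'_def)
    then have xy: "reach x y" "reach y x" by (auto simp: cls_def)
    \<comment> \<open>The condition \<open>reach z y\<close> keeps the path inside the class, where
      it has no edge leading out of \<open>I\<close>.\<close>
    have "reach z y \<longrightarrow> z \<in> I" if "reach x z" for z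
      using that unfolding reach_def
    proof (induction rule: rtrancl_induct)
      case base
      then show ?case using x by simp
    next
      case (step z w)
      show ?case
      proof
        assume wy: "(w, y) \<in> R\<^sup>*"
        then have "(z, y) \<in> R\<^sup>*" using step(2) by (rule converse_rtrancl_into_rtrancl[rotated])
        then have zI: "z \<in> I" using step(3) by blast
        have "reach x w" using step(1,2) unfolding reach_def by (rule rtrancl_into_rtrancl)
        moreover have "reach w x" using wy xy(2) reach_trans unfolding reach_def by blast
        moreover have "w \<in> V" using step(2) by (simp add: R_def)
        ultimately have "w \<in> X" unfolding xX(1) by (simp add: cls_def)
        then show "w \<in> I" using no_edge[OF zI] step(2) \<open>I \<union> J' = X\<close> by blast
      qed
    qed
    then have "y \<in> I" using xy(1) reach_refl by blast
    then show False using disj y by blast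
  qed

  \<comment> \<open>One class from each pair of distinct dual classes: the one of positive height
    or, at height 0, the one with the smaller minimum.\<close>
  define TT where "TT = {X \<in> CC. H X > 0 \<or> H X = 0 \<and> Min X < Min (dual X)}"
  define SS where "SS = {X \<in> CC. dual X = X}"
  define L where "L = card SS"
  define M where "M = card TT"
  have fin: "finite SS" "finite TT" using finCC by (auto simp: SS_def TT_def)
  have TT_dual: "dual X \<notin> TT" if "X \<in> TT" for X
    using that H_dual[of X] dual_dual[of X] by (auto simp: TT_def)
  have SS_H: "H X = 0" if "X \<in> SS" for X using that H_dual[of X] by (auto simp: SS_def)
  have SS_TT: "SS \<inter> TT = {}"
  proof -
    have False if "X \<in> SS" "X \<in> TT" for X using TT_dual[OF that(2)] that unfolding SS_def by simp
    then show ?thesis by blast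
  qed
  have CC_cases: "X \<in> TT \<or> X \<in> SS \<or> dual X \<in> TT" if X: "X \<in> CC" for X
  proof (rule ccontr)
    assume neg: "\<not> ?thesis"
    then have nX: "\<not> H X > 0" "\<not> (H X = 0 \<and> Min X < Min (dual X))" "dual X \<noteq> X"
      and nD: "\<not> H (dual X) > 0" "\<not> (H (dual X) = 0 \<and> Min (dual X) < Min (dual (dual X)))"
      using X dual_CC[OF X] unfolding TT_def SS_def by blast+
    have "H X = 0" using nX(1) nD(1) H_dual[OF X] by linarith
    then have "Min (dual X) = Min X" using nX(2) nD(2) H_dual[OF X] dual_dual[OF X] by simp
    moreover have "Min X \<in> X" "Min (dual X) \<in> dual X" using CC_ne CC_fin X dual_CC by (simp_all add: Min_in)
    ultimately show False using CC_disj[OF X dual_CC[OF X]] nX(3) by auto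
  qed
  \<comment> \<open>The sign turns the increasing order of the enumeration into decreasing
    heights.\<close>
  obtain t where t: "bij_betw t {..<M} TT" "\<And>i j. i \<le> j \<Longrightarrow> j < M \<Longrightarrow> - H (t i) \<le> - H (t j)"
    using sorted_enumeration[OF fin(2), of "\<lambda>X. - H X"] unfolding M_def by blast
  obtain s where s: "bij_betw s {..<L} SS"
    using ex_bij_betw_nat_finite[OF fin(1)] unfolding L_def lessThan_atLeast0 by blast
  let ?N = "L + 2 * M"
  \<comment> \<open>As \<open>t\<close> counts from 0, the class at position
    \<open>?N + 1 - i\<close> of the upper part is \<open>t (?N - i)\<close>, and its dual goes to
    position \<open>i\<close>.\<close>
  define C where "C = (\<lambda>i. if i \<le> M then t (i - 1) else if i \<le> M + L then s (i - M - 1) else dual (t (?N - i)))"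
  have tTT: "t i \<in> TT" if "i < M" for i using bij_betw_apply[OF t(1)] that by simp
  have sSS: "s i \<in> SS" if "i < L" for i using bij_betw_apply[OF s] that by simp
  have C_top: "C i \<in> TT" if "i \<in> {1..?N}" "i \<le> M" for i using that tTT[of "i - 1"] by (simp add: C_def)
  have C_mid: "C i \<in> SS" if "M < i" "i \<le> M + L" for i using that sSS[of "i - M - 1"] by (simp add: C_def)
  have C_bot: "dual (C i) \<in> TT" if "i \<in> {1..?N}" "M + L < i" for i
  proof -
    have "t (?N - i) \<in> TT" using that by (intro tTT) auto
    moreover have "t (?N - i) \<in> CC" using calculation by (simp add: TT_def)
    ultimately show ?thesis using that dual_dual by (simp add: C_def)
  qed
  have C_CC: "C i \<in> CC" if i: "i \<in> {1..?N}" for i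
  proof (cases "i \<le> M + L")
    case True
    then show ?thesis using C_top[OF i] C_mid[of i] by (cases "i \<le> M") (auto simp: TT_def SS_def)
  next
    case False
    then have "t (?N - i) \<in> CC" using tTT[of "?N - i"] i by (auto simp: TT_def)
    then show ?thesis using False dual_CC by (simp add: C_def)
  qed
  have C_hat: "C (compl_index L M i) = dual (C i)" if i: "i \<in> {1..?N}" for i
  proof -
    consider "i \<le> M" | "M < i" "i \<le> M + L" | "M + L < i" by linarith
    then show ?thesis
    proof cases
      case 1
      then have hat: "compl_index L M i = Suc ?N - i" "\<not> Suc ?N - i \<le> M + L" using i by (auto simp: compl_index_def)
      have "?N - (Suc ?N - i) = i - 1" using i by auto
      then show ?thesis using 1 hat unfolding C_def by auto
    next
      case 2
      then have "compl_index L M i = i" by (simp add: compl_index_def)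
      then show ?thesis using C_mid[OF 2] by (simp add: SS_def)
    next
      case 3
      then have hat: "compl_index L M i = Suc ?N - i" "Suc ?N - i \<le> M" using i by (auto simp: compl_index_def)
      have tCC: "t (?N - i) \<in> CC" using tTT[of "?N - i"] i 3 by (auto simp: TT_def)
      have "Suc ?N - i - 1 = ?N - i" by simp
      then have "C (compl_index L M i) = t (?N - i)" using hat unfolding C_def by simp
      moreover have "C i = dual (t (?N - i))" using 3 unfolding C_def by simp
      ultimately show ?thesis using dual_dual[OF tCC] by simp
    qed
  qed
  have injt: "t i = t j \<Longrightarrow> i = j" if "i < M" "j < M" for i j
    using bij_betw_imp_inj_on[OF t(1)] that by (auto dest: inj_onD)
  have injs: "s i = s j \<Longrightarrow> i = j" if "i < L" "j < L" for i j
    using bij_betw_imp_inj_on[OF s] that by (auto dest: inj_onD)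
  have C_inj: "i = j" if i: "i \<in> {1..?N}" and j: "j \<in> {1..?N}" and eq: "C i = C j" for i j
  proof -
    have top_iff: "C i \<in> TT \<longleftrightarrow> i \<le> M" if i: "i \<in> {1..?N}" for i
    proof -
      have "C i \<notin> TT" if "M < i" "i \<le> M + L" using C_mid[OF that] SS_TT by blast
      moreover have "C i \<notin> TT" if "M + L < i" using C_bot[OF i that] TT_dual by blast
      ultimately show ?thesis using C_top[OF i] by (meson linorder_not_le)
    qed
    have mid_iff: "C i \<in> SS \<longleftrightarrow> M < i \<and> i \<le> M + L" if i: "i \<in> {1..?N}" for i
    proof -
      have "C i \<notin> SS" if "M + L < i"
      proof
        assume "C i \<in> SS"
        then have "dual (C i) = C i" by (simp add: SS_def)
        then show False using C_bot[OF i that] TT_dual[of "C i"] by simp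
      qed
      moreover have "C i \<notin> SS" if "i \<le> M" using C_top[OF i that] SS_TT by blast
      ultimately show ?thesis using C_mid[of i] by (meson linorder_not_le)
    qed
    have "i \<le> M \<longleftrightarrow> j \<le> M" "M < i \<and> i \<le> M + L \<longleftrightarrow> M < j \<and> j \<le> M + L"
      using top_iff[OF i] top_iff[OF j] mid_iff[OF i] mid_iff[OF j] unfolding eq by blast+
    then consider "i \<le> M" "j \<le> M" | "M < i" "i \<le> M + L" "M < j" "j \<le> M + L" | "M + L < i" "M + L < j"
      by linarith
    then show ?thesis
    proof cases
      case 1
      then have "t (i - 1) = t (j - 1)" using eq by (simp add: C_def)
      then have "i - 1 = j - 1" using 1 i j by (intro injt) auto
      then show ?thesis using i j by auto
    next
      case 2
      then have "s (i - M - 1) = s (j - M - 1)" using eq by (simp add: C_def)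
      then have "i - M - 1 = j - M - 1" using 2 by (intro injs) auto
      then show ?thesis using 2 by auto
    next
      case 3
      then have "dual (dual (t (?N - i))) = dual (dual (t (?N - j)))" using eq by (simp add: C_def)
      moreover have "t (?N - i) \<in> CC" "t (?N - j) \<in> CC" using tTT[of "?N - i"] tTT[of "?N - j"] i j 3 by (auto simp: TT_def)
      ultimately have "t (?N - i) = t (?N - j)" using dual_dual by simp
      then have "?N - i = ?N - j" using 3 i j by (intro injt) auto
      then show ?thesis using i j by auto
    qed
  qed
  have C_surj: "\<exists>i\<in>{1..?N}. C i = X" if X: "X \<in> CC" for X
  proof -
    have top: "\<exists>i\<in>{1..?N}. i \<le> M \<and> C i = Y" if Y: "Y \<in> TT" for Y
    proof -
      obtain i where "i < M" "t i = Y" using Y bij_betw_imp_surj_on[OF t(1)] by blast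
      then show ?thesis by (intro bexI[of _ "Suc i"]) (auto simp: C_def)
    qed
    from CC_cases[OF X] show ?thesis
    proof (elim disjE)
      assume "X \<in> SS"
      then obtain i where "i < L" "s i = X" using bij_betw_imp_surj_on[OF s] by blast
      then show ?thesis by (intro bexI[of _ "M + Suc i"]) (auto simp: C_def)
    next
      assume "dual X \<in> TT"
      then obtain i where "i \<in> {1..?N}" "C i = dual X" using top by blast
      then show ?thesis using C_hat[of i] compl_index_in[of i] dual_dual[OF X] by auto
    qed (use top in blast)
  qed
  have H_top: "H (C i) \<ge> 0" if "i \<in> {1..?N}" "i \<le> M" for i using C_top[OF that] by (auto simp: TT_def)
  have H_mid: "H (C i) = 0" if "M < i" "i \<le> M + L" for i using SS_H[OF C_mid[OF that]] .
  have H_hat: "H (C (compl_index L M i)) = - H (C i)" if "i \<in> {1..?N}" for i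
    using C_hat[OF that] H_dual[OF C_CC[OF that]] by simp
  have H_top_mono: "H (C j) \<le> H (C i)" if "i \<in> {1..?N}" "i \<le> j" "j \<le> M" for i j
    using t(2)[of "i - 1" "j - 1"] that by (simp add: C_def)
  have H_bot: "H (C i) \<le> 0" if i: "i \<in> {1..?N}" "M + L < i" for i
    using H_hat[OF i(1)] H_top[OF compl_index_in[OF i(1)]] i by (auto simp: compl_index_def)
  have H_mono: "H (C j) \<le> H (C i)" if i: "i \<in> {1..?N}" and j: "j \<in> {1..?N}" and ij: "i \<le> j" for i j
  proof -
    consider "j \<le> M" | "i \<le> M" "M < j" | "M < i" "i \<le> M + L" | "M + L < i" using ij by linarith
    then show ?thesis
    proof cases
      case 1
      then show ?thesis using H_top_mono i ij by blast
    next
      case 2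
      have "H (C j) \<le> 0" using H_mid[of j] H_bot[OF j] 2 by (cases "j \<le> M + L") auto
      then show ?thesis using H_top[OF i 2(1)] by simp
    next
      case 3
      have "H (C j) \<le> 0" using H_mid[of j] H_bot[OF j] 3 ij by (cases "j \<le> M + L") auto
      then show ?thesis using H_mid[OF 3] by simp
    next
      case 4
      have hi: "compl_index L M i = Suc ?N - i" "compl_index L M j = Suc ?N - j" using 4 ij by (auto simp: compl_index_def)
      have "H (C (Suc ?N - i)) \<le> H (C (Suc ?N - j))" by (rule H_top_mono) (use 4 i j ij in auto)
      then show ?thesis using H_hat[OF i] H_hat[OF j] hi by simp
    qed
  qed
  \<comment> \<open>Edges between different classes strictly lower the height, which is
    nonincreasing along the enumeration. All central classes have height 0, so there are no edges
    among them.\<close>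
  have edge_imp: "i < j \<and> \<not> (M < i \<and> j \<le> M + L)"
    if i: "i \<in> {1..?N}" and j: "j \<in> {1..?N}" and ij: "i \<noteq> j" and e: "\<exists>a\<in>C i. \<exists>b\<in>C (compl_index L M j). S a b \<noteq> 0" for i j
  proof -
    have "C i \<noteq> C j" using C_inj[OF i j] ij by blast
    then have lt: "H (C j) < H (C i)" using e edge_H[OF C_CC[OF i] C_CC[OF j]] unfolding C_hat[OF j] by blast
    then have "i < j" using H_mono[OF j i] by (meson linorder_not_le)
    moreover have "\<not> (M < i \<and> j \<le> M + L)" using lt H_mid[of i] H_mid[of j] \<open>i < j\<close> by auto
    ultimately show ?thesis by blast
  qed
  have bs: "block_structure n S L M C"
  proof
    show "0 \<le> S a b" "S a b = S b a" if "a \<in> {1..n}" "b \<in> {1..n}" for a b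
      using nonneg sym that unfolding V_def by blast+
    have "1 \<in> V" using n by (simp add: V_def)
    then have "cls 1 \<in> CC" by (simp add: CC_def)
    then show "1 \<le> L + 2 * M" using C_surj by fastforce
    show "C i \<inter> C j = {}" if "i \<in> {1..?N}" "j \<in> {1..?N}" "i \<noteq> j" for i j
      using C_inj[OF that(1,2)] that(3) CC_disj C_CC that by blast
    show "(\<Union>i\<in>{1..?N}. C i) = {1..n}"
    proof -
      have "C ` {1..?N} = CC" using C_CC C_surj by blast
      then show ?thesis using CC_cover by (simp add: V_def)
    qed
    show "C i \<noteq> {}" if "i \<in> {1..?N}" for i using CC_ne[OF C_CC[OF that]] .
    show "card (C (compl_index L M i)) = card (C i)" if "i \<in> {1..?N}" for i
      unfolding C_hat[OF that] by (rule card_dual)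
    show "\<exists>a\<in>I. \<exists>b\<in>J. S a b \<noteq> 0"
      if "i \<in> {1..?N}" "I \<subseteq> C i" "J \<subseteq> C (compl_index L M i)" "I \<noteq> {}" "J \<noteq> {}" "card (C i) \<le> card I + card J" for i I J
      using strong[OF C_CC[OF that(1)] that(2,4) _ that(5,6)] that(3) unfolding C_hat[OF that(1)] by blast
    show "i < j" if "i \<in> {1..?N}" "j \<in> {1..?N}" "i \<noteq> j" "\<exists>a\<in>C i. \<exists>b\<in>C (compl_index L M j). S a b \<noteq> 0" for i j
      using edge_imp[OF that] by blast
  qed
  have "\<not> (M < i \<and> j \<le> M + L)" if "block_structure.edge S L M C i j" for i j
    using that edge_imp[of i j] unfolding block_structure.edge_def[OF bs] by blast
  from normal_form_of_block_structure[OF S bs this] show ?thesis by blast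
qed

section \<open>Stieltjes inversion\<close>

lemma Im_stieltjes_kernel:
  "Im (1 / (complex_of_real x - (of_real \<tau> + \<i> * of_real \<eta>))) = \<eta> / ((x - \<tau>)\<^sup>2 + \<eta>\<^sup>2)"
  by (simp add: Im_divide)

lemma norm_stieltjes_kernel_le:
  assumes "Im z > 0"
  shows "norm (1 / (complex_of_real x - z)) \<le> 1 / Im z"
proof -
  have "Im z \<le> norm (complex_of_real x - z)" using abs_Im_le_cmod[of "complex_of_real x - z"] assms by simp
  then show ?thesis using assms by (simp add: norm_divide frac_le)
qed

lemma Im_stieltjes:
  assumes "real_distribution \<mu>" "\<eta> > 0"
  shows "Im (stieltjes \<mu> (of_real \<tau> + \<i> * of_real \<eta>)) = (\<integral>x. \<eta> / ((x - \<tau>)\<^sup>2 + \<eta>\<^sup>2) \<partial>\<mu>)"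
proof -
  interpret real_distribution \<mu> by fact
  let ?z = "complex_of_real \<tau> + \<i> * of_real \<eta>"
  have "integrable \<mu> (\<lambda>x. 1 / (complex_of_real x - ?z))"
  proof (rule integrable_const_bound[of _ "1 / \<eta>"])
    show "AE x in \<mu>. norm (1 / (complex_of_real x - ?z)) \<le> 1 / \<eta>"
      using norm_stieltjes_kernel_le[of ?z] assms(2) by simp
  qed measurable
  then have "(\<integral>x. Im (1 / (complex_of_real x - ?z)) \<partial>\<mu>) = Im (\<integral>x. 1 / (complex_of_real x - ?z) \<partial>\<mu>)"
    by (rule integral_Im)
  then show ?thesis unfolding stieltjes_def Im_stieltjes_kernel by simp
qed

lemma arctan_scaled_derivative:
  assumes "\<eta> > 0"
  shows "((\<lambda>x. c * arctan ((x - \<tau>) / \<eta>)) has_real_derivative c * (\<eta> / ((x - \<tau>)\<^sup>2 + \<eta>\<^sup>2))) (at x)"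
proof -
  have pos: "(x - \<tau>)\<^sup>2 + \<eta>\<^sup>2 > 0" using assms by (simp add: add_nonneg_pos)
  have "((\<lambda>x. c * arctan ((x - \<tau>) / \<eta>)) has_real_derivative c * (inverse (1 + ((x - \<tau>) / \<eta>)\<^sup>2) * (1 / \<eta>))) (at x)"
    by (auto intro!: derivative_eq_intros simp: divide_inverse)
  moreover have "inverse (1 + ((x - \<tau>) / \<eta>)\<^sup>2) * (1 / \<eta>) = \<eta> / ((x - \<tau>)\<^sup>2 + \<eta>\<^sup>2)"
    using assms pos by (simp add: field_simps power2_eq_square)
  ultimately show ?thesis by (simp only:)
qed

lemma nn_integral_poisson_kernel:
  assumes "\<eta> > 0" "c \<ge> 0" "\<delta> \<ge> 0"
  shows "(\<integral>\<^sup>+x. ennreal (c * (\<eta> / ((x - \<tau>)\<^sup>2 + \<eta>\<^sup>2))) * indicator {\<tau> - \<delta>..\<tau> + \<delta>} x \<partial>lborel) = ennreal (c * (2 * arctan (\<delta> / \<eta>)))"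
proof -
  have "(\<integral>\<^sup>+x. ennreal (c * (\<eta> / ((x - \<tau>)\<^sup>2 + \<eta>\<^sup>2))) * indicator {\<tau> - \<delta>..\<tau> + \<delta>} x \<partial>lborel)
      = ennreal (c * arctan ((\<tau> + \<delta> - \<tau>) / \<eta>) - c * arctan ((\<tau> - \<delta> - \<tau>) / \<eta>))"
  proof (rule nn_integral_FTC_Icc)
    show "((\<lambda>x. c * arctan ((x - \<tau>) / \<eta>)) has_real_derivative c * (\<eta> / ((x - \<tau>)\<^sup>2 + \<eta>\<^sup>2))) (at x)" for x
      using assms(1) by (rule arctan_scaled_derivative)
    show "0 \<le> c * (\<eta> / ((x - \<tau>)\<^sup>2 + \<eta>\<^sup>2))" for x using assms by simp
  qed (use assms in auto)
  then show ?thesis by (simp add: arctan_minus algebra_simps)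
qed

text \<open>The condition \<open>f 0 = 0\<close> removes a possible atom of \<mu> at the origin,
  where nothing is assumed about the measure.\<close>

lemma nn_integral_density_off_zero:
  fixes \<rho> :: "real \<Rightarrow> real"
  assumes \<mu>: "real_distribution \<mu>" and \<rho>: "continuous_on (- {0}) \<rho>" "\<And>x. x \<noteq> 0 \<Longrightarrow> 0 \<le> \<rho> x"
    and dens: "restrict_space \<mu> (- {0}) = density (restrict_space lborel (- {0})) (\<lambda>x. ennreal (\<rho> x))"
    and f: "f \<in> borel_measurable borel" "f 0 = 0"
  shows "(\<integral>\<^sup>+x. f x \<partial>\<mu>) = (\<integral>\<^sup>+x. ennreal (\<rho> x) * f x \<partial>lborel)"
proof -
  interpret real_distribution \<mu> by fact
  have f0: "f x * indicator (- {0}) x = f x" for x using f(2) by (auto simp: indicator_def)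
  have sets: "sets (restrict_space lborel (- {0::real})) = sets (restrict_space borel (- {0}))"
    by (intro sets_restrict_space_cong) simp
  have "\<rho> \<in> borel_measurable (restrict_space borel (- {0}))"
    using \<rho>(1) by (rule borel_measurable_continuous_on_restrict)
  then have m\<rho>: "\<rho> \<in> borel_measurable (restrict_space lborel (- {0}))"
    using measurable_cong_sets[OF sets refl] by blast
  have mf: "f \<in> borel_measurable (restrict_space lborel (- {0}))"
    using f(1) by (intro measurable_restrict_space1) simp
  have "(\<integral>\<^sup>+x. f x \<partial>\<mu>) = (\<integral>\<^sup>+x. f x \<partial>restrict_space \<mu> (- {0}))"
    by (subst nn_integral_restrict_space) (auto simp: f0)
  also have "\<dots> = (\<integral>\<^sup>+x. ennreal (\<rho> x) * f x \<partial>restrict_space lborel (- {0}))"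
    unfolding dens using m\<rho> mf by (intro nn_integral_density) auto
  also have "\<dots> = (\<integral>\<^sup>+x. ennreal (\<rho> x) * f x * indicator (- {0}) x \<partial>lborel)"
    by (rule nn_integral_restrict_space) simp
  finally show ?thesis by (simp add: mult.assoc f0)
qed

text \<open>The imaginary part is a Poisson integral. On a small interval around \<tau> that avoids
  0 the measure has the almost constant density \<rho>; outside, the kernel is at most
  \<open>\<eta> / \<delta>\<^sup>2\<close>, whatever the measure does at 0.\<close>

lemma stieltjes_inversion_off_zero:
  fixes \<rho> :: "real \<Rightarrow> real"
  assumes \<mu>: "real_distribution \<mu>" and \<rho>: "continuous_on (- {0}) \<rho>" "\<And>x. x \<noteq> 0 \<Longrightarrow> 0 \<le> \<rho> x"
    and dens: "restrict_space \<mu> (- {0}) = density (restrict_space lborel (- {0})) (\<lambda>x. ennreal (\<rho> x))"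
    and \<tau>: "\<tau> \<noteq> 0"
  shows "((\<lambda>\<eta>. Im (stieltjes \<mu> (of_real \<tau> + \<i> * of_real \<eta>))) \<longlongrightarrow> pi * \<rho> \<tau>) (at_right 0)"
proof (rule tendstoI)
  fix e :: real assume e: "e > 0"
  interpret real_distribution \<mu> by fact
  \<comment> \<open>The kernel has total mass pi, so an error \<epsilon> in the density costs half
    of \<open>e\<close>.\<close>
  define \<epsilon> where "\<epsilon> = e / (2 * pi)"
  have \<epsilon>: "\<epsilon> > 0" "pi * \<epsilon> = e / 2" using e by (simp_all add: \<epsilon>_def)
  have "isCont \<rho> \<tau>" using \<rho>(1) \<tau> by (simp add: continuous_on_eq_continuous_at open_Compl)
  then obtain d where d: "d > 0" "\<And>x. \<bar>x - \<tau>\<bar> < d \<Longrightarrow> \<bar>\<rho> x - \<rho> \<tau>\<bar> < \<epsilon>"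
    using \<epsilon>(1) unfolding continuous_at_eps_delta dist_real_def by blast
  define \<delta> where "\<delta> = min d \<bar>\<tau>\<bar> / 2"
  have \<delta>: "\<delta> > 0" "\<delta> < d" "\<delta> < \<bar>\<tau>\<bar>" using d \<tau> by (auto simp: \<delta>_def)
  define B where "B = {\<tau> - \<delta>..\<tau> + \<delta>}"
  have B0: "0 \<notin> B" using \<delta> by (auto simp: B_def)
  have B\<rho>: "\<bar>\<rho> x - \<rho> \<tau>\<bar> < \<epsilon>" if "x \<in> B" for x using that \<delta> by (intro d(2)) (auto simp: B_def)
  define P where "P = (\<lambda>\<eta> x. \<eta> / ((x - \<tau>)\<^sup>2 + \<eta>\<^sup>2))"
  define J where "J = (\<lambda>\<eta>. 2 * arctan (\<delta> / \<eta>))"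
  have bounds: "(\<rho> \<tau> - \<epsilon>) * J \<eta> \<le> (\<integral>x. P \<eta> x \<partial>\<mu>)" "(\<integral>x. P \<eta> x \<partial>\<mu>) \<le> (\<rho> \<tau> + \<epsilon>) * J \<eta> + \<eta> / \<delta>\<^sup>2"
    if \<eta>: "\<eta> > 0" for \<eta>
  proof -
    have J0: "J \<eta> \<ge> 0" using \<delta> \<eta> by (simp add: J_def zero_le_arctan_iff)
    have P0: "P \<eta> x \<ge> 0" for x using \<eta> by (simp add: P_def)
    have Pm: "P \<eta> \<in> borel_measurable borel" unfolding P_def by measurable
    have Pb: "P \<eta> x \<le> 1 / \<eta>" for x
    proof -
      have "P \<eta> x \<le> \<eta> / \<eta>\<^sup>2" unfolding P_def
        using \<eta> by (intro divide_left_mono mult_pos_pos) (auto intro: add_nonneg_pos)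
      then show ?thesis using \<eta> by (simp add: power2_eq_square)
    qed
    have Pi: "integrable \<mu> (P \<eta>)"
      by (rule integrable_const_bound[of _ "1 / \<eta>"]) (use Pb P0 Pm in \<open>auto simp: measurable_cong_sets[OF M_is_borel refl]\<close>)
    have Bm: "B \<in> sets borel" by (simp add: B_def)
    have PBi: "integrable \<mu> (\<lambda>x. P \<eta> x * indicator B x)"
      by (rule integrable_real_mult_indicator) (use Bm Pi in auto)
    define I where "I = (\<integral>x. P \<eta> x * indicator B x \<partial>\<mu>)"
    have "ennreal I = (\<integral>\<^sup>+x. ennreal (P \<eta> x * indicator B x) \<partial>\<mu>)"
      unfolding I_def using PBi P0 by (intro nn_integral_eq_integral[symmetric]) auto
    also have "\<dots> = (\<integral>\<^sup>+x. ennreal (\<rho> x) * ennreal (P \<eta> x * indicator B x) \<partial>lborel)"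
      by (rule nn_integral_density_off_zero[OF \<mu> \<rho> dens]) (use Pm Bm B0 in auto)
    finally have I_eq: "ennreal I = (\<integral>\<^sup>+x. ennreal (\<rho> x) * ennreal (P \<eta> x * indicator B x) \<partial>lborel)" .
    have \<rho>B: "0 \<le> \<rho> x" if "x \<in> B" for x using that B0 by (intro \<rho>(2)) auto
    have I0: "I \<ge> 0" unfolding I_def using P0 by (intro integral_nonneg_AE) auto
    have "ennreal I \<le> (\<integral>\<^sup>+x. ennreal ((\<rho> \<tau> + \<epsilon>) * P \<eta> x) * indicator B x \<partial>lborel)"
      unfolding I_eq
    proof (intro nn_integral_mono)
      fix x
      have "\<rho> x * P \<eta> x \<le> (\<rho> \<tau> + \<epsilon>) * P \<eta> x" if "x \<in> B" using B\<rho>[OF that] P0 by (intro mult_right_mono) auto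
      then show "ennreal (\<rho> x) * ennreal (P \<eta> x * indicator B x) \<le> ennreal ((\<rho> \<tau> + \<epsilon>) * P \<eta> x) * indicator B x"
        using \<rho>B[of x] P0[of x] by (auto simp: indicator_def ennreal_mult[symmetric] intro!: ennreal_leI)
    qed
    also have "\<dots> = ennreal ((\<rho> \<tau> + \<epsilon>) * J \<eta>)"
      unfolding P_def B_def J_def using \<rho>(2)[OF \<tau>] \<epsilon> \<eta> \<delta> by (intro nn_integral_poisson_kernel) auto
    finally have up: "I \<le> (\<rho> \<tau> + \<epsilon>) * J \<eta>"
      using \<rho>(2)[OF \<tau>] \<epsilon> J0 by (subst (asm) ennreal_le_iff) auto
    \<comment> \<open>The maximum keeps the integrand nonnegative, since \<open>ennreal\<close>
      truncates; where it equals 0, the lower bound is trivial.\<close>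
    define c where "c = max 0 (\<rho> \<tau> - \<epsilon>)"
    have "ennreal (c * J \<eta>) = (\<integral>\<^sup>+x. ennreal (c * P \<eta> x) * indicator B x \<partial>lborel)"
      unfolding P_def B_def J_def using \<eta> \<delta> by (intro nn_integral_poisson_kernel[symmetric]) (auto simp: c_def)
    also have "\<dots> \<le> ennreal I"
      unfolding I_eq
    proof (intro nn_integral_mono)
      fix x
      have "c * P \<eta> x \<le> \<rho> x * P \<eta> x" if "x \<in> B" using B\<rho>[OF that] \<rho>B[OF that] P0 by (intro mult_right_mono) (auto simp: c_def)
      then show "ennreal (c * P \<eta> x) * indicator B x \<le> ennreal (\<rho> x) * ennreal (P \<eta> x * indicator B x)"
        using \<rho>B[of x] P0[of x] by (auto simp: indicator_def ennreal_mult[symmetric] intro!: ennreal_leI)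
    qed
    finally have "c * J \<eta> \<le> I" using I0 by (subst (asm) ennreal_le_iff) auto
    moreover have "(\<rho> \<tau> - \<epsilon>) * J \<eta> \<le> c * J \<eta>" using J0 by (intro mult_right_mono) (auto simp: c_def)
    ultimately have low: "(\<rho> \<tau> - \<epsilon>) * J \<eta> \<le> I" by simp
    have "I \<le> (\<integral>x. P \<eta> x \<partial>\<mu>)" unfolding I_def
      by (intro integral_mono PBi Pi) (use P0 in \<open>auto simp: indicator_def\<close>)
    then show "(\<rho> \<tau> - \<epsilon>) * J \<eta> \<le> (\<integral>x. P \<eta> x \<partial>\<mu>)" using low by simp
    have "(\<integral>x. P \<eta> x \<partial>\<mu>) \<le> (\<integral>x. P \<eta> x * indicator B x + \<eta> / \<delta>\<^sup>2 \<partial>\<mu>)"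
    proof (intro integral_mono Pi Bochner_Integration.integrable_add PBi)
      fix x
      have "P \<eta> x \<le> \<eta> / \<delta>\<^sup>2" if "x \<notin> B"
      proof -
        have "\<delta> \<le> \<bar>x - \<tau>\<bar>" using that by (auto simp: B_def)
        then have "\<delta>\<^sup>2 \<le> \<bar>x - \<tau>\<bar>\<^sup>2" using \<delta>(1) by (intro power_mono) auto
        then have "\<delta>\<^sup>2 \<le> (x - \<tau>)\<^sup>2 + \<eta>\<^sup>2" by (simp add: add_increasing2)
        then show ?thesis unfolding P_def using \<eta> \<delta>(1)
          by (intro divide_left_mono mult_pos_pos) (auto intro: add_nonneg_pos)
      qed
      then show "P \<eta> x \<le> P \<eta> x * indicator B x + \<eta> / \<delta>\<^sup>2" using \<eta> by (auto simp: indicator_def)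
    qed auto
    also have "\<dots> = I + \<eta> / \<delta>\<^sup>2" unfolding I_def using PBi prob_space by simp
    finally show "(\<integral>x. P \<eta> x \<partial>\<mu>) \<le> (\<rho> \<tau> + \<epsilon>) * J \<eta> + \<eta> / \<delta>\<^sup>2" using up by simp
  qed
  have Jlim: "(J \<longlongrightarrow> pi) (at_right 0)"
  proof -
    have "filterlim (\<lambda>\<eta>. \<delta> * inverse \<eta>) at_top (at_right 0)"
      by (rule filterlim_tendsto_pos_mult_at_top[OF tendsto_const \<delta>(1) filterlim_inverse_at_top_right])
    then have "((\<lambda>\<eta>. arctan (\<delta> * inverse \<eta>)) \<longlongrightarrow> pi / 2) (at_right 0)"
      by (rule filterlim_compose[OF tendsto_arctan_at_top])
    then have "((\<lambda>\<eta>. 2 * arctan (\<delta> * inverse \<eta>)) \<longlongrightarrow> 2 * (pi / 2)) (at_right 0)"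
      by (rule tendsto_mult[OF tendsto_const])
    moreover have "(\<lambda>\<eta>. 2 * arctan (\<delta> * inverse \<eta>)) = J"
      by (simp only: J_def divide_inverse)
    moreover have "2 * (pi / 2) = pi" by simp
    ultimately show ?thesis by (simp only:)
  qed
  have "((\<lambda>\<eta>. (\<rho> \<tau> - \<epsilon>) * J \<eta>) \<longlongrightarrow> (\<rho> \<tau> - \<epsilon>) * pi) (at_right 0)" by (intro tendsto_intros Jlim)
  moreover have "pi * \<rho> \<tau> - e < (\<rho> \<tau> - \<epsilon>) * pi" using \<epsilon>(2) e by (simp add: algebra_simps)
  ultimately have 1: "\<forall>\<^sub>F \<eta> in at_right 0. pi * \<rho> \<tau> - e < (\<rho> \<tau> - \<epsilon>) * J \<eta>" by (rule order_tendstoD(1))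
  have "((\<lambda>\<eta>. (\<rho> \<tau> + \<epsilon>) * J \<eta> + \<eta> / \<delta>\<^sup>2) \<longlongrightarrow> (\<rho> \<tau> + \<epsilon>) * pi + 0 / \<delta>\<^sup>2) (at_right 0)"
    using \<delta>(1) by (intro tendsto_intros Jlim) auto
  moreover have "(\<rho> \<tau> + \<epsilon>) * pi + 0 / \<delta>\<^sup>2 < pi * \<rho> \<tau> + e" using \<epsilon>(2) e by (simp add: algebra_simps)
  ultimately have 2: "\<forall>\<^sub>F \<eta> in at_right 0. (\<rho> \<tau> + \<epsilon>) * J \<eta> + \<eta> / \<delta>\<^sup>2 < pi * \<rho> \<tau> + e" by (rule order_tendstoD(2))
  show "\<forall>\<^sub>F \<eta> in at_right 0. dist (Im (stieltjes \<mu> (of_real \<tau> + \<i> * of_real \<eta>))) (pi * \<rho> \<tau>) < e"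
    using 1 2 eventually_at_right_less[of 0]
  proof eventually_elim
    case (elim \<eta>)
    then show ?case using bounds[of \<eta>] Im_stieltjes[OF \<mu>, of \<eta> \<tau>]
      unfolding P_def dist_real_def abs_less_iff by auto
  qed
qed

section \<open>The singularity at the origin\<close>

text \<open>The exponents \<open>r\<close> refer to no normal form, and \<open>d / (d + 2)\<close>
  determines \<open>d\<close>. Together with the existence of a normal form this justifies the
  definite description in \<open>ell_lhd\<close>.\<close>

lemma ell_lhd_min_exponent:
  assumes n: "1 \<le> n" and S: "symmetric_matrix n S" "nonneg_matrix n S" and supp: "has_support n S"
    and v: "\<And>l \<eta>. l \<in> {1..n} \<Longrightarrow> \<eta> > 0 \<Longrightarrow> v l \<eta> > 0 \<and> v l \<eta> * (\<eta> + (\<Sum>k\<in>{1..n}. S l k * v k \<eta>)) = 1"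
    and asym: "\<And>l. l \<in> {1..n} \<Longrightarrow> c l > 0 \<and> ((\<lambda>\<eta>. v l \<eta> * \<eta> powr (- r l)) \<longlongrightarrow> c l) (at_right 0)"
  shows "Min (r ` {1..n}) = - (real (ell_lhd n S) / (real (ell_lhd n S) + 2))"
proof -
  have len: "Min (r ` {1..n}) = - (real m / (real m + 2))"
    if p: "p permutes {1..n}" and nf: "normal_form n (\<lambda>i j. S (p i) (p j)) L M k"
      and m: "m = longest_increasing L M (zero_one_mask k (\<lambda>i j. S (p i) (p j)))" for p L M k m
  proof -
    note bs = normal_form_block_structure[OF S p nf]
    show ?thesis
      using block_structure.exponents[OF bs(1) v asym] unfolding m bs(2) Let_def by simp
  qed
  have inj: "m = m'" if "- (real m / (real m + 2)) = - (real m' / (real m' + 2))" for m m'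
  proof -
    have "real m * (real m' + 2) = real m' * (real m + 2)" using that by (simp add: field_simps)
    then show ?thesis by (simp add: algebra_simps)
  qed
  obtain p L M k where nf: "p permutes {1..n}" "normal_form n (\<lambda>i j. S (p i) (p j)) L M k"
    using ex_normal_form[OF n S supp] by blast
  have "\<exists>p L M k. p permutes {1..n} \<and> normal_form n (\<lambda>i j. S (p i) (p j)) L M k \<and>
     ell_lhd n S = longest_increasing L M (zero_one_mask k (\<lambda>i j. S (p i) (p j)))"
    unfolding ell_lhd_def
  proof (rule theI')
    show "\<exists>!m. \<exists>p L M k. p permutes {1..n} \<and> normal_form n (\<lambda>i j. S (p i) (p j)) L M k \<and>
       m = longest_increasing L M (zero_one_mask k (\<lambda>i j. S (p i) (p j)))"
    proof (rule ex_ex1I)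
      show "\<exists>m p L M k. p permutes {1..n} \<and> normal_form n (\<lambda>i j. S (p i) (p j)) L M k \<and>
         m = longest_increasing L M (zero_one_mask k (\<lambda>i j. S (p i) (p j)))"
        using nf by blast
    next
      fix m m'
      assume "\<exists>p L M k. p permutes {1..n} \<and> normal_form n (\<lambda>i j. S (p i) (p j)) L M k \<and>
         m = longest_increasing L M (zero_one_mask k (\<lambda>i j. S (p i) (p j)))"
        and "\<exists>p L M k. p permutes {1..n} \<and> normal_form n (\<lambda>i j. S (p i) (p j)) L M k \<and>
         m' = longest_increasing L M (zero_one_mask k (\<lambda>i j. S (p i) (p j)))"
      then have "Min (r ` {1..n}) = - (real m / (real m + 2))" "Min (r ` {1..n}) = - (real m' / (real m' + 2))"
        using len by blast+
      then show "m = m'" using inj by simp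
    qed
  qed
  then show ?thesis using len by blast
qed

section \<open>Passage to the imaginary and to the real axis\<close>

text \<open>The rotation moves the branch cut to the negative imaginary axis, so that the right-hand
  side extends continuously to the negative reals as well.\<close>

lemma powr_upper_half_plane:
  assumes "Im z > 0"
  shows "z powr a = exp (a * (Ln (- \<i> * z) + \<i> * of_real (pi / 2)))"
proof -
  have z: "z \<noteq> 0" using assms by auto
  have "\<bar>Im (Ln (- \<i> * z))\<bar> < pi / 2" using assms z by (subst Re_Ln_pos_lt) auto
  then have "Ln (\<i> * (- \<i> * z)) = Ln \<i> + Ln (- \<i> * z)"
    using z by (intro Ln_times_simple) auto
  then have "Ln z = Ln (- \<i> * z) + \<i> * of_real (pi / 2)" by simp
  then show ?thesis using z by (simp add: powr_def)
qed

lemma continuous_on_qve_solution: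
  fixes S :: "'i \<Rightarrow> 'i \<Rightarrow> real"
  assumes fin: "finite I" and S: "\<And>l k. l \<in> I \<Longrightarrow> k \<in> I \<Longrightarrow> 0 \<le> S l k"
    and m: "\<And>z l. Im z > 0 \<Longrightarrow> l \<in> I \<Longrightarrow> Im (m l z) > 0 \<and> - 1 / m l z = z + (\<Sum>k\<in>I. of_real (S l k) * m k z)"
    and l: "l \<in> I"
  shows "continuous_on {z. Im z > 0} (m l)"
  unfolding continuous_on_def
proof
  fix z0 :: complex assume "z0 \<in> {z. Im z > 0}"
  define \<eta> where "\<eta> = Im z0 / 2"
  have \<eta>: "\<eta> > 0" using \<open>z0 \<in> _\<close> by (simp add: \<eta>_def)
  define X where "X = (\<Sum>l\<in>I. \<Sum>k\<in>I. S l k) / \<eta>"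
  have "norm (m l z - m l z0) \<le> dist z z0 * (\<eta> + X) / \<eta> ^ 3" if "dist z z0 < \<eta>" for z
  proof -
    have "\<bar>Im z - Im z0\<bar> < \<eta>" using that abs_Im_le_cmod[of "z - z0"] by (simp add: dist_norm)
    then have z: "Im z \<ge> \<eta>" "Im z0 \<ge> \<eta>" unfolding \<eta>_def by linarith+
    then have zp: "Im z > 0" "Im z0 > 0" using \<eta> by linarith+
    show ?thesis unfolding X_def
      by (rule qve_stability[OF fin S, where a = "\<lambda>_. z" and b = "\<lambda>_. z0" and u = "\<lambda>l. m l z" and w = "\<lambda>l. m l z0"])
         (use m[OF zp(1)] m[OF zp(2)] \<eta> z l in \<open>auto simp: dist_norm\<close>)
  qed
  moreover have "\<forall>\<^sub>F z in at z0 within {z. Im z > 0}. dist z z0 < \<eta>"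
    unfolding eventually_at using \<eta> by blast
  ultimately have ev: "\<forall>\<^sub>F z in at z0 within {z. Im z > 0}. norm (m l z - m l z0) \<le> dist z z0 * (\<eta> + X) / \<eta> ^ 3"
    by (auto elim: eventually_mono)
  have "((\<lambda>z. dist z z0 * (\<eta> + X) / \<eta> ^ 3) \<longlongrightarrow> dist z0 z0 * (\<eta> + X) / \<eta> ^ 3) (at z0 within {z. Im z > 0})"
    using \<eta> by (intro tendsto_intros) auto
  then have "((\<lambda>z. m l z - m l z0) \<longlongrightarrow> 0) (at z0 within {z. Im z > 0})"
    using ev by (intro Lim_null_comparison[of "\<lambda>z. m l z - m l z0"]) auto
  then show "(m l \<longlongrightarrow> m l z0) (at z0 within {z. Im z > 0})" by (simp add: LIM_zero_iff)
qed

text \<open>The reflection \<open>w \<mapsto> - cnj w\<close> fixes the imaginary axis and maps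
  solutions to solutions, so by uniqueness, which is stability with error 0, the solution is fixed
  by it.\<close>

lemma qve_solution_imaginary_axis:
  fixes S :: "'i \<Rightarrow> 'i \<Rightarrow> real"
  assumes fin: "finite I" and S: "\<And>l k. l \<in> I \<Longrightarrow> k \<in> I \<Longrightarrow> 0 \<le> S l k"
    and \<eta>: "\<eta> > 0"
    and u: "\<And>l. l \<in> I \<Longrightarrow> Im (u l) > 0 \<and> - 1 / u l = \<i> * of_real \<eta> + (\<Sum>k\<in>I. of_real (S l k) * u k)"
    and l: "l \<in> I"
  shows "u l = \<i> * of_real (Im (u l))"
    and "Im (u l) * (\<eta> + (\<Sum>k\<in>I. S l k * Im (u k))) = 1"
proof -
  have reflected: "Im (- cnj (u l)) > 0 \<and> - 1 / (- cnj (u l)) = \<i> * of_real \<eta> + (\<Sum>k\<in>I. of_real (S l k) * (- cnj (u k)))"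
    if "l \<in> I" for l
  proof -
    have "- 1 / (- cnj (u l)) = - cnj (- 1 / u l)" by simp
    also have "\<dots> = - cnj (\<i> * of_real \<eta> + (\<Sum>k\<in>I. of_real (S l k) * u k))" using u[OF that] by simp
    finally show ?thesis using u[OF that] by (simp add: sum_negf)
  qed
  have eq: "u l = \<i> * of_real (Im (u l))" if l: "l \<in> I" for l
  proof -
    have "cmod (u l - - cnj (u l)) \<le> 0 * (\<eta> + (\<Sum>l\<in>I. \<Sum>k\<in>I. S l k) / \<eta>) / \<eta> ^ 3"
      by (rule qve_stability[OF fin S u reflected \<eta> _ l]) auto
    then have "u l = - cnj (u l)" by (simp add: eq_neg_iff_add_eq_0)
    then show ?thesis by (simp add: complex_eq_iff)
  qed
  show "u l = \<i> * of_real (Im (u l))" using eq[OF l] .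
  define A where "A = \<eta> + (\<Sum>k\<in>I. S l k * Im (u k))"
  have "(\<Sum>k\<in>I. of_real (S l k) * u k) = (\<Sum>k\<in>I. of_real (S l k) * (\<i> * of_real (Im (u k))))"
    by (intro sum.cong refl arg_cong2[where f = "(*)"] eq)
  also have "\<dots> = \<i> * of_real (\<Sum>k\<in>I. S l k * Im (u k))"
    by (simp add: sum_distrib_left mult_ac)
  finally have "- 1 / u l = \<i> * of_real A" using u[OF l] by (simp add: A_def algebra_simps)
  moreover have "u l \<noteq> 0" using u[OF l] by auto
  ultimately have "u l * (\<i> * of_real A) = - 1" by (simp add: field_simps)
  then have "(\<i> * of_real (Im (u l))) * (\<i> * of_real A) = - 1" using eq[OF l] by metis
  then have "of_real (Im (u l) * A) = (1 :: complex)" by (simp add: algebra_simps)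
  then show "Im (u l) * A = 1" using of_real_eq_1_iff by blast
qed

text \<open>The error in \<open>F z - C * z powr (- \<sigma>)\<close> is at most
  \<open>e * norm (z powr (- \<sigma>))\<close> on a whole half-disc. It therefore survives \<eta>
  -> 0 at fixed \<tau>, and multiplication by \<open>\<bar>\<tau>\<bar> powr \<sigma>\<close> makes
  it independent of \<tau>.\<close>

lemma tendsto_of_tendsto_upper_half_plane:
  fixes \<rho> :: "real \<Rightarrow> real" and F :: "complex \<Rightarrow> complex"
  assumes inv: "\<And>\<tau>. \<tau> \<noteq> 0 \<Longrightarrow> ((\<lambda>\<eta>. Im (F (of_real \<tau> + \<i> * of_real \<eta>))) \<longlongrightarrow> pi * \<rho> \<tau>) (at_right 0)"
    and F: "((\<lambda>z. F z * z powr of_real \<sigma>) \<longlongrightarrow> \<i> * exp (\<i> * of_real (pi / 2 * \<sigma>)) * of_real c) (at 0 within {z. Im z > 0})"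
  shows "((\<lambda>\<tau>. \<bar>\<tau>\<bar> powr \<sigma> * \<rho> \<tau>) \<longlongrightarrow> c * cos (pi / 2 * \<sigma>) / pi) (at 0)"
proof (rule tendstoI)
  fix e :: real assume e: "e > 0"
  define C where "C = \<i> * exp (\<i> * of_real (pi / 2 * \<sigma>)) * of_real c"
  have "\<forall>\<^sub>F z in at 0 within {z. Im z > 0}. dist (F z * z powr of_real \<sigma>) C < e"
    using F e unfolding C_def by (rule tendstoD)
  then obtain d where d0: "d > 0"
    "\<forall>z\<in>{z. Im z > 0}. z \<noteq> 0 \<and> dist z 0 < d \<longrightarrow> dist (F z * z powr of_real \<sigma>) C < e"
    unfolding eventually_at by blast
  have d: "norm (F z * z powr of_real \<sigma> - C) < e" if "Im z > 0" "norm z < d" for z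
  proof -
    have "z \<noteq> 0" using that(1) by auto
    then show ?thesis using d0(2) that by (simp add: dist_norm)
  qed
  have "dist (\<bar>\<tau>\<bar> powr \<sigma> * \<rho> \<tau>) (c * cos (pi / 2 * \<sigma>) / pi) < e" if \<tau>: "\<tau> \<noteq> 0" "\<bar>\<tau>\<bar> < d" for \<tau>
  proof -
    define z where "z = (\<lambda>\<eta>. complex_of_real \<tau> + \<i> * of_real \<eta>)"
    have Imz: "Im (z \<eta>) = \<eta>" for \<eta> by (simp add: z_def)
    have zlim: "(z \<longlongrightarrow> of_real \<tau> + \<i> * of_real 0) (at_right 0)" unfolding z_def by (intro tendsto_intros)
    have "((\<lambda>\<eta>. norm (z \<eta>)) \<longlongrightarrow> norm (complex_of_real \<tau> + \<i> * of_real 0)) (at_right 0)" by (intro tendsto_intros zlim)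
    then have "\<forall>\<^sub>F \<eta> in at_right 0. norm (z \<eta>) < d" using \<tau>(2) by (intro order_tendstoD(2)) auto
    then have near: "\<forall>\<^sub>F \<eta> in at_right 0. norm (F (z \<eta>) * z \<eta> powr of_real \<sigma> - C) < e"
      using eventually_at_right_less[of "0::real"]
    proof eventually_elim
      case (elim \<eta>)
      then show ?case by (intro d) (simp_all add: Imz)
    qed
    define w where "w = exp (- of_real \<sigma> * (Ln (- \<i> * of_real \<tau>) + \<i> * of_real (pi / 2)))"
    have ne: "- \<i> * of_real \<tau> \<notin> \<real>\<^sub>\<le>\<^sub>0" using \<tau>(1) by (auto simp: complex_nonpos_Reals_iff)
    have "((\<lambda>\<eta>. exp (- of_real \<sigma> * (Ln (- \<i> * z \<eta>) + \<i> * of_real (pi / 2)))) \<longlongrightarrow>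
         exp (- of_real \<sigma> * (Ln (- \<i> * (of_real \<tau> + \<i> * of_real 0)) + \<i> * of_real (pi / 2)))) (at_right 0)"
      using ne by (intro tendsto_intros zlim) auto
    then have "((\<lambda>\<eta>. exp (- of_real \<sigma> * (Ln (- \<i> * z \<eta>) + \<i> * of_real (pi / 2)))) \<longlongrightarrow> w) (at_right 0)"
      by (simp add: w_def)
    then have wlim: "((\<lambda>\<eta>. z \<eta> powr (- of_real \<sigma>)) \<longlongrightarrow> w) (at_right 0)"
    proof (rule Lim_transform_eventually)
      show "\<forall>\<^sub>F \<eta> in at_right 0. exp (- of_real \<sigma> * (Ln (- \<i> * z \<eta>) + \<i> * of_real (pi / 2))) = z \<eta> powr (- of_real \<sigma>)"
        using eventually_at_right_less[of "0::real"]
        by eventually_elim (simp add: powr_upper_half_plane Imz)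
    qed
    \<comment> \<open>After the rotation, positive and negative \<tau> have the opposite arguments
      -pi/2 and pi/2.\<close>
    have Lnt: "Ln (- \<i> * of_real \<tau>) = of_real (ln \<bar>\<tau>\<bar>) - \<i> * of_real (sgn \<tau> * (pi / 2))"
    proof (cases "\<tau> > 0")
      case True
      then have "Ln (of_real \<tau> * (- \<i>)) = of_real (ln \<tau>) + Ln (- \<i>)"
        using Ln_times_of_real[of \<tau> "- \<i>"] by (simp add: Ln_of_real)
      then show ?thesis using True by (simp add: mult.commute)
    next
      case False
      then have "Ln (of_real (- \<tau>) * \<i>) = of_real (ln (- \<tau>)) + Ln \<i>"
        using \<tau>(1) Ln_times_of_real[of "- \<tau>" \<i>] Ln_of_real[of "- \<tau>"] by simp
      then show ?thesis using False \<tau>(1) by (simp add: mult.commute)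
    qed
    have C_w: "C * w = of_real (c * \<bar>\<tau>\<bar> powr (- \<sigma>)) * (\<i> * exp (\<i> * of_real (\<sigma> * (sgn \<tau> * (pi / 2)))))"
    proof -
      have "w = exp (of_real (- \<sigma> * ln \<bar>\<tau>\<bar>)) * (exp (\<i> * of_real (\<sigma> * (sgn \<tau> * (pi / 2)))) * exp (- \<i> * of_real (pi / 2 * \<sigma>)))"
        unfolding w_def Lnt exp_add[symmetric] by (simp add: algebra_simps)
      moreover have "exp (of_real (- \<sigma> * ln \<bar>\<tau>\<bar>)) = complex_of_real (\<bar>\<tau>\<bar> powr (- \<sigma>))"
        using \<tau>(1) by (simp only: exp_of_real) (simp add: powr_def)
      moreover have "exp (\<i> * of_real (pi / 2 * \<sigma>)) * exp (- \<i> * of_real (pi / 2 * \<sigma>)) = (1 :: complex)"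
        unfolding exp_add[symmetric] by simp
      ultimately show ?thesis unfolding C_def by (simp add: mult_ac)
    qed
    \<comment> \<open>The cosine is even, so the limits from both sides of the origin agree.\<close>
    have cosine: "cos (\<sigma> * (sgn \<tau> * (pi / 2))) = cos (pi / 2 * \<sigma>)"
      using \<tau>(1) by (cases "\<tau> > 0") (simp_all add: mult.commute)
    have ImCw: "Im (C * w) = c * \<bar>\<tau>\<bar> powr (- \<sigma>) * cos (pi / 2 * \<sigma>)"
    proof -
      have "Im (of_real x * (\<i> * exp (\<i> * of_real y))) = x * cos y" for x y
        by (simp add: cis_conv_exp[symmetric])
      then show ?thesis unfolding C_w cosine[symmetric] .
    qed
    have "((\<lambda>\<eta>. Im (F (z \<eta>)) - Im (C * z \<eta> powr (- of_real \<sigma>))) \<longlongrightarrow> pi * \<rho> \<tau> - Im (C * w)) (at_right 0)"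
      using inv[OF \<tau>(1)] unfolding z_def[symmetric] by (intro tendsto_intros wlim) (simp add: z_def)
    then have lim: "((\<lambda>\<eta>. \<bar>Im (F (z \<eta>)) - Im (C * z \<eta> powr (- of_real \<sigma>))\<bar>) \<longlongrightarrow> \<bar>pi * \<rho> \<tau> - Im (C * w)\<bar>) (at_right 0)"
      by (rule tendsto_rabs)
    have limw: "((\<lambda>\<eta>. e * norm (z \<eta> powr (- of_real \<sigma>))) \<longlongrightarrow> e * norm w) (at_right 0)"
      by (intro tendsto_intros wlim)
    have "\<bar>pi * \<rho> \<tau> - Im (C * w)\<bar> \<le> e * norm w"
    proof (rule tendsto_le[OF _ limw lim])
      show "\<forall>\<^sub>F \<eta> in at_right 0. \<bar>Im (F (z \<eta>)) - Im (C * z \<eta> powr (- of_real \<sigma>))\<bar> \<le> e * norm (z \<eta> powr (- of_real \<sigma>))"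
        using near eventually_at_right_less[of "0::real"]
      proof eventually_elim
        case (elim \<eta>)
        have z0: "z \<eta> \<noteq> 0" using Imz[of \<eta>] elim(2) by auto
        have "F (z \<eta>) - C * z \<eta> powr (- of_real \<sigma>) = (F (z \<eta>) * z \<eta> powr of_real \<sigma> - C) * z \<eta> powr (- of_real \<sigma>)"
          using z0 by (simp add: algebra_simps powr_minus)
        then have "norm (F (z \<eta>) - C * z \<eta> powr (- of_real \<sigma>)) \<le> e * norm (z \<eta> powr (- of_real \<sigma>))"
          using elim(1) by (simp add: norm_mult mult_right_mono less_imp_le)
        then show ?case
          using abs_Im_le_cmod[of "F (z \<eta>) - C * z \<eta> powr (- of_real \<sigma>)"] by simp
      qed
    qed simp
    moreover have normw: "norm w = \<bar>\<tau>\<bar> powr (- \<sigma>)"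
      unfolding w_def Lnt norm_exp_eq_Re using \<tau>(1) by (simp add: powr_def)
    ultimately have "\<bar>pi * \<rho> \<tau> - c * \<bar>\<tau>\<bar> powr (- \<sigma>) * cos (pi / 2 * \<sigma>)\<bar> \<le> e * \<bar>\<tau>\<bar> powr (- \<sigma>)"
      unfolding ImCw by simp
    then have "\<bar>\<tau>\<bar> powr \<sigma> * \<bar>pi * \<rho> \<tau> - c * \<bar>\<tau>\<bar> powr (- \<sigma>) * cos (pi / 2 * \<sigma>)\<bar> \<le> \<bar>\<tau>\<bar> powr \<sigma> * (e * \<bar>\<tau>\<bar> powr (- \<sigma>))"
      by (rule mult_left_mono) simp
    moreover have pw: "\<bar>\<tau>\<bar> powr \<sigma> * \<bar>\<tau>\<bar> powr (- \<sigma>) = 1" using \<tau>(1) by (simp add: powr_add[symmetric])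
    moreover have "\<bar>\<tau>\<bar> powr \<sigma> * \<bar>pi * \<rho> \<tau> - c * \<bar>\<tau>\<bar> powr (- \<sigma>) * cos (pi / 2 * \<sigma>)\<bar>
        = \<bar>pi * (\<bar>\<tau>\<bar> powr \<sigma> * \<rho> \<tau>) - (\<bar>\<tau>\<bar> powr \<sigma> * \<bar>\<tau>\<bar> powr (- \<sigma>)) * (c * cos (pi / 2 * \<sigma>))\<bar>"
    proof -
      have "pi * (\<bar>\<tau>\<bar> powr \<sigma> * \<rho> \<tau>) - (\<bar>\<tau>\<bar> powr \<sigma> * \<bar>\<tau>\<bar> powr (- \<sigma>)) * (c * cos (pi / 2 * \<sigma>))
          = \<bar>\<tau>\<bar> powr \<sigma> * (pi * \<rho> \<tau> - c * \<bar>\<tau>\<bar> powr (- \<sigma>) * cos (pi / 2 * \<sigma>))"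
        by (simp only: right_diff_distrib mult_ac)
      then show ?thesis by (simp only: abs_mult) simp
    qed
    ultimately have le: "\<bar>pi * (\<bar>\<tau>\<bar> powr \<sigma> * \<rho> \<tau>) - c * cos (pi / 2 * \<sigma>)\<bar> \<le> e"
      by (simp add: mult.assoc mult.left_commute[of _ e])
    have "\<bar>\<tau>\<bar> powr \<sigma> * \<rho> \<tau> - c * cos (pi / 2 * \<sigma>) / pi = (pi * (\<bar>\<tau>\<bar> powr \<sigma> * \<rho> \<tau>) - c * cos (pi / 2 * \<sigma>)) / pi"
      by (simp add: field_simps)
    then have "dist (\<bar>\<tau>\<bar> powr \<sigma> * \<rho> \<tau>) (c * cos (pi / 2 * \<sigma>) / pi) = \<bar>pi * (\<bar>\<tau>\<bar> powr \<sigma> * \<rho> \<tau>) - c * cos (pi / 2 * \<sigma>)\<bar> / pi"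
      unfolding dist_real_def by (simp add: abs_divide)
    also have "\<dots> \<le> e / pi" using le by (intro divide_right_mono) auto
    also have "\<dots> < e" using e pi_gt3 by (simp add: field_simps)
    finally show ?thesis .
  qed
  then show "\<forall>\<^sub>F \<tau> in at 0. dist (\<bar>\<tau>\<bar> powr \<sigma> * \<rho> \<tau>) (c * cos (pi / 2 * \<sigma>) / pi) < e"
    unfolding eventually_at using d0(1) by (intro exI[of _ d]) auto
qed

theorem theorem2p8:
  fixes K :: nat and S :: "nat \<Rightarrow> nat \<Rightarrow> real" and \<rho> :: "real \<Rightarrow> real"
  assumes "1 \<le> K"
    and "symmetric_matrix K S"
    and "nonneg_matrix K S"
    and "has_support K S"
    and "is_scdos_density K S \<rho>"
  shows "\<exists>c>0. ((\<lambda>\<tau>. \<bar>\<tau>\<bar> powr (real (ell_lhd K S) / (real (ell_lhd K S) + 2)) * \<rho> \<tau>) \<longlongrightarrow> c) (at 0)"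
proof -
  let ?I = "{1..K}" and ?U = "at 0 within {z. Im z > 0}"
  have S0: "0 \<le> S l k" if "l \<in> ?I" "k \<in> ?I" for l k
    using assms(3) that unfolding nonneg_matrix_def by blast
  have \<rho>c: "continuous_on (- {0}) \<rho>" and \<rho>0: "\<And>x. x \<noteq> 0 \<Longrightarrow> 0 \<le> \<rho> x"
    using assms(5) unfolding is_scdos_density_def by blast+
  obtain \<mu> where \<mu>: "is_scdos K S \<mu>"
    and dens: "restrict_space \<mu> (- {0}) = density (restrict_space lborel (- {0})) (\<lambda>\<tau>. ennreal (\<rho> \<tau>))"
    using assms(5) unfolding is_scdos_density_def by blast
  have \<mu>r: "real_distribution \<mu>" using \<mu> unfolding is_scdos_def by blast
  obtain m where m0: "solves_qve K S m"
    and mF: "\<And>z. Im z > 0 \<Longrightarrow> stieltjes \<mu> z = (\<Sum>k\<in>?I. m k z) / of_nat K"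
    using \<mu> unfolding is_scdos_def by blast
  have m: "Im (m l z) > 0 \<and> - 1 / m l z = z + (\<Sum>k\<in>?I. of_real (S l k) * m k z)" if "Im z > 0" "l \<in> ?I" for z l
    using m0 that unfolding solves_qve_def by blast
  have "\<exists>r C. C \<noteq> 0 \<and> ((\<lambda>z. m k z * z powr (- of_real r)) \<longlongrightarrow> C) ?U" if k: "k \<in> ?I" for k
  proof -
    obtain E a where E: "finite E" "E \<noteq> {}" "\<forall>e\<in>E. a e \<noteq> (0::complex)"
      "\<forall>z. Im z > 0 \<longrightarrow> (\<Sum>e\<in>E. a e * z ^ fst e * m k z ^ snd e) = 0"
      using qve_algebraic[OF S0 m k] by blast
    have "m k z \<noteq> 0" if "Im z > 0" for z using m[OF that k] by auto
    then show ?thesis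
      using puiseux_leading_term[OF E(1,2), of a "m k"] E(3,4) continuous_on_qve_solution[OF _ S0 m k] by blast
  qed
  then have "\<forall>k\<in>?I. \<exists>p. snd p \<noteq> 0 \<and> ((\<lambda>z. m k z * z powr (- of_real (fst p))) \<longlongrightarrow> snd p) ?U" by force
  from bchoice[OF this] obtain p where p: "\<forall>k\<in>?I. snd (p k) \<noteq> 0 \<and> ((\<lambda>z. m k z * z powr (- of_real (fst (p k)))) \<longlongrightarrow> snd (p k)) ?U" ..
  define r where "r = (\<lambda>k. fst (p k))"
  define C where "C = (\<lambda>k. snd (p k))"
  have C: "C k \<noteq> 0" "((\<lambda>z. m k z * z powr (- of_real (r k))) \<longlongrightarrow> C k) ?U" if "k \<in> ?I" for k
    using p that by (auto simp: C_def r_def)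
  define v where "v = (\<lambda>l \<eta>. Im (m l (\<i> * of_real \<eta>)))"
  have Im_i: "Im (\<i> * of_real \<eta>) > 0" if "\<eta> > 0" for \<eta> using that by simp
  have v: "v l \<eta> > 0 \<and> v l \<eta> * (\<eta> + (\<Sum>k\<in>?I. S l k * v k \<eta>)) = 1" and v_m: "m l (\<i> * of_real \<eta>) = \<i> * of_real (v l \<eta>)"
    if "l \<in> ?I" "\<eta> > 0" for l \<eta>
    using qve_solution_imaginary_axis[of ?I S \<eta> "\<lambda>l. m l (\<i> * of_real \<eta>)" l] S0 m[OF Im_i[OF that(2)]] that
    unfolding v_def by auto
  \<comment> \<open>At \<open>\<i> * \<eta>\<close> the power \<open>z powr r\<close> has the phase
    \<open>exp (\<i> * pi / 2 * r)\<close> and the solution has the phase \<open>\<i>\<close>;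
    removing both leaves the leading coefficient of \<open>v l\<close>.\<close>
  define c where "c = (\<lambda>l. Re (C l * exp (\<i> * of_real (pi / 2 * r l)) / \<i>))"
  have axis: "filterlim (\<lambda>\<eta>. \<i> * complex_of_real \<eta>) ?U (at_right 0)"
    unfolding filterlim_at
    by (auto intro!: tendsto_eq_intros eventually_mono[OF eventually_at_right_less])
  have vc: "c l > 0 \<and> ((\<lambda>\<eta>. v l \<eta> * \<eta> powr (- r l)) \<longlongrightarrow> c l) (at_right 0) \<and> C l = \<i> * exp (\<i> * of_real (- (pi / 2 * r l))) * of_real (c l)"
    if l: "l \<in> ?I" for l
  proof -
    define D where "D = C l * exp (\<i> * of_real (pi / 2 * r l)) / \<i>"
    have "((\<lambda>\<eta>. m l (\<i> * of_real \<eta>) * (\<i> * of_real \<eta>) powr (- of_real (r l))) \<longlongrightarrow> C l) (at_right 0)"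
      by (rule filterlim_compose[OF C(2)[OF l] axis])
    then have "((\<lambda>\<eta>. m l (\<i> * of_real \<eta>) * (\<i> * of_real \<eta>) powr (- of_real (r l)) * exp (\<i> * of_real (pi / 2 * r l)) / \<i>) \<longlongrightarrow> D) (at_right 0)"
      unfolding D_def by (intro tendsto_intros) auto
    moreover have "\<forall>\<^sub>F \<eta> in at_right 0. m l (\<i> * of_real \<eta>) * (\<i> * of_real \<eta>) powr (- of_real (r l)) * exp (\<i> * of_real (pi / 2 * r l)) / \<i>
        = of_real (v l \<eta> * \<eta> powr (- r l))"
      using eventually_at_right_less[of "0::real"]
    proof eventually_elim
      case (elim \<eta>)
      have "Ln (- \<i> * (\<i> * of_real \<eta>)) = of_real (ln \<eta>)" using elim by (simp add: Ln_of_real)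
      then have "(\<i> * of_real \<eta>) powr (- of_real (r l)) = exp (of_real (- r l * ln \<eta>)) * exp (- (\<i> * of_real (pi / 2 * r l)))"
        unfolding powr_upper_half_plane[OF Im_i[OF elim]] exp_add[symmetric] by (simp add: algebra_simps)
      also have "exp (complex_of_real (- r l * ln \<eta>)) = of_real (\<eta> powr (- r l))"
        using elim by (simp only: exp_of_real) (simp add: powr_def)
      finally have pw: "(\<i> * of_real \<eta>) powr (- of_real (r l)) * exp (\<i> * of_real (pi / 2 * r l)) = of_real (\<eta> powr (- r l))"
        by (simp add: mult.assoc exp_add[symmetric])
      show ?case unfolding v_m[OF l elim] mult.assoc pw by simp
    qed
    ultimately have lim: "((\<lambda>\<eta>. complex_of_real (v l \<eta> * \<eta> powr (- r l))) \<longlongrightarrow> D) (at_right 0)"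
      by (rule Lim_transform_eventually)
    have Re: "((\<lambda>\<eta>. v l \<eta> * \<eta> powr (- r l)) \<longlongrightarrow> Re D) (at_right 0)" using tendsto_Re[OF lim] by simp
    have "((\<lambda>\<eta>. 0) \<longlongrightarrow> Im D) (at_right (0::real))" using tendsto_Im[OF lim] by simp
    then have "Im D = 0" by (simp add: tendsto_const_iff)
    then have D: "D = of_real (Re D)" by (simp add: complex_eq_iff)
    \<comment> \<open>A limit of positive quantities is only nonnegative; strict positivity follows
      from \<open>C l \<noteq> 0\<close>.\<close>
    have "Re D \<ge> 0"
    proof (rule tendsto_lowerbound[OF Re])
      show "\<forall>\<^sub>F \<eta> in at_right 0. 0 \<le> v l \<eta> * \<eta> powr (- r l)"
        by (rule eventually_mono[OF eventually_at_right_less]) (use v[OF l] in \<open>simp add: less_imp_le\<close>)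
    qed simp
    moreover have "D \<noteq> 0" using C(1)[OF l] by (simp add: D_def)
    ultimately have "Re D > 0" using D by (metis less_eq_real_def of_real_0)
    moreover have "C l = \<i> * exp (\<i> * of_real (- (pi / 2 * r l))) * D"
    proof -
      have "exp (\<i> * of_real (- (pi / 2 * r l))) * exp (\<i> * of_real (pi / 2 * r l)) = (1::complex)"
        unfolding exp_add[symmetric] by simp
      then show ?thesis unfolding D_def by (simp add: mult_ac)
    qed
    ultimately show ?thesis using Re D unfolding c_def D_def[symmetric] by simp
  qed
  define \<sigma> where "\<sigma> = real (ell_lhd K S) / (real (ell_lhd K S) + 2)"
  have min: "Min (r ` ?I) = - \<sigma>"
    unfolding \<sigma>_def by (rule ell_lhd_min_exponent[OF assms(1-4), where v = v and c = c and r = r]) (use v vc in blast)+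
  have \<sigma>: "0 \<le> \<sigma>" "\<sigma> < 1" by (auto simp: \<sigma>_def field_simps)
  have r_ge: "r k \<ge> - \<sigma>" if "k \<in> ?I" for k
  proof -
    have "Min (r ` ?I) \<le> r k" using that by (intro Min_le) auto
    then show ?thesis unfolding min .
  qed
  \<comment> \<open>The components that blow up fastest; after multiplication by
    \<open>z powr \<sigma>\<close> the others tend to 0.\<close>
  define Q where "Q = {k \<in> ?I. r k = - \<sigma>}"
  have "Min (r ` ?I) \<in> r ` ?I" using assms(1) by (intro Min_in) auto
  then have Q: "Q \<noteq> {}" "finite Q" unfolding min by (auto simp: Q_def)
  define c0 where "c0 = (\<Sum>k\<in>Q. c k) / K"
  have c0: "c0 > 0" unfolding c0_def using Q vc assms(1) by (intro divide_pos_pos sum_pos) (auto simp: Q_def)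
  have term_lim: "((\<lambda>z. m k z * z powr of_real \<sigma>) \<longlongrightarrow> (if k \<in> Q then C k else 0)) ?U" if k: "k \<in> ?I" for k
  proof (cases "k \<in> Q")
    case True
    then have "r k = - \<sigma>" by (simp add: Q_def)
    then show ?thesis using C(2)[OF k] True by simp
  next
    case False
    then have pos: "r k + \<sigma> > 0" using r_ge[OF k] k by (auto simp: Q_def)
    have n0: "((\<lambda>z. norm z) \<longlongrightarrow> 0) ?U" by (intro tendsto_eq_intros) auto
    have "((\<lambda>z. norm z powr (r k + \<sigma>)) \<longlongrightarrow> 0) ?U"
      by (rule tendsto_zero_powrI[OF n0 tendsto_const _ pos]) simp
    then have "((\<lambda>z. z powr of_real (r k + \<sigma>)) \<longlongrightarrow> 0) ?U"
      by (intro tendsto_norm_zero_cancel[of "\<lambda>z. z powr of_real (r k + \<sigma>)"]) (simp add: norm_powr_real_powr')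
    then have "((\<lambda>z. (m k z * z powr (- of_real (r k))) * z powr of_real (r k + \<sigma>)) \<longlongrightarrow> C k * 0) ?U"
      by (intro tendsto_mult C(2)[OF k])
    moreover have "(\<lambda>z. (m k z * z powr (- of_real (r k))) * z powr of_real (r k + \<sigma>)) = (\<lambda>z. m k z * z powr of_real \<sigma>)"
      by (simp add: mult.assoc powr_add[symmetric])
    ultimately show ?thesis using False by (simp only: mult_zero_right if_False)
  qed
  \<comment> \<open>For \<open>r k = - \<sigma>\<close> the phase of \<open>C k\<close> does not
    depend on \<open>k\<close>, so the leading coefficients add up without cancellation.\<close>
  have sumC: "(\<Sum>k\<in>?I. if k \<in> Q then C k else 0) / of_nat K = \<i> * exp (\<i> * of_real (pi / 2 * \<sigma>)) * of_real c0"
  proof -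
    have "(\<Sum>k\<in>?I. if k \<in> Q then C k else 0) = (\<Sum>k\<in>Q. C k)"
      by (simp add: sum.If_cases Q_def Int_def cong: conj_cong)
    also have "\<dots> = (\<Sum>k\<in>Q. \<i> * exp (\<i> * of_real (pi / 2 * \<sigma>)) * of_real (c k))"
      using vc by (intro sum.cong) (auto simp: Q_def)
    finally show ?thesis by (simp add: c0_def sum_distrib_left[symmetric])
  qed
  have "((\<lambda>z. (\<Sum>k\<in>?I. m k z * z powr of_real \<sigma>) / of_nat K) \<longlongrightarrow> (\<Sum>k\<in>?I. if k \<in> Q then C k else 0) / of_nat K) ?U"
    using assms(1) by (intro tendsto_divide tendsto_sum term_lim tendsto_const) auto
  then have "((\<lambda>z. stieltjes \<mu> z * z powr of_real \<sigma>) \<longlongrightarrow> \<i> * exp (\<i> * of_real (pi / 2 * \<sigma>)) * of_real c0) ?U"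
    unfolding sumC
  proof (rule Lim_transform_eventually)
    show "\<forall>\<^sub>F z in ?U. (\<Sum>k\<in>?I. m k z * z powr of_real \<sigma>) / of_nat K = stieltjes \<mu> z * z powr of_real \<sigma>"
      unfolding eventually_at using mF by (intro exI[of _ 1]) (auto simp: sum_distrib_right)
  qed
  from tendsto_of_tendsto_upper_half_plane[OF stieltjes_inversion_off_zero[OF \<mu>r \<rho>c \<rho>0 dens] this]
  have "((\<lambda>\<tau>. \<bar>\<tau>\<bar> powr \<sigma> * \<rho> \<tau>) \<longlongrightarrow> c0 * cos (pi / 2 * \<sigma>) / pi) (at 0)" .
  \<comment> \<open>As \<open>\<sigma> < 1\<close>, the angle lies in the interval from 0 up to, but
    not including, pi/2.\<close>
  moreover have "cos (pi / 2 * \<sigma>) > 0"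
    using \<sigma> by (intro cos_gt_zero_pi) (auto simp: field_simps intro: less_le_trans[of _ 0] mult_nonneg_nonneg)
  ultimately show ?thesis using c0 unfolding \<sigma>_def by (intro exI[of _ "c0 * cos (pi / 2 * \<sigma>) / pi"]) (auto simp: \<sigma>_def)
qed

end
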